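(* Let $H,A,\sigma,W,F,F_0,a$ satisfy the standing assumptions (A1)–(A4) listed in the context, and let $x\in H$. Then there exists a pseudo-weak solution $\{X^x_t\}_{t\ge0}$ (defined in the context) of $$dX_t=(AX_t+F(t,X_t))\,dt+\sigma\,dW_t,\qquad X_0=x,$$ i.e. $$X^x_t:=Z^x_t+W_{0,A,\sigma}(t),\qquad t\ge0,$$ where the process $Z^x_t$ is a pseudo-weak limit point, as $\alpha\to0$, of $Z^x_{\alpha,t}$, and $Z^x_{\alpha,t}$ is the continuous mild solution of $dZ^x_{\alpha,t}=(AZ^x_{\alpha,t}+F_\alpha(t,Z^x_{\alpha,t}+W_{0,A,\sigma}(t)))\,dt$, $Z^x_{\alpha,0}=x$. Moreover, $(dt\times\mathbb P)$-a.s., $$|X^x_t|_H\le|x|_He^{-\beta t}+\int_0^te^{-\beta(t-s)}a\big(|W_{0,A,\sigma}(s)|_H\big)\,ds+|W_{0,A,\sigma}(t)|_H .$$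
   Context: Setting. $H$ is a real separable Hilbert space with inner product $\langle\cdot,\cdot\rangle$ and norm $|\cdot|_H$; $B(H)$ is the space of bounded linear operators with operator norm $\|\cdot\|$; $\|\cdot\|_{HS}$ is the Hilbert–Schmidt norm. $W_t$ is a cylindrical Wiener process in $H$ on a filtered probability space $(\Omega,\mathcal F,\mathcal F_t,\mathbb P)$ satisfying the usual conditions. (A1) $(A,D_A)$ generates a $C_0$-semigroup $e^{tA}$ on $H$ and there is $\beta>0$ with $\langle Ax,x\rangle\le-\beta|x|_H^2$ for all $x\in D_A$. (A2) $\sigma,\sigma^{-1}\in B(H)$, $\sigma$ is self-adjoint and positive, and for some $\varepsilon>0$, $\int_0^T t^{-\varepsilon}\|e^{tA}\sigma\|_{HS}^2\,dt<\infty$ for all $T>0$. The Ornstein–Uhlenbeck process $W_{x,A,\sigma}(t):=e^{tA}x+\int_0^te^{(t-s)A}\sigma\,dW_s$, $t\ge0$, is then pathwise continuous. (A3) $F(t,\cdot):D_F\to2^H$, $t\in[0,\infty)$, is a family of maps ($2^H$ is the power set of $H$), where $D_F\subset H$ is a non-empty Borel set, and $dt\otimes\mathbb P$-almost surely $W_{x,A,\sigma}\in D_F$ for all $x\in D_F$. Each $F(t,\cdot)$ is $m$-dissipative: $\langle y_1-y_2,x_1-x_2\rangle\le0$ for all $x_1,x_2\in D_F$, $y_i\in F(t,x_i)$, and $\{\alpha x-y: x\in D_F,\ y\in F(t,x)\}=H$ for every $\alpha>0$, $t\ge 0$. Then $F(t,x)$ is non-empty, closed and convex for $x\in D_F$,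 and $F_0(t,x)$ denotes its unique element of minimal norm. (A4) $a(r):=\sup_{x\in B_r\cap D_F}\sup_{t\ge0}|F_0(t,x)|_H<\infty$ for all $r>0$, where $B_r=\{x\in H:|x|_H<r\}$; also $a(0):=0$. Yosida approximation: for $\alpha>0$, $F_\alpha(t,x):=\frac1\alpha\big((I-\alpha F(t,\cdot))^{-1}(x)-x\big)$, $x\in H$; it is single-valued, dissipative, and Lipschitz in $x$ uniformly in $t$. $F_0$ and $F_\alpha$ are jointly Borel measurable in $(t,x)$. Approximating processes: $X^x_\alpha=(X^x_{\alpha,t})_{t\ge0}$ is the mild solution, with $\mathbb P$-a.s. continuous sample paths, of $dX_t=(AX_t+F_\alpha(t,X_t))\,dt+\sigma\,dW_t$, $X_0=x$. Equivalently $X^x_{\alpha,t}=Z^x_{\alpha,t}+W_{0,A,\sigma}(t)$, where $Z^x_\alpha$ is the continuous mild solution of the random equation displayed in the claim. Pseudo-weak convergence: let $\psi(h)=\frac{h}{1+|h|_H}$, $h\in H$. For a $\sigma$-finite measure space $(S,\mathcal S,\mu)$, let $L^0(S,\mu;H)$ be the space of $\mu$-a.e. equivalence classes of measurable $H$-valued functions. A sequence $f_n\in L^0(S,\mu;H)$ converges pseudo-weakly to $f\in L^0(S,\mu;H)$ if $\psi(f_n)\rightharpoonup\psi(f)$ weakly in $L^2(S,\mathbb 1_B\,\mu;H)$ for every $B\in\mathcal S$ with $\mu(B)<\infty$. A pseudo-weak limit point as $\alpha\to0$ of a family indexed by $\alpha>0$ is a pseudo-weak limit along some sequence $\alpha_n\to0$;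 here $(S,\mu)=([0,\infty)\times\Omega,\ dt\times\mathbb P)$. Pseudo-weak solution: an adapted $H$-valued process $X^x$ which is a pseudo-weak limit point in $L^2([0,\infty)\times\Omega,\ dt\times\mathbb P;\ H)$ of the approximating processes $X^x_\alpha$. *)

theory Defs
  imports "HOL-Probability.Probability"
begin

section \<open>Semigroups and Hilbert--Schmidt norm\<close>

definition c0_semigroup :: "(real \<Rightarrow> ('h::real_normed_vector \<Rightarrow>\<^sub>L 'h)) \<Rightarrow> bool" where
  "c0_semigroup S \<longleftrightarrow>
     S 0 = id_blinfun \<and>
     (\<forall>s\<ge>0. \<forall>t\<ge>0. S (s + t) = S s o\<^sub>L S t) \<and>
     (\<forall>x. ((\<lambda>t. S t x) \<longlongrightarrow> x) (at_right 0))"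

text \<open>The operator \<open>A\<close> with domain \<open>D\<close> is the infinitesimal generator of \<open>S\<close>, so that
  \<open>S t\<close> is what is usually written \<open>exp (t A)\<close>. Values of \<open>A\<close> outside \<open>D\<close> play no role.\<close>

definition generates_c0_semigroup ::
    "('h::real_normed_vector \<Rightarrow> 'h) \<Rightarrow> 'h set \<Rightarrow> (real \<Rightarrow> ('h \<Rightarrow>\<^sub>L 'h)) \<Rightarrow> bool" where
  "generates_c0_semigroup A D S \<longleftrightarrow>
     c0_semigroup S \<and>
     D = {x. \<exists>y. ((\<lambda>t. (1 / t) *\<^sub>R (S t x - x)) \<longlongrightarrow> y) (at_right 0)} \<and>
     (\<forall>x\<in>D. ((\<lambda>t. (1 / t) *\<^sub>R (S t x - x)) \<longlongrightarrow> A x) (at_right 0))"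

definition orthonormal_basis :: "'h::real_inner set \<Rightarrow> bool" where
  "orthonormal_basis E \<longleftrightarrow>
     (\<forall>e\<in>E. \<forall>f\<in>E. inner e f = (if e = f then 1 else 0)) \<and> closure (span E) = UNIV"

text \<open>Squared Hilbert--Schmidt norm, with value \<open>\<infinity>\<close> if the operator is not Hilbert--Schmidt.
  The sum does not depend on the chosen orthonormal basis.\<close>

definition hs_norm_sq :: "('h::real_inner \<Rightarrow>\<^sub>L 'h) \<Rightarrow> ennreal" where
  "hs_norm_sq T =
     (\<integral>\<^sup>+ e. ennreal ((norm (T e))\<^sup>2) \<partial>count_space (SOME E. orthonormal_basis E))"


section \<open>Cylindrical Wiener process and the stochastic convolution\<close>

definition usual_filtration :: "'w measure \<Rightarrow> (real \<Rightarrow> 'w measure) \<Rightarrow> bool" where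
  "usual_filtration M Filt \<longleftrightarrow>
     (\<forall>t\<ge>0. subalgebra M (Filt t)) \<and>
     (\<forall>s t. 0 \<le> s \<and> s \<le> t \<longrightarrow> sets (Filt s) \<subseteq> sets (Filt t)) \<and>
     (\<forall>N\<in>null_sets M. \<forall>N'\<subseteq>N. N' \<in> sets (Filt 0)) \<and>
     (\<forall>t\<ge>0. sets (Filt t) = (\<Inter>s\<in>{t<..}. sets (Filt s)))"

definition adapted :: "(real \<Rightarrow> 'w measure) \<Rightarrow> (real \<Rightarrow> 'w \<Rightarrow> 'b::topological_space) \<Rightarrow> bool" where
  "adapted Filt X \<longleftrightarrow> (\<forall>t\<ge>0. X t \<in> borel_measurable (Filt t))"

text \<open>\<open>W t h\<close> is the real random variable \<open>\<langle>W\<^sub>t, h\<rangle>\<close>; a cylindrical Wiener process does not take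
  values in the Hilbert space itself. Linearity in \<open>h\<close> together with the law of the increments
  and their independence of the past determines the joint law
  (covariance \<open>min s t * inner g h\<close>).\<close>

definition cylindrical_wiener ::
    "'w measure \<Rightarrow> (real \<Rightarrow> 'w measure) \<Rightarrow> (real \<Rightarrow> 'h::real_inner \<Rightarrow> 'w \<Rightarrow> real) \<Rightarrow> bool" where
  "cylindrical_wiener M Filt W \<longleftrightarrow>
     (\<forall>h. adapted Filt (\<lambda>t. W t h)) \<and>
     (\<forall>h. AE \<omega> in M. W 0 h \<omega> = 0) \<and>
     (\<forall>h. AE \<omega> in M. continuous_on {0..} (\<lambda>t. W t h \<omega>)) \<and>
     (\<forall>t\<ge>0. \<forall>a b g h. AE \<omega> in M. W t (a *\<^sub>R g + b *\<^sub>R h) \<omega> = a * W t g \<omega> + b * W t h \<omega>) \<and>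
     (\<forall>s t h. 0 \<le> s \<and> s < t \<and> h \<noteq> 0 \<longrightarrow>
        distributed M lborel (\<lambda>\<omega>. W t h \<omega> - W s h \<omega>)
          (\<lambda>r. ennreal (normal_density 0 (sqrt (t - s) * norm h) r)) \<and>
        prob_space.indep_set M (sets (Filt s))
          {(\<lambda>\<omega>. W t h \<omega> - W s h \<omega>) -` B \<inter> space M | B. B \<in> sets borel})"

text \<open>A list of tuples \<open>(a, b, h, u)\<close> represents the deterministic finite-rank step function
  \<open>s \<mapsto> \<Sum> 1\<^bsub>(a,b]\<^esub>(s) u \<otimes> h\<close>, where \<open>u \<otimes> h\<close> maps \<open>y\<close> to \<open>\<langle>h, y\<rangle> u\<close>. Its stochastic integral
  is \<open>\<Sum> (W\<^sub>b h - W\<^sub>a h) u\<close>.\<close>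

definition step_integrand ::
    "(real \<times> real \<times> 'h \<times> 'h) list \<Rightarrow> real \<Rightarrow> ('h::real_inner \<Rightarrow>\<^sub>L 'h)" where
  "step_integrand xs s =
     (\<Sum>(a, b, h, u)\<leftarrow>xs.
        if a < s \<and> s \<le> b then blinfun_scaleR_left u o\<^sub>L blinfun_inner_left h else 0)"

definition step_integral ::
    "(real \<Rightarrow> 'h::real_inner \<Rightarrow> 'w \<Rightarrow> real) \<Rightarrow> (real \<times> real \<times> 'h \<times> 'h) list \<Rightarrow> 'w \<Rightarrow> 'h" where
  "step_integral W xs \<omega> = (\<Sum>(a, b, h, u)\<leftarrow>xs. (W b h \<omega> - W a h \<omega>) *\<^sub>R u)"

text \<open>\<open>I\<close> is (a version of) \<open>\<integral>\<^sub>0\<^sup>t \<Phi> dW\<close> for a deterministic integrand \<open>\<Phi>\<close>: the mean-square limit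
  of the integrals of step functions approximating \<open>\<Phi>\<close> in
  \<open>L\<^sup>2(0,t)\<close> with respect to the Hilbert--Schmidt norm.\<close>

definition is_wiener_integral ::
    "'w measure \<Rightarrow> (real \<Rightarrow> 'h::{real_inner, banach, second_countable_topology} \<Rightarrow> 'w \<Rightarrow> real) \<Rightarrow>
     real \<Rightarrow> (real \<Rightarrow> ('h \<Rightarrow>\<^sub>L 'h)) \<Rightarrow> ('w \<Rightarrow> 'h) \<Rightarrow> bool" where
  "is_wiener_integral M W t \<Phi> I \<longleftrightarrow>
     I \<in> borel_measurable M \<and>
     (\<exists>xs :: nat \<Rightarrow> (real \<times> real \<times> 'h \<times> 'h) list.
        (\<forall>n. \<forall>(a, b, h, u)\<in>set (xs n). 0 \<le> a \<and> a \<le> b \<and> b \<le> t) \<and>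
        (\<lambda>n. \<integral>\<^sup>+ s\<in>{0..t}. hs_norm_sq (step_integrand (xs n) s - \<Phi> s) \<partial>lborel) \<longlonglongrightarrow> 0 \<and>
        (\<lambda>n. \<integral>\<^sup>+ \<omega>. ennreal ((norm (step_integral W (xs n) \<omega> - I \<omega>))\<^sup>2) \<partial>M) \<longlonglongrightarrow> 0)"

text \<open>\<open>V\<close> is the pathwise continuous version of \<open>t \<mapsto> \<integral>\<^sub>0\<^sup>t exp ((t-s) A) \<sigma> dW\<^sub>s\<close>, that is, of the
  Ornstein--Uhlenbeck process started in \<open>0\<close>. It is unique up to indistinguishability.
  The process started in \<open>x\<close> is \<open>S t x + V t\<close>.\<close>

definition stochastic_convolution ::
    "'w measure \<Rightarrow> (real \<Rightarrow> 'h::{real_inner, banach, second_countable_topology} \<Rightarrow> 'w \<Rightarrow> real) \<Rightarrow>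
     (real \<Rightarrow> ('h \<Rightarrow>\<^sub>L 'h)) \<Rightarrow> ('h \<Rightarrow>\<^sub>L 'h) \<Rightarrow> (real \<Rightarrow> 'w \<Rightarrow> 'h) \<Rightarrow> bool" where
  "stochastic_convolution M W S \<sigma> V \<longleftrightarrow>
     (\<forall>t\<ge>0. is_wiener_integral M W t (\<lambda>s. S (t - s) o\<^sub>L \<sigma>) (V t)) \<and>
     (\<forall>\<omega>\<in>space M. continuous_on {0..} (\<lambda>t. V t \<omega>))"


section \<open>Dissipative maps\<close>

definition m_dissipative :: "'h::real_inner set \<Rightarrow> ('h \<Rightarrow> 'h set) \<Rightarrow> bool" where
  "m_dissipative D G \<longleftrightarrow>
     (\<forall>x\<^sub>1\<in>D. \<forall>x\<^sub>2\<in>D. \<forall>y\<^sub>1\<in>G x\<^sub>1. \<forall>y\<^sub>2\<in>G x\<^sub>2. inner (y\<^sub>1 - y\<^sub>2) (x\<^sub>1 - x\<^sub>2) \<le> 0) \<and>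
     (\<forall>\<alpha>>0. {\<alpha> *\<^sub>R x - y | x y. x \<in> D \<and> y \<in> G x} = UNIV)"

definition minimal_section :: "('h::real_normed_vector \<Rightarrow> 'h set) \<Rightarrow> 'h \<Rightarrow> 'h" where
  "minimal_section G x = (THE y. y \<in> G x \<and> (\<forall>z\<in>G x. norm y \<le> norm z))"

definition resolvent :: "'h::real_vector set \<Rightarrow> ('h \<Rightarrow> 'h set) \<Rightarrow> real \<Rightarrow> 'h \<Rightarrow> 'h" where
  "resolvent D G \<alpha> x = (THE u. u \<in> D \<and> (\<exists>y\<in>G u. u - \<alpha> *\<^sub>R y = x))"

definition yosida :: "'h::real_vector set \<Rightarrow> ('h \<Rightarrow> 'h set) \<Rightarrow> real \<Rightarrow> 'h \<Rightarrow> 'h" where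
  "yosida D G \<alpha> x = (1 / \<alpha>) *\<^sub>R (resolvent D G \<alpha> x - x)"

text \<open>The function \<open>a\<close>. Since \<open>ball 0 0\<close> is empty and \<open>Sup {} = 0\<close> in \<^typ>\<open>ennreal\<close>, it
  satisfies \<open>a(0) = 0\<close>.\<close>

definition growth_bound ::
    "'h::real_normed_vector set \<Rightarrow> (real \<Rightarrow> 'h \<Rightarrow> 'h set) \<Rightarrow> real \<Rightarrow> ennreal" where
  "growth_bound D F r =
     (\<Squnion>x\<in>ball 0 r \<inter> D. \<Squnion>t\<in>{0..}. ennreal (norm (minimal_section (F t) x)))"

lemma growth_bound_0: "growth_bound D F 0 = 0"
  by (simp add: growth_bound_def bot_ennreal)


section \<open>Pseudo-weak convergence\<close>

definition psi :: "'h::real_normed_vector \<Rightarrow> 'h" where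
  "psi h = (1 / (1 + norm h)) *\<^sub>R h"

definition L2 :: "'s measure \<Rightarrow> ('s \<Rightarrow> 'h::real_normed_vector) set" where
  "L2 N = {f \<in> borel_measurable N. integrable N (\<lambda>z. (norm (f z))\<^sup>2)}"

definition weakly_converges_L2 ::
    "'s measure \<Rightarrow> (nat \<Rightarrow> 's \<Rightarrow> 'h::real_inner) \<Rightarrow> ('s \<Rightarrow> 'h) \<Rightarrow> bool" where
  "weakly_converges_L2 N f g \<longleftrightarrow>
     (\<forall>n. f n \<in> L2 N) \<and> g \<in> L2 N \<and>
     (\<forall>k\<in>L2 N. (\<lambda>n. \<integral>z. inner (f n z) (k z) \<partial>N) \<longlonglongrightarrow> (\<integral>z. inner (g z) (k z) \<partial>N))"

definition pseudo_weakly_converges ::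
    "'s measure \<Rightarrow> (nat \<Rightarrow> 's \<Rightarrow> 'h::real_inner) \<Rightarrow> ('s \<Rightarrow> 'h) \<Rightarrow> bool" where
  "pseudo_weakly_converges N f g \<longleftrightarrow>
     (\<forall>n. f n \<in> borel_measurable N) \<and> g \<in> borel_measurable N \<and>
     (\<forall>B\<in>sets N. emeasure N B < \<infinity> \<longrightarrow>
        weakly_converges_L2 (density N (indicator B)) (\<lambda>n z. psi (f n z)) (\<lambda>z. psi (g z)))"

text \<open>\<open>dt \<otimes> P\<close> on \<open>[0,\<infinity>) \<times> \<Omega>\<close>\<close>

definition time_product :: "'w measure \<Rightarrow> (real \<times> 'w) measure" where
  "time_product M = restrict_space lborel {0..} \<Otimes>\<^sub>M M"

text \<open>\<open>X\<close> is a pseudo-weak limit point of the family of processes \<open>Y \<alpha>\<close> as \<open>\<alpha> \<rightarrow> 0+\<close>.\<close>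

definition pseudo_weak_limit_point ::
    "'w measure \<Rightarrow> (real \<Rightarrow> real \<Rightarrow> 'w \<Rightarrow> 'h::real_inner) \<Rightarrow> (real \<Rightarrow> 'w \<Rightarrow> 'h) \<Rightarrow> bool" where
  "pseudo_weak_limit_point M Y X \<longleftrightarrow>
     (\<exists>\<alpha> :: nat \<Rightarrow> real. (\<forall>n. 0 < \<alpha> n) \<and> \<alpha> \<longlonglongrightarrow> 0 \<and>
        pseudo_weakly_converges (time_product M)
          (\<lambda>n (t, \<omega>). Y (\<alpha> n) t \<omega>) (\<lambda>(t, \<omega>). X t \<omega>))"


section \<open>Mild solutions of the regularised equations\<close>

text \<open>\<open>z\<close> is a continuous solution on \<open>[0,\<infinity>)\<close> of
  \<open>z t = S t x + \<integral>\<^sub>0\<^sup>t S (t-s) (G s (z s)) ds + v t\<close>.\<close>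

definition mild_path ::
    "(real \<Rightarrow> ('h::{banach, second_countable_topology} \<Rightarrow>\<^sub>L 'h)) \<Rightarrow> (real \<Rightarrow> 'h \<Rightarrow> 'h) \<Rightarrow> 'h \<Rightarrow>
     (real \<Rightarrow> 'h) \<Rightarrow> (real \<Rightarrow> 'h) \<Rightarrow> bool" where
  "mild_path S G x v z \<longleftrightarrow>
     continuous_on {0..} z \<and>
     (\<forall>t\<ge>0. set_integrable lborel {0..t} (\<lambda>s. S (t - s) (G s (z s))) \<and>
        z t = S t x + (LINT s:{0..t}|lborel. S (t - s) (G s (z s))) + v t)"

text \<open>Mild solution, with almost surely continuous paths, of
  \<open>dX = (A X + G(t, X)) dt + \<sigma> dW\<close>, \<open>X\<^sub>0 = x\<close>, where \<open>V\<close> is the stochastic convolution.\<close>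

definition mild_solution ::
    "'w measure \<Rightarrow> (real \<Rightarrow> 'w measure) \<Rightarrow>
     (real \<Rightarrow> ('h::{real_inner, banach, second_countable_topology} \<Rightarrow>\<^sub>L 'h)) \<Rightarrow>
     (real \<Rightarrow> 'h \<Rightarrow> 'h) \<Rightarrow> (real \<Rightarrow> 'w \<Rightarrow> 'h) \<Rightarrow> 'h \<Rightarrow> (real \<Rightarrow> 'w \<Rightarrow> 'h) \<Rightarrow> bool" where
  "mild_solution M Filt S G V x X \<longleftrightarrow>
     adapted Filt X \<and> (AE \<omega> in M. mild_path S G x (\<lambda>t. V t \<omega>) (\<lambda>t. X t \<omega>))"

text \<open>Continuous mild solution of the random equation
  \<open>dZ = (A Z + G(t, Z + V t)) dt\<close>, \<open>Z\<^sub>0 = x\<close>, solved path by path.\<close>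

definition random_mild_solution ::
    "'w measure \<Rightarrow> (real \<Rightarrow> 'w measure) \<Rightarrow>
     (real \<Rightarrow> ('h::{real_inner, banach, second_countable_topology} \<Rightarrow>\<^sub>L 'h)) \<Rightarrow>
     (real \<Rightarrow> 'h \<Rightarrow> 'h) \<Rightarrow> (real \<Rightarrow> 'w \<Rightarrow> 'h) \<Rightarrow> 'h \<Rightarrow> (real \<Rightarrow> 'w \<Rightarrow> 'h) \<Rightarrow> bool" where
  "random_mild_solution M Filt S G V x Z \<longleftrightarrow>
     adapted Filt Z \<and>
     (\<forall>\<omega>\<in>space M. mild_path S (\<lambda>t z. G t (z + V t \<omega>)) x (\<lambda>t. 0) (\<lambda>t. Z t \<omega>))"

text \<open>The Yosida approximations are Lipschitz in space, so the approximating processes \<open>Y \<alpha>\<close> are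
  determined up to indistinguishability; the existential quantifier only selects versions
  of them. Note that \<open>X\<close> need not be square integrable over \<open>[0,\<infinity>) \<times> \<Omega>\<close> (for \<open>F = 0\<close> it is the
  Ornstein--Uhlenbeck process): only \<open>psi\<close> of the processes lies in \<open>L\<^sup>2\<close>, over sets of
  finite measure.\<close>

definition pseudo_weak_solution ::
    "'w measure \<Rightarrow> (real \<Rightarrow> 'w measure) \<Rightarrow>
     (real \<Rightarrow> ('h::{real_inner, banach, second_countable_topology} \<Rightarrow>\<^sub>L 'h)) \<Rightarrow>
     'h set \<Rightarrow> (real \<Rightarrow> 'h \<Rightarrow> 'h set) \<Rightarrow> (real \<Rightarrow> 'w \<Rightarrow> 'h) \<Rightarrow> 'h \<Rightarrow> (real \<Rightarrow> 'w \<Rightarrow> 'h) \<Rightarrow> bool" where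
  "pseudo_weak_solution M Filt S D F V x X \<longleftrightarrow>
     adapted Filt X \<and>
     (\<exists>Y. (\<forall>\<alpha>>0. mild_solution M Filt S (\<lambda>t. yosida D (F t) \<alpha>) V x (Y \<alpha>)) \<and>
        pseudo_weak_limit_point M Y X)"

end

theory Submission
  imports Defs
begin

text \<open>
  The proof rests on two facts.

  \<^emph>\<open>The noise fills the domain.\<close> As \<open>\<sigma>\<close> is invertible, the real variable \<open>inner h (V t)\<close> is, for
  \<open>t > 0\<close> and \<open>h \<noteq> 0\<close>, a mean-square limit of centred Gaussian variables whose variances are bounded
  below (\<open>wiener_integral_nondegenerate\<close>). So it exceeds every constant with positive probability.
  On the other hand, local boundedness of the minimal sections makes \<open>D\<^sub>F\<close> closed and convex
  (\<open>closed_domain\<close>, \<open>convex_domain\<close>). If \<open>D\<^sub>F\<close> were not the whole space, it would lie in a half-space,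
  and \<open>S t y + V t \<in> D\<^sub>F\<close> would bound some \<open>inner h (V t)\<close> from above. Hence \<open>D\<^sub>F = UNIV\<close>
  (\<open>invariant_domain_is_everything\<close>).

  \<^emph>\<open>The approximations converge in norm.\<close> Now the Yosida approximations are bounded on bounded sets,
  uniformly in \<open>\<alpha>\<close>. Each path is treated as a deterministic equation. An energy inequality for mild
  solutions (\<open>energy_inequality\<close>) bounds \<open>Z \<alpha>\<close> on compact time intervals uniformly in \<open>\<alpha>\<close>
  (\<open>Z_norm_le\<close>), and together with the inequality of Komura (\<open>yosida_komura\<close>) it gives
  \<open>norm (Z \<alpha> t - Z \<gamma> t) ^ 2 \<le> 4 C ^ 2 (\<alpha> + \<gamma>) t\<close> (\<open>Z_difference\<close>). So \<open>Z \<alpha> t \<omega>\<close> converges in norm as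
  \<open>\<alpha> = 1 / (n + 1)\<close> tends to 0, for all \<open>t \<ge> 0\<close> and all \<open>\<omega>\<close>. Norm convergence is compatible with adding \<open>V\<close>
  and with applying \<open>psi\<close>, and weak convergence is not; therefore \<open>X = Z + V\<close> and \<open>Z\<close> are
  pseudo-weak limit points along the same sequence (\<open>pseudo_weak_of_pointwise\<close>).

  For the estimate, the energy inequality of the rescaled semigroup \<open>exp (\<beta> t) S t\<close> and the Ou-Iang
  inequality bound \<open>norm (Z \<alpha> t)\<close> by \<open>exp (- \<beta> t) * norm x\<close> plus the integral over \<open>[0, t]\<close> of
  \<open>exp (- \<beta> (t - s))\<close> times the norm of the Yosida approximation at \<open>V s\<close>. That norm is at most
  the growth bound at \<open>norm (V s)\<close> when \<open>V s \<noteq> 0\<close>. At \<open>V s = 0\<close> the comparison can fail, since the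
  growth bound vanishes at 0; but unless the Hilbert space is trivial, the Gaussian argument also
  shows that almost every path vanishes only on a null set of times.
\<close>

section \<open>Separation and orthonormal bases in Hilbert spaces\<close>

text \<open>The vector \<open>h\<close> points from the projection of \<open>p\<close> onto \<open>C\<close> to \<open>p\<close>. A minimising sequence
  for the distance is Cauchy by the parallelogram law, and moving from the projection towards a
  point of \<open>C\<close> cannot decrease the distance.\<close>

lemma separate_point_closed_convex:
  fixes C :: "'h::{real_inner, banach} set"
  assumes "closed C" "convex C" "C \<noteq> {}" "p \<notin> C"
  shows "\<exists>h. h \<noteq> 0 \<and> (\<forall>u\<in>C. inner h u \<le> inner h p - (norm h)\<^sup>2)"
proof -
  define d where "d = infdist p C"
  have d0: "d \<ge> 0" by (simp add: d_def infdist_nonneg)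
  have dle: "d \<le> norm (u - p)" if "u \<in> C" for u
    using infdist_le[OF that, of p] by (simp add: d_def dist_norm norm_minus_commute)
  have "\<exists>u\<in>C. norm (u - p) < d + 1 / (real n + 1)" for n
  proof -
    have "infdist p C < d + 1 / (real n + 1)" by (simp add: d_def)
    then show ?thesis
      using \<open>C \<noteq> {}\<close> unfolding infdist_def
      by (simp split: if_splits, subst (asm) cINF_less_iff)
        (auto simp: dist_norm norm_minus_commute intro!: bdd_belowI[of _ 0])
  qed
  then obtain u where uC: "\<And>n. u n \<in> C" and ud: "\<And>n. norm (u n - p) < d + 1 / (real n + 1)"
    by metis
  have est: "(norm (u m - u n))\<^sup>2 \<le> 4 * (2 * d + 1) / (real N + 1)" if "m \<ge> N" "n \<ge> N" for m n N
  proof -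
    define e where "e = 1 / (real N + 1)"
    have e: "0 < e" "e \<le> 1" by (auto simp: e_def)
    have le: "norm (u k - p) \<le> d + e" if "k \<ge> N" for k
    proof -
      have "1 / (real k + 1) \<le> e" using that by (simp add: e_def frac_le)
      then show ?thesis using ud[of k] by simp
    qed
    have mid: "d \<le> norm ((1/2) *\<^sub>R u m + (1/2) *\<^sub>R u n - p)"
      by (rule dle) (use \<open>convex C\<close> uC in \<open>simp add: convexD\<close>)
    have "(norm (u m - u n))\<^sup>2 = 2 * (norm (u m - p))\<^sup>2 + 2 * (norm (u n - p))\<^sup>2
        - 4 * (norm ((1/2) *\<^sub>R u m + (1/2) *\<^sub>R u n - p))\<^sup>2"
      unfolding power2_norm_eq_inner
      by (simp add: inner_diff_left inner_diff_right inner_add_left inner_add_right inner_commute algebra_simps)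
    also have "\<dots> \<le> 2 * (d + e)\<^sup>2 + 2 * (d + e)\<^sup>2 - 4 * d\<^sup>2"
      using power_mono[OF le[OF that(1)], of 2] power_mono[OF le[OF that(2)], of 2] power_mono[OF mid d0, of 2]
      by simp
    also have "\<dots> = 4 * e * (2 * d + e)" by (simp add: power2_eq_square algebra_simps)
    also have "\<dots> \<le> 4 * e * (2 * d + 1)" using e by (intro mult_left_mono) auto
    finally show ?thesis by (simp add: e_def)
  qed
  have "Cauchy u"
  proof (rule metric_CauchyI)
    fix r :: real assume r: "r > 0"
    obtain N :: nat where N: "4 * (2 * d + 1) / r\<^sup>2 < real N" using reals_Archimedean2 by blast
    have "dist (u m) (u n) < r" if "m \<ge> N" "n \<ge> N" for m n
    proof -
      have "4 * (2 * d + 1) / (real N + 1) < r\<^sup>2"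
      proof -
        have "4 * (2 * d + 1) < real N * r\<^sup>2" using N r by (simp add: divide_less_eq)
        also have "\<dots> \<le> r\<^sup>2 * (real N + 1)" by (simp add: algebra_simps)
        finally show ?thesis by (simp add: divide_less_eq)
      qed
      with est[OF that] have "(norm (u m - u n))\<^sup>2 < r\<^sup>2" by linarith
      then show ?thesis using r by (simp add: dist_norm power2_less_imp_less)
    qed
    then show "\<exists>N. \<forall>m\<ge>N. \<forall>n\<ge>N. dist (u m) (u n) < r" by blast
  qed
  then obtain q where q: "u \<longlonglongrightarrow> q" using Cauchy_convergent convergent_def by blast
  have qC: "q \<in> C" using closed_sequentially[OF \<open>closed C\<close> _ q] uC by blast
  have "norm (q - p) \<le> d"
  proof (rule LIMSEQ_le)
    show "(\<lambda>n. norm (u n - p)) \<longlonglongrightarrow> norm (q - p)" by (intro tendsto_intros q)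
    show "(\<lambda>n. d + 1 / (real n + 1)) \<longlonglongrightarrow> d"
      using tendsto_add[OF tendsto_const[of d] LIMSEQ_inverse_real_of_nat] by (simp add: inverse_eq_divide add.commute)
  qed (use ud less_imp_le in blast)
  define h where "h = p - q"
  have "inner h (v - q) \<le> 0" if v: "v \<in> C" for v
  proof (rule ccontr)
    assume "\<not> ?thesis"
    then have pos: "inner h (v - q) > 0" by simp
    then have vq: "v - q \<noteq> 0" by auto
    define t where "t = min 1 (inner h (v - q) / (norm (v - q))\<^sup>2)"
    have t: "0 < t" "t \<le> 1" "t * (norm (v - q))\<^sup>2 \<le> inner h (v - q)"
      using pos vq by (auto simp: t_def min_def field_simps)
    have "q + t *\<^sub>R (v - q) = (1 - t) *\<^sub>R q + t *\<^sub>R v" by (simp add: algebra_simps)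
    also have "\<dots> \<in> C" using \<open>convex C\<close> qC v t by (simp add: convexD)
    finally have "norm (q - p) \<le> norm (q + t *\<^sub>R (v - q) - p)"
      using dle \<open>norm (q - p) \<le> d\<close> by fastforce
    then have "(norm h)\<^sup>2 \<le> (norm (h - t *\<^sub>R (v - q)))\<^sup>2"
      by (intro power_mono) (simp_all add: h_def norm_minus_commute algebra_simps)
    also have "\<dots> = (norm h)\<^sup>2 - 2 * t * inner h (v - q) + t * (t * (norm (v - q))\<^sup>2)"
      unfolding power2_norm_eq_inner
      by (simp add: inner_diff_left inner_diff_right inner_commute algebra_simps)
    also have "\<dots> \<le> (norm h)\<^sup>2 - 2 * t * inner h (v - q) + t * inner h (v - q)"
      using t by (intro add_left_mono mult_left_mono) auto
    finally show False using mult_pos_pos[OF t(1) pos] by simp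
  qed
  moreover have "inner h p - (norm h)\<^sup>2 = inner h q"
    unfolding power2_norm_eq_inner by (simp add: h_def inner_diff_left inner_diff_right inner_commute)
  moreover have "h \<noteq> 0" using qC \<open>p \<notin> C\<close> by (auto simp: h_def)
  ultimately show ?thesis by (intro exI[of _ h]) (simp add: inner_diff_right)
qed

text \<open>Zorn's lemma gives a maximal orthonormal set. If its closed span missed a point, a separating
  functional would be bounded above on a subspace, hence vanish there, and its normalisation could
  be added to the set. So the choice made in \<^const>\<open>hs_norm_sq\<close> is a choice among orthonormal bases.\<close>

lemma orthonormal_basis_exists: "\<exists>E :: 'h::{real_inner, banach} set. orthonormal_basis E"
proof -
  define ON where "ON = {E :: 'h set. \<forall>e\<in>E. \<forall>f\<in>E. inner e f = (if e = f then 1 else 0)}"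
  have "\<exists>U\<in>ON. \<forall>X\<in>c. X \<subseteq> U" if c: "subset.chain ON c" for c
  proof (intro bexI[of _ "\<Union>c"] ballI)
    show "\<Union>c \<in> ON"
      unfolding ON_def
    proof safe
      fix e f X Y assume "e \<in> X" "X \<in> c" "f \<in> Y" "Y \<in> c"
      then obtain Z where "Z \<in> ON" "e \<in> Z" "f \<in> Z"
        using c unfolding subset_chain_def by blast
      then show "inner e f = (if e = f then 1 else 0)" by (simp add: ON_def)
    qed
  qed auto
  then have "\<exists>E\<in>ON. \<forall>X\<in>ON. E \<subseteq> X \<longrightarrow> X = E" by (rule subset_Zorn)
  then obtain E where E: "E \<in> ON" and max: "\<And>X. X \<in> ON \<Longrightarrow> E \<subseteq> X \<Longrightarrow> X = E" by blast
  have "closure (span E) = UNIV"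
  proof (rule ccontr)
    assume "closure (span E) \<noteq> UNIV"
    then obtain p where p: "p \<notin> closure (span E)" by blast
    have "convex (closure (span E))"
      by (intro convex_closure subspace_imp_convex subspace_span)
    moreover have "closure (span E) \<noteq> {}" using span_0 closure_subset by blast
    ultimately obtain h where h0: "h \<noteq> 0" and
      h: "\<And>u. u \<in> closure (span E) \<Longrightarrow> inner h u \<le> inner h p - (norm h)\<^sup>2"
      using separate_point_closed_convex[OF closed_closure _ _ p] by blast
    have orth: "inner h e = 0" if e: "e \<in> E" for e
    proof (rule ccontr)
      assume ne: "inner h e \<noteq> 0"
      define c where "c = (inner h p + 1) / inner h e"
      have "c *\<^sub>R e \<in> closure (span E)"
        by (rule subsetD[OF closure_subset]) (intro span_mul span_base e)
      from h[OF this] have "inner h p + 1 \<le> inner h p - (norm h)\<^sup>2" using ne by (simp add: c_def)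
      then show False using zero_le_power2[of "norm h"] by linarith
    qed
    define g where "g = (1 / norm h) *\<^sub>R h"
    have gg: "inner g g = 1"
      using h0 by (simp add: g_def power2_norm_eq_inner[symmetric] power2_eq_square)
    have ge: "inner g e = 0" "inner e g = 0" if "e \<in> E" for e
      using orth[OF that] by (simp_all add: g_def inner_commute)
    have "insert g E \<in> ON"
      unfolding ON_def
    proof (intro CollectI ballI)
      fix e f assume "e \<in> insert g E" "f \<in> insert g E"
      moreover have "g \<notin> E" using gg ge by fastforce
      ultimately show "inner e f = (if e = f then 1 else 0)"
        using E gg ge by (elim insertE) (simp_all add: ON_def, (blast | metis)+)
    qed
    then have "g \<in> E" using max by blast
    from ge(1)[OF this] gg show False by simp
  qed
  moreover have "\<forall>e\<in>E. \<forall>f\<in>E. inner e f = (if e = f then 1 else 0)"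
    using E unfolding ON_def by (rule CollectD)
  ultimately have "orthonormal_basis E" unfolding orthonormal_basis_def by (intro conjI)
  then show ?thesis ..
qed

text \<open>The Cauchy--Schwarz inequality bounds \<open>T\<close> on finite combinations of basis vectors; density
  does the rest. This is how convergence of integrands in the Hilbert--Schmidt norm is used: it
  controls their values at one vector.\<close>

lemma norm_apply_le_hs_norm_sq:
  fixes T :: "'h::{real_inner, banach} \<Rightarrow>\<^sub>L 'h"
  assumes "norm y \<le> 1"
  shows "ennreal ((norm (T y))\<^sup>2) \<le> hs_norm_sq T"
proof (cases "hs_norm_sq T")
  case top
  then show ?thesis by simp
next
  case (real K)
  define E where "E = (SOME E :: 'h set. orthonormal_basis E)"
  have E: "orthonormal_basis E" unfolding E_def by (rule someI_ex[OF orthonormal_basis_exists])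
  have on: "inner e f = (if e = f then 1 else 0)" if "e \<in> E" "f \<in> E" for e f
    using E that by (auto simp: orthonormal_basis_def)
  have fin: "(\<Sum>e\<in>B. (norm (T e))\<^sup>2) \<le> K" if B: "finite B" "B \<subseteq> E" for B
  proof -
    have "ennreal (\<Sum>e\<in>B. (norm (T e))\<^sup>2) = (\<integral>\<^sup>+ e. ennreal ((norm (T e))\<^sup>2) \<partial>count_space B)"
      using B by (simp add: nn_integral_count_space_finite sum_ennreal)
    also have "\<dots> = (\<integral>\<^sup>+ e. ennreal ((norm (T e))\<^sup>2) * indicator B e \<partial>count_space B)"
      by (intro nn_integral_cong) simp
    also have "\<dots> = (\<integral>\<^sup>+ e. ennreal ((norm (T e))\<^sup>2) * indicator B e \<partial>count_space E)"
      using B by (intro nn_integral_count_space_eq) auto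
    also have "\<dots> \<le> hs_norm_sq T"
      unfolding hs_norm_sq_def E_def[symmetric] by (intro nn_integral_mono) (auto split: split_indicator)
    finally show ?thesis using real by simp
  qed
  have span: "(norm (T z))\<^sup>2 \<le> K * (norm z)\<^sup>2" if z: "z \<in> span E" for z
  proof -
    obtain B c where B: "finite B" "B \<subseteq> E" and zc: "z = (\<Sum>e\<in>B. c e *\<^sub>R e)"
      using z unfolding span_explicit by auto
    have "(norm z)\<^sup>2 = (\<Sum>e\<in>B. \<Sum>f\<in>B. c e * c f * inner f e)"
      unfolding power2_norm_eq_inner zc
      by (simp add: inner_sum_left inner_sum_right sum_distrib_left mult.assoc)
    also have "\<dots> = (\<Sum>e\<in>B. \<Sum>f\<in>B. if f = e then c e * c e else 0)"
      using B by (intro sum.cong refl) (simp add: on subset_iff)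
    also have "\<dots> = (\<Sum>e\<in>B. (c e)\<^sup>2)" using B by (simp add: power2_eq_square)
    finally have nz: "(norm z)\<^sup>2 = (\<Sum>e\<in>B. (c e)\<^sup>2)" .
    have "norm (T z) \<le> (\<Sum>e\<in>B. norm (c e *\<^sub>R T e))"
      unfolding zc by (simp add: blinfun.sum_right blinfun.scaleR_right sum_norm_le)
    also have "\<dots> = (\<Sum>e\<in>B. \<bar>c e\<bar> * norm (T e))" by simp
    finally have "(norm (T z))\<^sup>2 \<le> (\<Sum>e\<in>B. \<bar>c e\<bar> * norm (T e))\<^sup>2" by (intro power_mono) auto
    also have "\<dots> \<le> (\<Sum>e\<in>B. \<bar>c e\<bar>\<^sup>2) * (\<Sum>e\<in>B. (norm (T e))\<^sup>2)"
      by (rule Cauchy_Schwarz_ineq_sum)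
    also have "\<dots> \<le> (\<Sum>e\<in>B. \<bar>c e\<bar>\<^sup>2) * K"
      by (intro mult_left_mono fin B sum_nonneg) auto
    finally show ?thesis using nz by (simp add: mult.commute)
  qed
  have "y \<in> closure (span E)" using E by (simp add: orthonormal_basis_def)
  then obtain z where z: "\<And>n. z n \<in> span E" "z \<longlonglongrightarrow> y" unfolding closure_sequential by auto
  have "(norm (T y))\<^sup>2 \<le> K * (norm y)\<^sup>2"
  proof (rule LIMSEQ_le)
    show "(\<lambda>n. (norm (T (z n)))\<^sup>2) \<longlonglongrightarrow> (norm (T y))\<^sup>2" by (intro tendsto_intros z)
    show "(\<lambda>n. K * (norm (z n))\<^sup>2) \<longlonglongrightarrow> K * (norm y)\<^sup>2" by (intro tendsto_intros z)
  qed (use span z in blast)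
  also have "\<dots> \<le> K" using real assms by (simp add: mult_left_le power_le_one)
  finally show ?thesis using real by (simp add: ennreal_leI)
qed

section \<open>Yosida approximations of m-dissipative maps\<close>

lemma inner_le_norm_square:
  fixes u v :: "'h::real_inner"
  shows "2 * inner u v \<le> (norm u)\<^sup>2 + (norm v)\<^sup>2"
proof -
  have "0 \<le> (norm (u - v))\<^sup>2" by simp
  then show ?thesis
    unfolding power2_norm_eq_inner by (simp add: inner_diff_left inner_diff_right inner_commute)
qed

context
  fixes D :: "'h::{real_inner, banach} set" and G :: "'h \<Rightarrow> 'h set"
  assumes mdis: "m_dissipative D G"
begin

lemma dissipative:
  "\<lbrakk>u \<in> D; u' \<in> D; y \<in> G u; y' \<in> G u'\<rbrakk> \<Longrightarrow> inner (y - y') (u - u') \<le> 0"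
  using mdis by (auto simp: m_dissipative_def)

text \<open>Existence is the range condition at \<open>1 / \<alpha>\<close>, uniqueness is dissipativity.\<close>

lemma resolvent_ex1:
  assumes "\<alpha> > 0"
  shows "\<exists>!u. u \<in> D \<and> (\<exists>y\<in>G u. u - \<alpha> *\<^sub>R y = x)"
proof -
  have "(1 / \<alpha>) *\<^sub>R x \<in> {(1 / \<alpha>) *\<^sub>R x - y | x y. x \<in> D \<and> y \<in> G x}"
    using mdis assms by (auto simp: m_dissipative_def)
  then obtain u y where uy: "u \<in> D" "y \<in> G u" "(1 / \<alpha>) *\<^sub>R x = (1 / \<alpha>) *\<^sub>R u - y" by blast
  have "x = \<alpha> *\<^sub>R ((1 / \<alpha>) *\<^sub>R x)" using assms by simp
  also have "\<dots> = u - \<alpha> *\<^sub>R y" unfolding uy(3) using assms by (simp add: scaleR_diff_right)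
  finally have ex: "u \<in> D \<and> (\<exists>y\<in>G u. u - \<alpha> *\<^sub>R y = x)" using uy by blast
  have "u1 = u2" if "u1 \<in> D" "y1 \<in> G u1" "u1 - \<alpha> *\<^sub>R y1 = x" "u2 \<in> D" "y2 \<in> G u2" "u2 - \<alpha> *\<^sub>R y2 = x"
    for u1 u2 y1 y2
  proof -
    have "u1 - u2 = \<alpha> *\<^sub>R (y1 - y2)"
      using that(3,6) by (simp add: scaleR_diff_right algebra_simps)
    then have "\<alpha> * (norm (y1 - y2))\<^sup>2 \<le> 0"
      using dissipative[OF that(1,4,2,5)] by (simp add: power2_norm_eq_inner)
    then have "y1 - y2 = 0" using assms by (simp add: mult_le_0_iff)
    then show ?thesis using \<open>u1 - u2 = \<alpha> *\<^sub>R (y1 - y2)\<close> by simp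
  qed
  with ex show ?thesis by (intro ex1I[of _ u]) blast+
qed

lemma yosida_in_graph:
  assumes "\<alpha> > 0"
  shows "x + \<alpha> *\<^sub>R yosida D G \<alpha> x \<in> D" "yosida D G \<alpha> x \<in> G (x + \<alpha> *\<^sub>R yosida D G \<alpha> x)"
proof -
  define u where "u = resolvent D G \<alpha> x"
  have "u \<in> D \<and> (\<exists>y\<in>G u. u - \<alpha> *\<^sub>R y = x)"
    unfolding u_def resolvent_def by (rule theI'[OF resolvent_ex1[OF assms]])
  then obtain y where y: "u \<in> D" "y \<in> G u" "u - \<alpha> *\<^sub>R y = x" by blast
  have "u - x = \<alpha> *\<^sub>R y" using y(3) by (simp add: algebra_simps)
  then have "yosida D G \<alpha> x = y" using assms by (simp add: yosida_def u_def[symmetric])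
  moreover have "x + \<alpha> *\<^sub>R y = u" using y(3) by (simp add: algebra_simps)
  ultimately show "x + \<alpha> *\<^sub>R yosida D G \<alpha> x \<in> D" "yosida D G \<alpha> x \<in> G (x + \<alpha> *\<^sub>R yosida D G \<alpha> x)"
    using y by simp_all
qed

text \<open>Dissipativity at the two points of the graph above \<open>x + \<alpha> y\<close> and \<open>x' + \<gamma> y'\<close>, where \<open>y\<close> and
  \<open>y'\<close> are the Yosida values. The inequality compares approximations with different parameters, and
  its error is small when \<open>\<alpha>\<close> and \<open>\<gamma>\<close> are small and the Yosida values are bounded.\<close>

lemma yosida_komura:
  assumes "\<alpha> > 0" "\<gamma> > 0"
  shows "inner (yosida D G \<alpha> x - yosida D G \<gamma> x') (x - x')
    \<le> - inner (yosida D G \<alpha> x - yosida D G \<gamma> x') (\<alpha> *\<^sub>R yosida D G \<alpha> x - \<gamma> *\<^sub>R yosida D G \<gamma> x')"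
  using dissipative[OF yosida_in_graph(1)[OF assms(1)] yosida_in_graph(1)[OF assms(2)]
      yosida_in_graph(2)[OF assms(1)] yosida_in_graph(2)[OF assms(2)], of x x']
  by (simp add: inner_diff_right inner_add_right algebra_simps)

lemma yosida_strongly_dissipative:
  assumes "\<alpha> > 0"
  shows "inner (yosida D G \<alpha> x - yosida D G \<alpha> x') (x - x')
    \<le> - \<alpha> * (norm (yosida D G \<alpha> x - yosida D G \<alpha> x'))\<^sup>2"
  using yosida_komura[OF assms assms, of x x']
  by (simp add: power2_norm_eq_inner scaleR_diff_right[symmetric])

lemma yosida_lipschitz:
  assumes "\<alpha> > 0"
  shows "norm (yosida D G \<alpha> x - yosida D G \<alpha> x') \<le> (1 / \<alpha>) * norm (x - x')"
proof -
  let ?N = "norm (yosida D G \<alpha> x - yosida D G \<alpha> x')"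
  have "\<alpha> * ?N\<^sup>2 \<le> - inner (yosida D G \<alpha> x - yosida D G \<alpha> x') (x - x')"
    using yosida_strongly_dissipative[OF assms, of x x'] by simp
  also have "\<dots> \<le> ?N * norm (x - x')"
    using Cauchy_Schwarz_ineq2[of "yosida D G \<alpha> x - yosida D G \<alpha> x'" "x - x'"] by linarith
  finally have "?N * (\<alpha> * ?N) \<le> ?N * norm (x - x')" by (simp add: power2_eq_square ac_simps)
  then have "\<alpha> * ?N \<le> norm (x - x')"
    using assms by (cases "?N = 0") auto
  then show ?thesis using assms by (simp add: field_simps)
qed

lemma yosida_minimal:
  assumes "\<alpha> > 0" "x \<in> D" "v \<in> G x"
  shows "norm (yosida D G \<alpha> x) \<le> norm v"
proof -
  let ?y = "yosida D G \<alpha> x"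
  have "inner (?y - v) (\<alpha> *\<^sub>R ?y) \<le> 0"
    using dissipative[OF yosida_in_graph(1)[OF assms(1)] assms(2) yosida_in_graph(2)[OF assms(1)] assms(3), of x]
    by simp
  then have "\<alpha> * inner (?y - v) ?y \<le> 0" by simp
  then have "inner ?y ?y \<le> inner v ?y" using assms(1) by (simp add: mult_le_0_iff inner_diff_left)
  also have "\<dots> \<le> norm v * norm ?y" by (rule norm_cauchy_schwarz)
  finally have "norm ?y * norm ?y \<le> norm v * norm ?y"
    by (simp add: power2_norm_eq_inner[symmetric] power2_eq_square)
  then show ?thesis by (cases "norm ?y = 0") auto
qed

text \<open>Maximality of the graph: the range condition produces \<open>u\<close> in the domain and \<open>v \<in> G u\<close> with
  \<open>u - v = x - y\<close>, and testing against this pair forces \<open>u = x\<close> and \<open>v = y\<close>.\<close>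

lemma in_graph_if_monotonically_related:
  assumes "\<And>u v. u \<in> D \<Longrightarrow> v \<in> G u \<Longrightarrow> inner (y - v) (x - u) \<le> 0"
  shows "x \<in> D \<and> y \<in> G x"
proof -
  define u where "u = x - y + 1 *\<^sub>R yosida D G 1 (x - y)"
  define v where "v = yosida D G 1 (x - y)"
  have uv: "u \<in> D" "v \<in> G u" unfolding u_def v_def by (intro yosida_in_graph; simp)+
  have "x - u = y - v" by (simp add: u_def v_def)
  then have "inner (y - v) (y - v) \<le> 0" using assms[OF uv] by simp
  then have "y = v" by (metis eq_iff_diff_eq_0 inner_eq_zero_iff inner_ge_zero order_antisym)
  with \<open>x - u = y - v\<close> uv show ?thesis by simp
qed

text \<open>For \<open>x = x'\<close> the inequality of \<open>yosida_komura\<close> says that the squared norms of the Yosida values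
  increase as the parameter decreases and that their increments dominate the squared distances. If
  the values are bounded, they therefore form a Cauchy sequence; by maximality the
  limit lies in the graph above \<open>x\<close>, and so \<open>x\<close> lies in the domain.\<close>

lemma yosida_bounded_imp_converges:
  assumes bdd: "\<And>\<alpha>. \<alpha> > 0 \<Longrightarrow> norm (yosida D G \<alpha> x) \<le> a"
  obtains y where "x \<in> D" "y \<in> G x" "norm y \<le> a" "(\<lambda>n. yosida D G (1 / real (Suc n)) x) \<longlonglongrightarrow> y"
proof -
  define s where "s n = yosida D G (1 / real (Suc n)) x" for n
  have diff: "(norm (s m - s n))\<^sup>2 \<le> (norm (s n))\<^sup>2 - (norm (s m))\<^sup>2" if "m \<le> n" for m n
  proof -
    define \<alpha> \<gamma> where "\<alpha> = 1 / real (Suc m)" and "\<gamma> = 1 / real (Suc n)"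
    have ag: "0 < \<gamma>" "0 < \<alpha>" "\<gamma> \<le> \<alpha>" using that by (auto simp: \<alpha>_def \<gamma>_def frac_le)
    define p A B where "p = inner (s m) (s n)" and "A = (norm (s m))\<^sup>2" and "B = (norm (s n))\<^sup>2"
    have "inner (s m - s n) (\<alpha> *\<^sub>R s m - \<gamma> *\<^sub>R s n) \<le> 0"
      using yosida_komura[OF ag(2,1), of x x] by (simp add: s_def \<alpha>_def \<gamma>_def)
    then have 1: "\<alpha> * A + \<gamma> * B \<le> (\<alpha> + \<gamma>) * p"
      unfolding A_def B_def p_def power2_norm_eq_inner
      by (simp add: inner_diff_left inner_diff_right algebra_simps inner_commute)
    have "2 * p \<le> A + B" unfolding p_def A_def B_def by (rule inner_le_norm_square)
    then have "(\<alpha> + \<gamma>) * (2 * p) \<le> (\<alpha> + \<gamma>) * (A + B)" using ag by (intro mult_left_mono) auto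
    with 1 have 2: "(\<alpha> - \<gamma>) * A \<le> (\<alpha> - \<gamma>) * B" by (simp add: algebra_simps)
    have "A \<le> p"
    proof (cases "\<alpha> = \<gamma>")
      case True
      then have "m = n" by (simp add: \<alpha>_def \<gamma>_def)
      then show ?thesis by (simp add: A_def p_def power2_norm_eq_inner)
    next
      case False
      then have "A \<le> B" using 2 ag by simp
      then have "\<gamma> * A \<le> \<gamma> * B" using ag by simp
      with 1 have "(\<alpha> + \<gamma>) * A \<le> (\<alpha> + \<gamma>) * p" by (simp add: algebra_simps)
      then show ?thesis using ag by simp
    qed
    moreover have "(norm (s m - s n))\<^sup>2 = A + B - 2 * p"
      unfolding A_def B_def p_def power2_norm_eq_inner
      by (simp add: inner_diff_left inner_diff_right inner_commute)
    ultimately show ?thesis by (simp add: A_def B_def)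
  qed
  have mono: "incseq (\<lambda>n. (norm (s n))\<^sup>2)"
  proof (rule incseq_SucI)
    fix n show "(norm (s n))\<^sup>2 \<le> (norm (s (Suc n)))\<^sup>2"
      using diff[of n "Suc n"] zero_le_power2[of "norm (s n - s (Suc n))"] by linarith
  qed
  have a0: "0 \<le> a" using bdd[of 1] norm_ge_zero[of "yosida D G 1 x"] by linarith
  have sa: "norm (s n) \<le> a" for n by (simp add: s_def bdd)
  have "Cauchy s"
  proof (rule metric_CauchyI)
    fix e :: real assume e: "e > 0"
    have "(norm (s n))\<^sup>2 \<le> a\<^sup>2" for n by (intro power_mono sa) simp
    then have "convergent (\<lambda>n. (norm (s n))\<^sup>2)"
      using incseq_convergent[OF mono] convergent_def by metis
    then have "Cauchy (\<lambda>n. (norm (s n))\<^sup>2)" by (rule convergent_Cauchy)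
    then obtain N where N: "\<And>m n. m \<ge> N \<Longrightarrow> n \<ge> N \<Longrightarrow> dist ((norm (s m))\<^sup>2) ((norm (s n))\<^sup>2) < e\<^sup>2"
      using metric_CauchyD[of _ "e\<^sup>2"] e by (metis zero_less_power)
    have ord: "dist (s m) (s n) < e" if "m \<ge> N" "m \<le> n" for m n
    proof -
      have "(norm (s m - s n))\<^sup>2 < e\<^sup>2"
        using diff[OF that(2)] N[of m n] that by (simp add: dist_real_def)
      then show ?thesis using e by (simp add: dist_norm power2_less_imp_less)
    qed
    have "dist (s m) (s n) < e" if "m \<ge> N" "n \<ge> N" for m n
      using ord[of m n] ord[of n m] that by (cases "m \<le> n") (auto simp: dist_commute)
    then show "\<exists>N. \<forall>m\<ge>N. \<forall>n\<ge>N. dist (s m) (s n) < e" by blast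
  qed
  then obtain y where y: "s \<longlonglongrightarrow> y" using Cauchy_convergent convergent_def by blast
  have lim0: "(\<lambda>n. 1 / real (Suc n)) \<longlonglongrightarrow> 0"
    using LIMSEQ_inverse_real_of_nat by (simp add: inverse_eq_divide)
  have xlim: "(\<lambda>n. x + (1 / real (Suc n)) *\<^sub>R s n) \<longlonglongrightarrow> x + 0 *\<^sub>R y"
    by (intro tendsto_intros lim0 y)
  have "x \<in> D \<and> y \<in> G x"
  proof (rule in_graph_if_monotonically_related)
    fix u v assume uv: "u \<in> D" "v \<in> G u"
    have "(\<lambda>n. inner (s n - v) (x + (1 / real (Suc n)) *\<^sub>R s n - u)) \<longlonglongrightarrow> inner (y - v) (x + 0 *\<^sub>R y - u)"
      by (intro tendsto_intros y xlim lim0)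
    moreover have "inner (s n - v) (x + (1 / real (Suc n)) *\<^sub>R s n - u) \<le> 0" for n
      unfolding s_def by (intro dissipative uv yosida_in_graph) auto
    ultimately show "inner (y - v) (x - u) \<le> 0"
      using LIMSEQ_le_const2 by fastforce
  qed
  moreover have "norm y \<le> a"
    using LIMSEQ_le_const2[OF tendsto_norm[OF y]] sa by blast
  ultimately show ?thesis using that y unfolding s_def by blast
qed

text \<open>The limit of the Yosida values is an element of \<open>G x\<close> of least norm, and it is the only one
  because \<open>inner (y - v) y \<le> 0\<close> for every \<open>v \<in> G x\<close>. So the definite description that defines
  \<^const>\<open>minimal_section\<close> has a referent.\<close>

lemma minimal_section_minimal:
  assumes "x \<in> D" "G x \<noteq> {}"
  shows "minimal_section G x \<in> G x" "v \<in> G x \<Longrightarrow> norm (minimal_section G x) \<le> norm v"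
proof -
  obtain w where w: "w \<in> G x" using assms(2) by blast
  obtain y where y: "y \<in> G x" "(\<lambda>n. yosida D G (1 / real (Suc n)) x) \<longlonglongrightarrow> y"
    by (rule yosida_bounded_imp_converges[of x "norm w"]) (use yosida_minimal assms(1) w in auto)
  have le: "(norm (v - y))\<^sup>2 \<le> (norm v)\<^sup>2 - (norm y)\<^sup>2" if v: "v \<in> G x" for v
  proof -
    have "inner (y - v) y \<le> 0"
    proof (rule LIMSEQ_le_const2)
      show "(\<lambda>n. inner (yosida D G (1 / real (Suc n)) x - v) (yosida D G (1 / real (Suc n)) x)) \<longlonglongrightarrow> inner (y - v) y"
        by (intro tendsto_intros y)
      have "inner (yosida D G (1 / real (Suc n)) x - v) (yosida D G (1 / real (Suc n)) x) \<le> 0" for n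
      proof -
        let ?\<alpha> = "1 / real (Suc n)"
        have "inner (yosida D G ?\<alpha> x - v) (x + ?\<alpha> *\<^sub>R yosida D G ?\<alpha> x - x) \<le> 0"
          by (intro dissipative yosida_in_graph assms v) auto
        then show ?thesis by (simp add: divide_le_0_iff del: of_nat_Suc)
      qed
      then show "\<exists>N. \<forall>n\<ge>N. inner (yosida D G (1 / real (Suc n)) x - v) (yosida D G (1 / real (Suc n)) x) \<le> 0"
        by blast
    qed
    then show ?thesis unfolding power2_norm_eq_inner
      by (simp add: inner_diff_left inner_diff_right inner_commute)
  qed
  then have min: "norm y \<le> norm v" if "v \<in> G x" for v
    using le[OF that] zero_le_power2[of "norm (v - y)"] by (intro power2_le_imp_le[of "norm y"]) (linarith, simp)
  have "minimal_section G x = y"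
    unfolding minimal_section_def
  proof (rule the_equality)
    show "y \<in> G x \<and> (\<forall>z\<in>G x. norm y \<le> norm z)" using y min by blast
    fix z assume z: "z \<in> G x \<and> (\<forall>v\<in>G x. norm z \<le> norm v)"
    then have "norm z = norm y" using y min by (meson order_antisym)
    then have "(norm (z - y))\<^sup>2 \<le> 0" using le[of z] z by simp
    then show "z = y" by simp
  qed
  then show "minimal_section G x \<in> G x" "v \<in> G x \<Longrightarrow> norm (minimal_section G x) \<le> norm v"
    using y min by auto
qed

lemma yosida_le_minimal_section:
  "\<lbrakk>\<alpha> > 0; x \<in> D; G x \<noteq> {}\<rbrakk> \<Longrightarrow> norm (yosida D G \<alpha> x) \<le> norm (minimal_section G x)"
  by (intro yosida_minimal minimal_section_minimal)

context
  assumes ne: "\<And>x. x \<in> D \<Longrightarrow> G x \<noteq> {}"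
    and locbdd: "\<And>r. r > 0 \<Longrightarrow> \<exists>a. \<forall>x\<in>D. norm x < r \<longrightarrow> norm (minimal_section G x) \<le> a"
begin

text \<open>Near a limit point of the domain the minimal section, hence every Yosida approximation, is
  bounded by one constant. By Lipschitz continuity the same bound holds at the limit point, so the
  Yosida values converge there.\<close>

lemma closed_domain: "closed D"
  unfolding closed_sequential_limits
proof safe
  fix u x assume u: "\<forall>n. u n \<in> D" and lim: "u \<longlonglongrightarrow> x"
  obtain a where a: "\<And>z. z \<in> D \<Longrightarrow> norm z < norm x + 1 \<Longrightarrow> norm (minimal_section G z) \<le> a"
    using locbdd[of "norm x + 1"] by (auto simp: add_nonneg_pos)
  have "eventually (\<lambda>n. norm (u n) < norm x + 1) sequentially"
    by (rule order_tendstoD[OF tendsto_norm[OF lim]]) simp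
  then have bd: "eventually (\<lambda>n. norm (yosida D G \<alpha> (u n)) \<le> a) sequentially" if "\<alpha> > 0" for \<alpha>
    by eventually_elim
      (use u a ne that in \<open>meson order_trans yosida_le_minimal_section\<close>)
  have "norm (yosida D G \<alpha> x) \<le> a" if \<alpha>: "\<alpha> > 0" for \<alpha>
  proof -
    have z: "(\<lambda>n. (1 / \<alpha>) * norm (u n - x)) \<longlonglongrightarrow> (1 / \<alpha>) * norm (x - x)"
      by (intro tendsto_intros lim)
    have "(\<lambda>n. yosida D G \<alpha> (u n) - yosida D G \<alpha> x) \<longlonglongrightarrow> 0"
    proof (rule Lim_null_comparison[OF always_eventually])
      show "\<forall>n. norm (yosida D G \<alpha> (u n) - yosida D G \<alpha> x) \<le> (1 / \<alpha>) * norm (u n - x)"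
        using yosida_lipschitz[OF \<alpha>] by blast
    qed (use z in simp)
    then have "(\<lambda>n. yosida D G \<alpha> (u n)) \<longlonglongrightarrow> yosida D G \<alpha> x" by (simp add: LIM_zero_iff)
    then show ?thesis by (intro tendsto_upperbound[OF tendsto_norm bd[OF \<alpha>]]) auto
  qed
  then show "x \<in> D" by (rule yosida_bounded_imp_converges)
qed

text \<open>Let \<open>x\<close> be a convex combination of \<open>u1\<close> and \<open>u2\<close> in the domain and let \<open>d\<close> be the displacement of
  \<open>x\<close> under the resolvent. Dissipativity against \<open>u1\<close> and \<open>u2\<close>, averaged with the weights of the
  combination, loses the term linear in \<open>d\<close> and leaves \<open>norm d ^ 2 = O(\<alpha>)\<close>. Hence \<open>x\<close> is a limit of
  points \<open>x + d\<close> of the domain, which is closed.\<close>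

lemma convex_domain: "convex D"
proof (rule convexI)
  fix u1 u2 :: 'h and a b :: real
  assume u: "u1 \<in> D" "u2 \<in> D" and ab: "0 \<le> a" "0 \<le> b" "a + b = 1"
  define x where "x = a *\<^sub>R u1 + b *\<^sub>R u2"
  obtain v1 v2 where v: "v1 \<in> G u1" "v2 \<in> G u2" using ne u by blast
  define d where "d n = (1 / real (Suc n)) *\<^sub>R yosida D G (1 / real (Suc n)) x" for n
  define K where "K = norm v1 + norm v2 + norm v1 * norm (x - u1) + norm v2 * norm (x - u2)"
  have K0: "0 \<le> K" by (simp add: K_def)
  have est: "(norm (d n))\<^sup>2 \<le> (1 / real (Suc n)) * (K * (1 + norm (d n)))" for n
  proof -
    define \<alpha> where "\<alpha> = 1 / real (Suc n)"
    have \<alpha>: "\<alpha> > 0" by (simp add: \<alpha>_def)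
    have d: "d n = \<alpha> *\<^sub>R yosida D G \<alpha> x" by (simp add: d_def \<alpha>_def)
    have i: "(norm (d n))\<^sup>2 + inner (d n) (x - u) \<le> \<alpha> * (norm v * (norm (x - u) + norm (d n)))"
      if "u \<in> D" "v \<in> G u" for u v
    proof -
      have "inner (yosida D G \<alpha> x - v) (x + \<alpha> *\<^sub>R yosida D G \<alpha> x - u) \<le> 0"
        by (intro dissipative yosida_in_graph \<alpha> that)
      then have "\<alpha> * inner (yosida D G \<alpha> x - v) (x + d n - u) \<le> 0"
        using \<alpha> by (simp add: d mult_le_0_iff)
      then have "inner (\<alpha> *\<^sub>R yosida D G \<alpha> x - \<alpha> *\<^sub>R v) (x + d n - u) \<le> 0"
        by (simp add: scaleR_diff_right[symmetric])
      then have "inner (d n) (x + d n - u) \<le> \<alpha> * inner v (x + d n - u)"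
        by (simp add: d inner_diff_left)
      also have "\<dots> \<le> \<alpha> * (norm v * norm ((x - u) + d n))"
        using \<alpha> norm_cauchy_schwarz[of v "(x - u) + d n"]
        by (intro mult_left_mono) (simp_all add: algebra_simps)
      also have "\<dots> \<le> \<alpha> * (norm v * (norm (x - u) + norm (d n)))"
        using \<alpha> by (intro mult_left_mono norm_triangle_ineq) auto
      finally show ?thesis
        by (simp add: power2_norm_eq_inner inner_diff_right inner_add_right algebra_simps)
    qed
    have "a *\<^sub>R (x - u1) + b *\<^sub>R (x - u2) = (a + b) *\<^sub>R x - x"
      unfolding x_def by (simp add: algebra_simps)
    then have z: "a * inner (d n) (x - u1) + b * inner (d n) (x - u2) = 0"
      using ab(3) by (metis diff_self inner_add_right inner_scaleR_right inner_zero_right scaleR_one)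
    have "(norm (d n))\<^sup>2 = a * ((norm (d n))\<^sup>2 + inner (d n) (x - u1)) + b * ((norm (d n))\<^sup>2 + inner (d n) (x - u2))"
    proof -
      have "a * ((norm (d n))\<^sup>2 + inner (d n) (x - u1)) + b * ((norm (d n))\<^sup>2 + inner (d n) (x - u2))
          = (a + b) * (norm (d n))\<^sup>2 + (a * inner (d n) (x - u1) + b * inner (d n) (x - u2))"
        by (simp add: distrib_left distrib_right)
      then show ?thesis using z ab(3) by simp
    qed
    also have "\<dots> \<le> 1 * (\<alpha> * (norm v1 * (norm (x - u1) + norm (d n)))) + 1 * (\<alpha> * (norm v2 * (norm (x - u2) + norm (d n))))"
    proof (intro add_mono)
      have gen: "c * t \<le> 1 * s" if "0 \<le> c" "c \<le> 1" "t \<le> s" "0 \<le> s" for c t s :: real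
        using mult_mono[of c 1 s s] mult_left_mono[of t s c] that by linarith
      show "a * ((norm (d n))\<^sup>2 + inner (d n) (x - u1)) \<le> 1 * (\<alpha> * (norm v1 * (norm (x - u1) + norm (d n))))"
        by (rule gen[OF _ _ i]) (use ab u v \<alpha> in auto)
      show "b * ((norm (d n))\<^sup>2 + inner (d n) (x - u2)) \<le> 1 * (\<alpha> * (norm v2 * (norm (x - u2) + norm (d n))))"
        by (rule gen[OF _ _ i]) (use ab u v \<alpha> in auto)
    qed
    also have "\<dots> = \<alpha> * (norm v1 * norm (x - u1) + norm v2 * norm (x - u2) + (norm v1 + norm v2) * norm (d n))"
      by (simp add: algebra_simps)
    also have "\<dots> \<le> \<alpha> * (K * (1 + norm (d n)))"
      unfolding K_def using \<alpha> by (intro mult_left_mono) (simp_all add: algebra_simps)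
    finally show ?thesis by (simp add: \<alpha>_def)
  qed
  have bound: "norm (d n) \<le> K + 1" for n
  proof (rule ccontr)
    assume "\<not> ?thesis"
    then have gt: "norm (d n) > K + 1" by simp
    have "(norm (d n))\<^sup>2 \<le> 1 * (K * (1 + norm (d n)))"
      by (rule order_trans[OF est mult_right_mono]) (use K0 in simp_all)
    also have "\<dots> \<le> K * norm (d n) + norm (d n)" using gt K0 by (simp add: algebra_simps)
    also have "\<dots> < norm (d n) * norm (d n)" 
    proof -
      have "0 < norm (d n)" using gt K0 by linarith
      from mult_strict_right_mono[OF gt this] show ?thesis by (simp add: algebra_simps)
    qed
    finally show False by (simp add: power2_eq_square)
  qed
  have "(\<lambda>n. (norm (d n))\<^sup>2) \<longlonglongrightarrow> 0"
  proof (rule Lim_null_comparison[OF always_eventually])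
    show "\<forall>n. norm ((norm (d n))\<^sup>2) \<le> (1 / real (Suc n)) * (K * (1 + (K + 1)))"
    proof
      fix n
      have "(norm (d n))\<^sup>2 \<le> (1 / real (Suc n)) * (K * (1 + (K + 1)))"
        by (intro order_trans[OF est] mult_left_mono add_left_mono bound K0) simp
      then show "norm ((norm (d n))\<^sup>2) \<le> (1 / real (Suc n)) * (K * (1 + (K + 1)))" by simp
    qed
    have "(\<lambda>n. 1 / real (Suc n)) \<longlonglongrightarrow> 0"
      using LIMSEQ_inverse_real_of_nat by (simp only: inverse_eq_divide)
    then show "(\<lambda>n. (1 / real (Suc n)) * (K * (1 + (K + 1)))) \<longlonglongrightarrow> 0"
      by (rule tendsto_mult_left_zero)
  qed
  then have "d \<longlonglongrightarrow> 0" by (simp add: tendsto_norm_zero_iff)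
  then have "(\<lambda>n. x + d n) \<longlonglongrightarrow> x + 0" by (intro tendsto_intros)
  moreover have "x + d n \<in> D" for n unfolding d_def by (rule yosida_in_graph) simp
  ultimately show "a *\<^sub>R u1 + b *\<^sub>R u2 \<in> D"
    using closed_sequentially[OF closed_domain] by (metis add_0_right x_def)
qed

end

end

section \<open>Semigroups with dissipative generators\<close>

text \<open>By the Baire category theorem one of the closed sets on which all \<open>T n\<close> are bounded by \<open>k\<close>
  contains a ball.\<close>

lemma uniform_boundedness_sequence:
  fixes T :: "nat \<Rightarrow> 'a::banach \<Rightarrow>\<^sub>L 'b::real_normed_vector"
  assumes bdd: "\<And>x. \<exists>K. \<forall>n. norm (T n x) \<le> K"
  shows "\<exists>M. \<forall>n. norm (T n) \<le> M"
proof -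
  define C where "C k = {x. \<forall>n. norm (T n x) \<le> real k}" for k :: nat
  have cl: "closed (C k)" for k
    unfolding C_def by (intro closed_Collect_all closed_Collect_le continuous_intros)
  have cover: "(\<Union>k. C k) = UNIV"
  proof (intro set_eqI iffI UNIV_I)
    fix x
    obtain K where K: "\<And>n. norm (T n x) \<le> K" using bdd by blast
    obtain k :: nat where "K \<le> real k" using real_arch_simple by blast
    then have "x \<in> C k" unfolding C_def using K order_trans by blast
    then show "x \<in> (\<Union>k. C k)" by blast
  qed
  have "\<exists>k. interior (C k) \<noteq> {}"
  proof (rule ccontr)
    assume none: "\<nexists>k. interior (C k) \<noteq> {}"
    have "Met_TC.mtopology interior_of \<Union>(range C) = {}"
    proof (rule Met_TC.metric_Baire_category_alt)
      show "Met_TC.mcomplete TYPE('a)" by (simp add: complete_UNIV)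
      show "closedin Met_TC.mtopology T' \<and> Met_TC.mtopology interior_of T' = {}" if "T' \<in> range C" for T'
        using that cl none by auto
    qed auto
    with cover show False by simp
  qed
  then obtain k x0 where "x0 \<in> interior (C k)" by blast
  then obtain r where r: "r > 0" "cball x0 r \<subseteq> C k" by (meson mem_interior_cball)
  have "norm (T n) \<le> 2 * real k / r" for n
  proof (rule norm_blinfun_bound)
    show "0 \<le> 2 * real k / r" using r by simp
    fix x
    show "norm (T n x) \<le> 2 * real k / r * norm x"
    proof (cases "x = 0")
      case False
      define y where "y = (r / norm x) *\<^sub>R x"
      have "x0 + y \<in> C k" "x0 \<in> C k"
        using r False by (auto intro!: subsetD[OF r(2)] simp: y_def dist_norm)
      then have "norm (T n (x0 + y)) \<le> real k" "norm (T n x0) \<le> real k" by (auto simp: C_def)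
      then have "norm (T n (x0 + y) - T n x0) \<le> 2 * real k"
        using norm_triangle_ineq4[of "T n (x0 + y)" "T n x0"] by linarith
      then have "norm (T n y) \<le> 2 * real k" by (simp add: blinfun.add_right)
      then have "(r / norm x) * norm (T n x) \<le> 2 * real k"
        using r by (simp add: y_def blinfun.scaleR_right)
      then show ?thesis using r False by (simp add: field_simps)
    qed simp
  qed
  then show ?thesis by blast
qed

context
  fixes S :: "real \<Rightarrow> 'h::banach \<Rightarrow>\<^sub>L 'h"
  assumes sg: "c0_semigroup S"
begin

lemma semigroup_0 [simp]: "S 0 x = x"
  using sg by (simp add: c0_semigroup_def)

lemma semigroup_add: "s \<ge> 0 \<Longrightarrow> t \<ge> 0 \<Longrightarrow> S (s + t) x = S s (S t x)"
  using sg by (simp add: c0_semigroup_def)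

lemma semigroup_right_limit_0: "((\<lambda>t. S t x) \<longlongrightarrow> x) (at_right 0)"
  using sg by (simp add: c0_semigroup_def)

text \<open>A sequence \<open>t n\<close> tending to 0 with unbounded \<open>norm (S (t n))\<close> would contradict uniform
  boundedness, as \<open>S (t n) x\<close> converges for every \<open>x\<close>. The bound near 0 spreads by the semigroup law.\<close>

lemma semigroup_locally_bounded: "\<exists>M\<ge>1. \<forall>t\<in>{0..T}. norm (S t) \<le> M"
proof -
  have "\<exists>\<delta>>0. \<exists>M. \<forall>t\<in>{0..\<delta>}. norm (S t) \<le> M"
  proof (rule ccontr)
    assume neg: "\<not> ?thesis"
    have "\<exists>t\<in>{0..1 / real (Suc n)}. norm (S t) > real n" for n
      using neg by (meson not_le divide_pos_pos of_nat_0_less_iff zero_less_Suc zero_less_one)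
    then obtain t where t: "\<And>n. t n \<in> {0..1 / real (Suc n)}" and big: "\<And>n. norm (S (t n)) > real n"
      by metis
    have "\<exists>K. \<forall>n. norm (S (t n) x) \<le> K" for x
    proof -
      have lim: "((\<lambda>t. S t x) \<longlongrightarrow> x) (at 0 within {0..})"
        using semigroup_right_limit_0[of x] by (simp add: at_within_Ici_at_right)
      have t0: "t \<longlonglongrightarrow> 0"
      proof (rule Lim_null_comparison[OF always_eventually])
        show "\<forall>n. norm (t n) \<le> 1 / real (Suc n)"
          using t by (metis atLeastAtMost_iff real_norm_def abs_of_nonneg)
        show "(\<lambda>n. 1 / real (Suc n)) \<longlonglongrightarrow> 0"
          using LIMSEQ_inverse_real_of_nat by (simp add: inverse_eq_divide)
      qed
      have "continuous (at 0 within {0..}) (\<lambda>t. S t x)" using lim by (simp add: continuous_within)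
      then have "(\<lambda>n. S (t n) x) \<longlonglongrightarrow> S 0 x"
        using t0 t by (auto simp: continuous_within_sequentially o_def)
      then have "Bseq (\<lambda>n. S (t n) x)" using convergent_imp_Bseq convergentI by blast
      then show ?thesis unfolding Bseq_def by blast
    qed
    from uniform_boundedness_sequence[of "\<lambda>n. S (t n)", OF this]
    obtain M where M: "\<And>n. norm (S (t n)) \<le> M" by blast
    obtain n :: nat where "M \<le> real n" using real_arch_simple by blast
    with M[of n] big[of n] show False by linarith
  qed
  then obtain \<delta> M0 where \<delta>: "\<delta> > 0" and M0: "\<And>t. t \<in> {0..\<delta>} \<Longrightarrow> norm (S t) \<le> M0" by blast
  define M where "M = max 1 M0"
  have M: "norm (S t) \<le> M" if "0 \<le> t" "t \<le> \<delta>" for t using M0[of t] that by (simp add: M_def)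
  have M1: "1 \<le> M" by (simp add: M_def)
  have pow: "norm (S t) \<le> M ^ Suc n" if "0 \<le> t" "t \<le> real (Suc n) * \<delta>" for n t
    using that
  proof (induction n arbitrary: t)
    case 0
    then show ?case using M by simp
  next
    case (Suc n)
    show ?case
    proof (cases "t \<le> \<delta>")
      case True
      then have "norm (S t) \<le> M" using Suc M by simp
      also have "\<dots> \<le> M ^ Suc (Suc n)" using self_le_power[of M "Suc (Suc n)"] M1 by simp
      finally show ?thesis .
    next
      case False
      have "S t = S (\<delta> + (t - \<delta>))" by simp
      also have "\<dots> = S \<delta> o\<^sub>L S (t - \<delta>)"
        using sg False \<delta> unfolding c0_semigroup_def by (metis diff_ge_0_iff_ge less_imp_le not_le)
      finally have "norm (S t) \<le> norm (S \<delta>) * norm (S (t - \<delta>))" by (simp add: norm_blinfun_compose)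
      also have "\<dots> \<le> M * M ^ Suc n"
        using Suc.prems False \<delta> M1 by (intro mult_mono M Suc.IH) (auto simp: algebra_simps)
      finally show ?thesis by simp
    qed
  qed
  obtain n :: nat where n: "T / \<delta> \<le> real n" using real_arch_simple by blast
  have "norm (S t) \<le> M ^ Suc n" if "t \<in> {0..T}" for t
  proof (rule pow)
    have "T \<le> real n * \<delta>" using n \<delta> by (simp add: field_simps)
    then show "t \<le> real (Suc n) * \<delta>" using that \<delta> by (simp add: algebra_simps)
  qed (use that in simp)
  moreover have "1 \<le> M ^ Suc n" using M1 by (rule one_le_power)
  ultimately show ?thesis by blast
qed

text \<open>Continuity from the left is where the local bound enters. Freezing the semigroup at negative
  times makes the orbit continuous on the whole line.\<close>

lemma semigroup_continuous: "continuous_on UNIV (\<lambda>t. S (max 0 t) x)"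
proof (rule continuous_at_imp_continuous_on, rule ballI)
  fix t0 :: real
  define T where "T = \<bar>t0\<bar> + 1"
  obtain M where M: "M \<ge> 1" "\<And>t. t \<in> {0..T} \<Longrightarrow> norm (S t) \<le> M"
    using semigroup_locally_bounded by blast
  have lim: "((\<lambda>t. S t x) \<longlongrightarrow> x) (at 0 within {0..})"
    using semigroup_right_limit_0[of x] by (simp add: at_within_Ici_at_right)
  show "isCont (\<lambda>t. S (max 0 t) x) t0"
    unfolding continuous_at_eps_delta
  proof (intro allI impI)
    fix e :: real assume e: "e > 0"
    then have "e / M > 0" using M by simp
    then obtain d where d: "d > 0" "\<And>h. 0 \<le> h \<Longrightarrow> h < d \<Longrightarrow> dist (S h x) x < e / M"
      using lim unfolding Lim_within by (metis atLeast_iff dist_real_def diff_0_right abs_of_nonneg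
          dist_self order_le_less semigroup_0)
    have key: "dist (S (a + h) x) (S a x) < e" if "0 \<le> a" "a \<le> T" "0 \<le> h" "h < d" for a h
    proof -
      have "S (a + h) x - S a x = S a (S h x - x)"
        using that by (simp add: semigroup_add blinfun.diff_right)
      then have "dist (S (a + h) x) (S a x) \<le> norm (S a) * dist (S h x) x"
        by (simp add: dist_norm norm_blinfun)
      also have "\<dots> \<le> M * dist (S h x) x" using M that by (intro mult_right_mono) auto
      also have "\<dots> < M * (e / M)" using d that M by (intro mult_strict_left_mono) auto
      finally show ?thesis using M by simp
    qed
    show "\<exists>d>0. \<forall>t. dist t t0 < d \<longrightarrow> dist (S (max 0 t) x) (S (max 0 t0) x) < e"
    proof (intro exI[of _ "min d 1"] conjI allI impI)
      fix t assume "dist t t0 < min d 1"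
      then have t: "\<bar>t - t0\<bar> < d" "\<bar>t - t0\<bar> < 1" by (auto simp: dist_real_def)
      show "dist (S (max 0 t) x) (S (max 0 t0) x) < e"
      proof (cases "max 0 t0 \<le> max 0 t")
        case True
        then show ?thesis
          using key[of "max 0 t0" "max 0 t - max 0 t0"] t by (auto simp: T_def max_def split: if_splits)
      next
        case False
        then show ?thesis
          using key[of "max 0 t" "max 0 t0 - max 0 t"] t
          by (auto simp: T_def max_def dist_commute split: if_splits)
      qed
    qed (use d in simp)
  qed
qed

end

lemma average_tendsto:
  fixes f :: "real \<Rightarrow> 'a::banach"
  assumes cont: "continuous_on UNIV f"
  shows "((\<lambda>h. (1 / h) *\<^sub>R integral {t..t + h} f) \<longlongrightarrow> f t) (at_right 0)"
  unfolding tendsto_iff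
proof (intro allI impI)
  fix e :: real assume e: "e > 0"
  have "isCont f t" using cont by (simp add: continuous_on_eq_continuous_at)
  then obtain d where d: "d > 0" "\<And>u. dist u t < d \<Longrightarrow> dist (f u) (f t) < e / 2"
    unfolding continuous_at_eps_delta using e by (metis half_gt_zero)
  have int: "f integrable_on {a..b}" for a b
    by (intro integrable_continuous_real continuous_on_subset[OF cont]) simp
  show "eventually (\<lambda>h. dist ((1 / h) *\<^sub>R integral {t..t + h} f) (f t) < e) (at_right 0)"
  proof (rule eventually_at_rightI[of 0 d])
    fix h assume "h \<in> {0<..<d}"
    then have h: "0 < h" "h < d" by auto
    have "norm (integral {t..t + h} (\<lambda>u. f u - f t)) \<le> (e / 2) * (t + h - t)"
    proof (rule integral_bound)
      show "continuous_on {t..t + h} (\<lambda>u. f u - f t)"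
        by (intro continuous_intros continuous_on_subset[OF cont]) simp
      show "\<And>u. u \<in> {t..t + h} \<Longrightarrow> norm (f u - f t) \<le> e / 2"
        using d h by (auto simp: dist_norm intro!: less_imp_le)
    qed (use h in simp)
    also have "integral {t..t + h} (\<lambda>u. f u - f t) = integral {t..t + h} f - h *\<^sub>R f t"
      using h by (subst integral_diff[OF int integrable_const_ivl]) simp_all
    finally have "norm (integral {t..t + h} f - h *\<^sub>R f t) \<le> (e / 2) * h" by simp
    moreover have "(1 / h) *\<^sub>R integral {t..t + h} f - f t = (1 / h) *\<^sub>R (integral {t..t + h} f - h *\<^sub>R f t)"
      using h by (simp add: scaleR_diff_right)
    ultimately have "dist ((1 / h) *\<^sub>R integral {t..t + h} f) (f t) \<le> e / 2"
      unfolding dist_norm using h by (simp only: norm_scaleR) (simp add: pos_divide_le_eq)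
    then show "dist ((1 / h) *\<^sub>R integral {t..t + h} f) (f t) < e" using e by linarith
  qed (use d in simp)
qed

context
  fixes S :: "real \<Rightarrow> 'h::{real_inner, banach} \<Rightarrow>\<^sub>L 'h" and A :: "'h \<Rightarrow> 'h" and D :: "'h set" and \<beta> :: real
  assumes gen: "generates_c0_semigroup A D S"
    and diss: "\<And>y. y \<in> D \<Longrightarrow> inner (A y) y \<le> - \<beta> * (norm y)\<^sup>2"
    and \<beta>: "\<beta> > 0"
begin

lemma sg: "c0_semigroup S"
  using gen by (simp add: generates_c0_semigroup_def)

lemma domain_iff: "y \<in> D \<longleftrightarrow> (\<exists>z. ((\<lambda>t. (1 / t) *\<^sub>R (S t y - y)) \<longlongrightarrow> z) (at_right 0))"
proof -
  have "D = {x. \<exists>y. ((\<lambda>t. (1 / t) *\<^sub>R (S t x - x)) \<longlongrightarrow> y) (at_right 0)}"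
    using gen by (simp only: generates_c0_semigroup_def)
  then show ?thesis by (simp only: mem_Collect_eq)
qed

lemma generator_limit: "y \<in> D \<Longrightarrow> ((\<lambda>t. (1 / t) *\<^sub>R (S t y - y)) \<longlongrightarrow> A y) (at_right 0)"
  using gen by (simp only: generates_c0_semigroup_def)

text \<open>The averages of the orbit of \<open>x\<close> over \<open>[0, h]\<close> lie in the domain and tend to \<open>x\<close>.\<close>

lemma generator_dense: "closure D = UNIV"
proof (rule set_eqI)
  fix x :: 'h
  define f where "f t = S (max 0 t) x" for t
  have cont: "continuous_on UNIV f" unfolding f_def by (rule semigroup_continuous[OF sg])
  have int: "f integrable_on {a..b}" for a b
    by (intro integrable_continuous_real continuous_on_subset[OF cont]) simp
  define w where "w t = integral {0..t} f" for t
  have w_in_D: "w t \<in> D" if t: "t > 0" for t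
  proof -
    have "((\<lambda>h. (1 / h) *\<^sub>R integral {t..t + h} f - (1 / h) *\<^sub>R integral {0..0 + h} f) \<longlongrightarrow> f t - f 0) (at_right 0)"
      by (intro tendsto_intros average_tendsto cont)
    moreover have "eventually (\<lambda>h. (1 / h) *\<^sub>R integral {t..t + h} f - (1 / h) *\<^sub>R integral {0..0 + h} f
        = (1 / h) *\<^sub>R (S h (w t) - w t)) (at_right 0)"
    proof (rule eventually_at_rightI[of 0 t])
      fix h assume "h \<in> {0<..<t}"
      then have h: "0 < h" "h < t" by auto
      have "S h (w t) = integral {0..t} (\<lambda>s. S h (f s))"
        unfolding w_def using integral_linear[OF int blinfun.bounded_linear_right, of 0 t "S h"] by (simp add: o_def)
      also have "\<dots> = integral {0..t} (\<lambda>s. f (s + h))"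
        using h by (intro integral_cong) (simp add: f_def semigroup_add[OF sg, symmetric] add.commute max_def)
      also have "\<dots> = integral {h..t + h} f"
        using integral_shift_real_ivl[of h h "t + h" f] by simp
      finally have 1: "S h (w t) = integral {h..t + h} f" .
      have 2: "integral {0..h} f + integral {h..t + h} f = integral {0..t + h} f"
        using h by (intro Henstock_Kurzweil_Integration.integral_combine int) auto
      have 3: "integral {0..t} f + integral {t..t + h} f = integral {0..t + h} f"
        using h by (intro Henstock_Kurzweil_Integration.integral_combine int) auto
      have "S h (w t) - w t = integral {t..t + h} f - integral {0..h} f"
      proof -
        have "integral {h..t + h} f = integral {0..t + h} f - integral {0..h} f"
          "integral {t..t + h} f = integral {0..t + h} f - integral {0..t} f"
          using 2 3 by (simp_all add: eq_diff_eq add.commute)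
        then show ?thesis unfolding 1 unfolding w_def by simp
      qed
      then show "(1 / h) *\<^sub>R integral {t..t + h} f - (1 / h) *\<^sub>R integral {0..0 + h} f = (1 / h) *\<^sub>R (S h (w t) - w t)"
        by (simp add: scaleR_diff_right)
    qed (use t in simp)
    ultimately have "((\<lambda>h. (1 / h) *\<^sub>R (S h (w t) - w t)) \<longlongrightarrow> f t - f 0) (at_right 0)"
      by (rule Lim_transform_eventually)
    then show ?thesis unfolding domain_iff by (rule exI)
  qed
  have cone: "c *\<^sub>R y \<in> D" if y: "y \<in> D" for c y
  proof -
    from y[unfolded domain_iff] obtain z where z: "((\<lambda>t. (1 / t) *\<^sub>R (S t y - y)) \<longlongrightarrow> z) (at_right 0)"
      by (rule exE)
    then have "((\<lambda>t. c *\<^sub>R ((1 / t) *\<^sub>R (S t y - y))) \<longlongrightarrow> c *\<^sub>R z) (at_right 0)" by (intro tendsto_intros)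
    moreover have "c *\<^sub>R ((1 / t) *\<^sub>R (S t y - y)) = (1 / t) *\<^sub>R (S t (c *\<^sub>R y) - c *\<^sub>R y)" for t
      by (simp add: blinfun.scaleR_right scaleR_diff_right mult.commute)
    ultimately have "((\<lambda>t. (1 / t) *\<^sub>R (S t (c *\<^sub>R y) - c *\<^sub>R y)) \<longlongrightarrow> c *\<^sub>R z) (at_right 0)" by simp
    then show ?thesis unfolding domain_iff by (rule exI)
  qed
  have "((\<lambda>h. (1 / h) *\<^sub>R integral {0..0 + h} f) \<longlongrightarrow> f 0) (at_right 0)"
    by (rule average_tendsto[OF cont])
  then have lim: "((\<lambda>h. (1 / h) *\<^sub>R w h) \<longlongrightarrow> x) (at_right 0)"
    by (simp add: w_def f_def semigroup_0[OF sg])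
  have "x \<in> closure D"
  proof (rule Lim_in_closed_set[OF closed_closure _ _ lim])
    show "eventually (\<lambda>h. (1 / h) *\<^sub>R w h \<in> closure D) (at_right 0)"
      by (rule eventually_at_rightI[of 0 1]) (auto intro!: subsetD[OF closure_subset] cone w_in_D)
  qed simp
  then show "x \<in> closure D \<longleftrightarrow> x \<in> UNIV" by simp
qed

text \<open>A step of length \<open>h\<close> multiplies \<open>norm (S s y) ^ 2\<close> by at most \<open>1 - 2 \<beta> h\<close>, up to an error
  \<open>h \<epsilon> h\<close> in which \<open>\<epsilon> h\<close> tends to 0 and does not depend on \<open>s\<close>. Iterating \<open>n\<close> steps of length
  \<open>t / n\<close> gives the exponential in the limit.\<close>

lemma semigroup_decay_on_domain:
  assumes y: "y \<in> D" and t: "t \<ge> 0"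
  shows "(norm (S t y))\<^sup>2 \<le> exp (- (2 * \<beta> * t)) * (norm y)\<^sup>2"
proof -
  obtain M where M: "M \<ge> 1" "\<And>s. s \<in> {0..t} \<Longrightarrow> norm (S s) \<le> M"
    using semigroup_locally_bounded[OF sg] by blast
  define r where "r h = (1 / h) *\<^sub>R (S h y - y) - A y" for h
  have "((\<lambda>h. (1 / h) *\<^sub>R (S h y - y)) \<longlongrightarrow> A y) (at_right 0)"
    by (rule generator_limit[OF y])
  then have "((\<lambda>h. (1 / h) *\<^sub>R (S h y - y) - A y) \<longlongrightarrow> A y - A y) (at_right 0)"
    by (intro tendsto_intros)
  then have r0: "(r \<longlongrightarrow> 0) (at_right 0)" by (simp add: r_def[abs_def])
  have orbit: "S s y \<in> D" "A (S s y) = S s (A y)" if s: "s \<ge> 0" for s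
  proof -
    have "((\<lambda>h. (1 / h) *\<^sub>R (S h y - y)) \<longlongrightarrow> A y) (at_right 0)"
      by (rule generator_limit[OF y])
    then have "((\<lambda>h. S s ((1 / h) *\<^sub>R (S h y - y))) \<longlongrightarrow> S s (A y)) (at_right 0)"
      by (intro tendsto_intros)
    moreover have "eventually (\<lambda>h. S s ((1 / h) *\<^sub>R (S h y - y)) = (1 / h) *\<^sub>R (S h (S s y) - S s y)) (at_right 0)"
      by (rule eventually_at_rightI[of 0 1])
        (use s in \<open>simp_all add: blinfun.scaleR_right blinfun.diff_right semigroup_add[OF sg, symmetric] add.commute\<close>)
    ultimately have lim: "((\<lambda>h. (1 / h) *\<^sub>R (S h (S s y) - S s y)) \<longlongrightarrow> S s (A y)) (at_right 0)"
      by (rule Lim_transform_eventually)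
    then show D: "S s y \<in> D" unfolding domain_iff by (rule exI)
    then have "((\<lambda>h. (1 / h) *\<^sub>R (S h (S s y) - S s y)) \<longlongrightarrow> A (S s y)) (at_right 0)"
      by (rule generator_limit)
    then show "A (S s y) = S s (A y)" using lim by (intro tendsto_unique[of "at_right 0"]) auto
  qed
  define \<epsilon> where "\<epsilon> h = 2 * M\<^sup>2 * norm y * norm (r h) + h * (M * (norm (A y) + norm (r h)))\<^sup>2" for h
  have step: "(norm (S (s + h) y))\<^sup>2 \<le> (1 - 2 * \<beta> * h) * (norm (S s y))\<^sup>2 + h * \<epsilon> h"
    if s: "0 \<le> s" "s \<le> t" and h: "0 < h" for s h
  proof -
    have "S h y - y = h *\<^sub>R (A y + r h)" using h by (simp add: r_def)
    then have "S s (S h y) - S s y = S s (h *\<^sub>R (A y + r h))" by (metis blinfun.diff_right)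
    then have eq: "S (s + h) y = S s y + h *\<^sub>R S s (A y + r h)"
      using semigroup_add[OF sg s(1) less_imp_le[OF h], of y]
      by (simp add: blinfun.scaleR_right diff_eq_eq add.commute[of "h *\<^sub>R _"])
    have "(norm (S (s + h) y))\<^sup>2 = (norm (S s y))\<^sup>2 + 2 * h * inner (S s (A y)) (S s y)
        + 2 * h * inner (S s y) (S s (r h)) + h * (h * (norm (S s (A y + r h)))\<^sup>2)"
      unfolding eq power2_norm_eq_inner
      by (simp add: inner_add_left inner_add_right inner_commute blinfun.add_right algebra_simps)
    also have "\<dots> \<le> (norm (S s y))\<^sup>2 + 2 * h * (- \<beta> * (norm (S s y))\<^sup>2)
        + 2 * h * (M\<^sup>2 * norm y * norm (r h)) + h * (h * (M * (norm (A y) + norm (r h)))\<^sup>2)"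
    proof (intro add_mono mult_left_mono power_mono)
      show "inner (S s (A y)) (S s y) \<le> - \<beta> * (norm (S s y))\<^sup>2"
        using diss[OF orbit(1)[OF s(1)]] orbit(2)[OF s(1)] by simp
      have le: "norm (S s z) \<le> M * norm z" for z
        using norm_blinfun[of "S s" z] M(2)[of s] s mult_right_mono[of "norm (S s)" M "norm z"] by auto
      have "inner (S s y) (S s (r h)) \<le> norm (S s y) * norm (S s (r h))" by (rule norm_cauchy_schwarz)
      also have "\<dots> \<le> (M * norm y) * (M * norm (r h))"
        using M by (intro mult_mono le) auto
      finally show "inner (S s y) (S s (r h)) \<le> M\<^sup>2 * norm y * norm (r h)"
        by (simp add: power2_eq_square ac_simps)
      have "norm (S s (A y + r h)) \<le> M * norm (A y + r h)" by (rule le)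
      also have "\<dots> \<le> M * (norm (A y) + norm (r h))"
        using M by (intro mult_left_mono norm_triangle_ineq) auto
      finally show "norm (S s (A y + r h)) \<le> M * (norm (A y) + norm (r h))" .
    qed (use h in auto)
    also have "\<dots> = (1 - 2 * \<beta> * h) * (norm (S s y))\<^sup>2 + h * \<epsilon> h"
      by (simp add: \<epsilon>_def algebra_simps)
    finally show ?thesis .
  qed
  have \<epsilon>0: "(\<epsilon> \<longlongrightarrow> 0) (at_right 0)"
  proof -
    have "((\<lambda>h. 2 * M\<^sup>2 * norm y * norm (r h) + h * (M * (norm (A y) + norm (r h)))\<^sup>2)
        \<longlongrightarrow> 2 * M\<^sup>2 * norm y * norm (0::'h) + 0 * (M * (norm (A y) + norm (0::'h)))\<^sup>2) (at_right 0)"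
      by (intro tendsto_intros r0)
    then show ?thesis by (simp add: \<epsilon>_def[abs_def])
  qed
  show ?thesis
  proof (cases "t = 0")
    case False
    define h where "h n = t / real (Suc n)" for n
    have hpos: "0 < h n" for n using t False by (simp add: h_def)
    have hne: "h n \<noteq> 0" for n using hpos[of n] by simp
    have h0: "h \<longlonglongrightarrow> 0"
      using tendsto_mult_right_zero[OF LIMSEQ_inverse_real_of_nat, of t]
      by (simp add: h_def[abs_def] divide_inverse)
    have e0: "(\<lambda>n. \<epsilon> (h n)) \<longlonglongrightarrow> 0"
      by (rule filterlim_compose[OF \<epsilon>0]) (use h0 hpos hne in \<open>simp add: filterlim_at\<close>)
    have "eventually (\<lambda>n. h n < 1 / (2 * \<beta>)) sequentially"
      by (rule order_tendstoD[OF h0]) (use \<beta> in simp)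
    then have bound: "eventually (\<lambda>n. (norm (S t y))\<^sup>2 \<le> exp (- (2 * \<beta> * t)) * (norm y)\<^sup>2 + t * \<epsilon> (h n)) sequentially"
    proof eventually_elim
      case (elim n)
      define q where "q = 1 - 2 * \<beta> * h n"
      have q: "0 \<le> q" "q \<le> 1" using elim \<beta> hpos[of n] by (auto simp: q_def field_simps)
      have \<epsilon>n: "0 \<le> \<epsilon> (h n)" unfolding \<epsilon>_def using hpos[of n] by simp
      have it: "(norm (S (real k * h n) y))\<^sup>2 \<le> q ^ k * (norm y)\<^sup>2 + real k * (h n * \<epsilon> (h n))"
        if "k \<le> Suc n" for k
        using that
      proof (induction k)
        case 0
        then show ?case by (simp add: semigroup_0[OF sg])
      next
        case (Suc k)
        have kt: "real k * h n \<le> t"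
        proof -
          have "real k * h n \<le> real (Suc n) * h n" using Suc.prems hpos[of n] by (intro mult_right_mono) auto
          then show ?thesis by (simp add: h_def)
        qed
        have "(norm (S (real (Suc k) * h n) y))\<^sup>2 = (norm (S (real k * h n + h n) y))\<^sup>2"
          by (simp add: algebra_simps)
        also have "\<dots> \<le> q * (norm (S (real k * h n) y))\<^sup>2 + h n * \<epsilon> (h n)"
          unfolding q_def by (rule step) (use kt hpos[of n] in auto)
        also have "\<dots> \<le> q * (q ^ k * (norm y)\<^sup>2 + real k * (h n * \<epsilon> (h n))) + h n * \<epsilon> (h n)"
          using Suc q by (intro add_right_mono mult_left_mono) auto
        also have "\<dots> \<le> q ^ Suc k * (norm y)\<^sup>2 + real (Suc k) * (h n * \<epsilon> (h n))"
        proof -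
          have "q * (real k * (h n * \<epsilon> (h n))) \<le> 1 * (real k * (h n * \<epsilon> (h n)))"
            using q \<epsilon>n hpos[of n] by (intro mult_right_mono) auto
          then show ?thesis by (simp add: algebra_simps)
        qed
        finally show ?case .
      qed
      have "q \<le> exp (- (2 * \<beta> * h n))" using exp_ge_add_one_self[of "- (2 * \<beta> * h n)"] by (simp add: q_def)
      then have "q ^ Suc n \<le> exp (- (2 * \<beta> * h n)) ^ Suc n" using q by (intro power_mono) auto
      also have "\<dots> = exp (- (2 * \<beta> * t))"
        by (simp add: exp_of_nat_mult[symmetric] h_def del: power_Suc)
      finally have "q ^ Suc n * (norm y)\<^sup>2 \<le> exp (- (2 * \<beta> * t)) * (norm y)\<^sup>2" by (intro mult_right_mono) auto
      moreover have "real (Suc n) * h n = t" by (simp add: h_def)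
      ultimately show ?case using it[of "Suc n"] by (simp add: mult.assoc[symmetric])
    qed
    have "(\<lambda>n. exp (- (2 * \<beta> * t)) * (norm y)\<^sup>2 + t * \<epsilon> (h n)) \<longlonglongrightarrow> exp (- (2 * \<beta> * t)) * (norm y)\<^sup>2 + t * 0"
      by (intro tendsto_intros e0)
    then show ?thesis using tendsto_lowerbound[OF _ bound] by simp
  qed (simp add: semigroup_0[OF sg])
qed

lemma semigroup_decay:
  assumes t: "t \<ge> 0"
  shows "norm (S t x) \<le> exp (- \<beta> * t) * norm x"
proof -
  have on_domain: "norm (S t y) \<le> exp (- \<beta> * t) * norm y" if "y \<in> D" for y
  proof (rule power2_le_imp_le)
    have "(norm (S t y))\<^sup>2 \<le> exp (- (2 * \<beta> * t)) * (norm y)\<^sup>2"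
      by (rule semigroup_decay_on_domain[OF that t])
    also have "exp (- (2 * \<beta> * t)) = (exp (- \<beta> * t))\<^sup>2"
      by (simp add: power2_eq_square exp_add[symmetric])
    finally show "(norm (S t y))\<^sup>2 \<le> (exp (- \<beta> * t) * norm y)\<^sup>2" by (simp add: power_mult_distrib)
  qed simp
  have "x \<in> closure D" using generator_dense by simp
  then obtain y where y: "\<And>n. y n \<in> D" "y \<longlonglongrightarrow> x" unfolding closure_sequential by auto
  show ?thesis
  proof (rule LIMSEQ_le)
    show "(\<lambda>n. norm (S t (y n))) \<longlonglongrightarrow> norm (S t x)" by (intro tendsto_intros y)
    show "(\<lambda>n. exp (- \<beta> * t) * norm (y n)) \<longlonglongrightarrow> exp (- \<beta> * t) * norm x" by (intro tendsto_intros y)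
  qed (use on_domain y in blast)
qed

end

lemma contraction_semigroup_jointly_continuous:
  fixes S :: "real \<Rightarrow> 'h::banach \<Rightarrow>\<^sub>L 'h"
  assumes sg: "c0_semigroup S" and contr: "\<And>t x. t \<ge> 0 \<Longrightarrow> norm (S t x) \<le> norm x"
  shows "continuous_on UNIV (\<lambda>p. S (max 0 (fst p)) (snd p))"
  unfolding continuous_on_def
proof (intro ballI)
  fix p :: "real \<times> 'h"
  have "((\<lambda>q. S (max 0 (fst q)) (snd q) - S (max 0 (fst p)) (snd p)) \<longlongrightarrow> 0) (at p)"
  proof (rule Lim_null_comparison[OF always_eventually])
    show "\<forall>q. norm (S (max 0 (fst q)) (snd q) - S (max 0 (fst p)) (snd p))
        \<le> norm (snd q - snd p) + norm (S (max 0 (fst q)) (snd p) - S (max 0 (fst p)) (snd p))"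
    proof
      fix q :: "real \<times> 'h"
      have "S (max 0 (fst q)) (snd q) - S (max 0 (fst p)) (snd p)
          = S (max 0 (fst q)) (snd q - snd p) + (S (max 0 (fst q)) (snd p) - S (max 0 (fst p)) (snd p))"
        by (simp add: blinfun.diff_right)
      then have "norm (S (max 0 (fst q)) (snd q) - S (max 0 (fst p)) (snd p))
        \<le> norm (S (max 0 (fst q)) (snd q - snd p)) + norm (S (max 0 (fst q)) (snd p) - S (max 0 (fst p)) (snd p))"
        by (simp only: norm_triangle_ineq)
      also have "\<dots> \<le> norm (snd q - snd p) + norm (S (max 0 (fst q)) (snd p) - S (max 0 (fst p)) (snd p))"
        by (intro add_right_mono contr) simp
      finally show "norm (S (max 0 (fst q)) (snd q) - S (max 0 (fst p)) (snd p))
        \<le> norm (snd q - snd p) + norm (S (max 0 (fst q)) (snd p) - S (max 0 (fst p)) (snd p))" .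
    qed
    have "isCont (\<lambda>t. S (max 0 t) (snd p)) (fst p)"
      using semigroup_continuous[OF sg, of "snd p"] by (simp add: continuous_on_eq_continuous_at)
    then have 1: "((\<lambda>q. S (max 0 (fst q)) (snd p)) \<longlongrightarrow> S (max 0 (fst p)) (snd p)) (at p)"
      by (rule isCont_tendsto_compose) (intro tendsto_intros)
    have "((\<lambda>q. norm (snd q - snd p) + norm (S (max 0 (fst q)) (snd p) - S (max 0 (fst p)) (snd p)))
       \<longlongrightarrow> norm (snd p - snd p) + norm (S (max 0 (fst p)) (snd p) - S (max 0 (fst p)) (snd p))) (at p)"
      by (intro tendsto_intros 1)
    then show "((\<lambda>q. norm (snd q - snd p) + norm (S (max 0 (fst q)) (snd p) - S (max 0 (fst p)) (snd p)))
       \<longlongrightarrow> 0) (at p)" by simp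
  qed
  then show "((\<lambda>q. S (max 0 (fst q)) (snd q)) \<longlongrightarrow> S (max 0 (fst p)) (snd p)) (at p within UNIV)"
    by (simp add: LIM_zero_iff)
qed

section \<open>Integral inequalities and the energy of mild solutions\<close>

lemma borel_measurable_compose_pair:
  fixes G :: "'a::second_countable_topology \<Rightarrow> 'b::second_countable_topology \<Rightarrow> 'c::topological_space"
  assumes G: "(\<lambda>p. G (fst p) (snd p)) \<in> borel_measurable borel"
    and [measurable]: "f \<in> borel_measurable M" "g \<in> borel_measurable M"
  shows "(\<lambda>w. G (f w) (g w)) \<in> borel_measurable M"
proof -
  have [measurable]: "(\<lambda>p. G (fst p) (snd p)) \<in> borel_measurable (borel \<Otimes>\<^sub>M borel)"
    using G by (simp add: borel_prod)
  have "(\<lambda>w. (\<lambda>p. G (fst p) (snd p)) (f w, g w)) \<in> borel_measurable M" by measurable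
  then show ?thesis by simp
qed

lemma continuous_bounded_Icc:
  fixes w :: "real \<Rightarrow> 'a::real_normed_vector"
  assumes "continuous_on UNIV w"
  shows "\<exists>B. \<forall>s\<in>{0..T}. norm (w s) \<le> B"
proof -
  have "bounded (w ` {0..T})"
    by (intro compact_imp_bounded compact_continuous_image continuous_on_subset[OF assms]) auto
  then show ?thesis unfolding bounded_iff by blast
qed

lemma set_integrable_bounded_Icc:
  fixes g :: "real \<Rightarrow> 'a::{banach, second_countable_topology}"
  assumes "g \<in> borel_measurable borel" "\<And>s. s \<in> {a..b} \<Longrightarrow> norm (g s) \<le> K"
  shows "set_integrable lborel {a..b} g"
  unfolding set_integrable_def
proof (rule Bochner_Integration.integrable_bound)
  show "integrable lborel (\<lambda>s. indicator {a..b} s * K :: real)"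
    by (intro integrable_mult_left integrable_real_indicator) (auto simp: emeasure_lborel_Icc_eq)
  show "(\<lambda>s. indicator {a..b} s *\<^sub>R g s) \<in> borel_measurable lborel"
    using assms(1) by simp
  show "AE s in lborel. norm (indicator {a..b} s *\<^sub>R g s) \<le> norm (indicator {a..b} s * K)"
    using assms(2) by (auto simp: indicator_def intro: order_trans[OF _ abs_ge_self])
qed

lemma set_integral_Ioc_eq_Icc:
  fixes f :: "real \<Rightarrow> 'a::{banach, second_countable_topology}"
  assumes [measurable]: "f \<in> borel_measurable borel"
  shows "(LINT s:{a<..b}|lborel. f s) = (LINT s:{a..b}|lborel. f s)"
  unfolding set_lebesgue_integral_def
proof (rule integral_cong_AE)
  show "AE s in lborel. indicator {a<..b} s *\<^sub>R f s = indicator {a..b} s *\<^sub>R f s"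
    using AE_lborel_singleton[of a] by eventually_elim (auto simp: indicator_def)
qed simp_all

lemma set_integral_Icc_split:
  fixes f :: "real \<Rightarrow> 'a::{banach, second_countable_topology}"
  assumes f: "f \<in> borel_measurable borel" and int: "set_integrable lborel {a..c} f" and "a \<le> b" "b \<le> c"
  shows "(LINT s:{a..c}|lborel. f s) = (LINT s:{a..b}|lborel. f s) + (LINT s:{b..c}|lborel. f s)"
proof -
  have "{a..c} = {a..b} \<union> {b<..c}" using assms by auto
  then have "(LINT s:{a..c}|lborel. f s) = (LINT s:{a..b} \<union> {b<..c}|lborel. f s)" by simp
  also have "\<dots> = (LINT s:{a..b}|lborel. f s) + (LINT s:{b<..c}|lborel. f s)"
    by (rule set_integral_Un) (use assms in \<open>auto intro!: set_integrable_subset[OF int]\<close>)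
  also have "(LINT s:{b<..c}|lborel. f s) = (LINT s:{b..c}|lborel. f s)"
    by (rule set_integral_Ioc_eq_Icc[OF f])
  finally show ?thesis .
qed

lemma norm_set_integral_Icc_le:
  fixes g :: "real \<Rightarrow> 'a::{banach, second_countable_topology}"
  assumes "g \<in> borel_measurable borel" "\<And>s. s \<in> {a..b} \<Longrightarrow> norm (g s) \<le> K" "a \<le> b"
  shows "norm (LINT s:{a..b}|lborel. g s) \<le> K * (b - a)"
proof -
  have "norm (LINT s:{a..b}|lborel. g s) \<le> (LINT s:{a..b}|lborel. norm (g s))"
    by (rule set_integral_norm_bound[OF set_integrable_bounded_Icc[OF assms(1,2)]])
  also have "\<dots> \<le> (LINT s:{a..b}|lborel. K)"
  proof (rule set_integral_mono)
    show "set_integrable lborel {a..b} (\<lambda>s. norm (g s))"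
      using assms by (intro set_integrable_bounded_Icc[where K = K]) auto
    show "set_integrable lborel {a..b} (\<lambda>s. K)"
      by (intro set_integrable_bounded_Icc[where K = "\<bar>K\<bar>"]) auto
  qed (use assms in auto)
  also have "\<dots> = K * (b - a)" using assms(3) by (simp add: set_lebesgue_integral_def)
  finally show ?thesis .
qed

text \<open>Over \<open>n\<close> equal steps the increments add up to at most \<open>C T ^ 2 / n\<close>. The lemma stands in for
  a derivative in situations where the integrands are merely measurable.\<close>

lemma quadratic_increments_imp_le:
  fixes \<Phi> :: "real \<Rightarrow> real"
  assumes incr: "\<And>s t. 0 \<le> s \<Longrightarrow> s \<le> t \<Longrightarrow> t \<le> T \<Longrightarrow> \<Phi> t - \<Phi> s \<le> C * (t - s)\<^sup>2" and T: "0 \<le> T"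
  shows "\<Phi> T \<le> \<Phi> 0"
proof -
  have est: "\<Phi> T \<le> \<Phi> 0 + C * T\<^sup>2 / real (Suc n)" for n
  proof -
    define h where "h = T / real (Suc n)"
    have h: "0 \<le> h" "real (Suc n) * h = T" using T by (auto simp: h_def)
    have "\<Phi> (real k * h) \<le> \<Phi> 0 + real k * (C * h\<^sup>2)" if "k \<le> Suc n" for k
      using that
    proof (induction k)
      case (Suc k)
      have "real (Suc k) * h \<le> real (Suc n) * h" using Suc.prems h by (intro mult_right_mono) auto
      then have "\<Phi> (real (Suc k) * h) - \<Phi> (real k * h) \<le> C * (real (Suc k) * h - real k * h)\<^sup>2"
        using h by (intro incr) (auto simp: algebra_simps)
      moreover have "real (Suc k) * h - real k * h = h" by (simp add: algebra_simps)
      ultimately show ?case using Suc by (simp add: algebra_simps)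
    qed simp
    from this[of "Suc n"] have "\<Phi> T \<le> \<Phi> 0 + real (Suc n) * (C * h\<^sup>2)" using h by simp
    also have "real (Suc n) * (C * h\<^sup>2) = C * T\<^sup>2 / real (Suc n)"
      unfolding h_def by (simp add: power2_eq_square)
    finally show ?thesis .
  qed
  have "(\<lambda>n. \<Phi> 0 + (C * T\<^sup>2) * inverse (real (Suc n))) \<longlonglongrightarrow> \<Phi> 0 + (C * T\<^sup>2) * 0"
    by (intro tendsto_intros LIMSEQ_inverse_real_of_nat)
  then have "\<Phi> T \<le> \<Phi> 0 + (C * T\<^sup>2) * 0"
    by (rule LIMSEQ_le_const) (use est in \<open>auto simp: divide_inverse\<close>)
  then show ?thesis by simp
qed

text \<open>The nonlinear Gronwall inequality of Ou-Iang. With \<open>R t\<close> equal to \<open>c ^ 2 + \<epsilon>\<close> plus twice the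
  integral of \<open>g \<phi>\<close> up to \<open>t\<close>, one has formally \<open>(sqrt R)' = g \<phi> / sqrt R \<le> g\<close>. The rigorous version
  is that \<open>sqrt R\<close> minus the integral of \<open>g\<close> has increments of quadratic size; \<open>\<epsilon>\<close> keeps \<open>R\<close> away
  from 0 and is removed at the end.\<close>

lemma ou_iang:
  fixes \<phi> g :: "real \<Rightarrow> real"
  assumes [measurable]: "\<phi> \<in> borel_measurable borel" "g \<in> borel_measurable borel"
    and \<phi>: "\<And>s. s \<in> {0..T} \<Longrightarrow> 0 \<le> \<phi> s" "\<And>s. s \<in> {0..T} \<Longrightarrow> \<phi> s \<le> B"
    and g: "\<And>s. s \<in> {0..T} \<Longrightarrow> 0 \<le> g s" "\<And>s. s \<in> {0..T} \<Longrightarrow> g s \<le> K"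
    and c: "0 \<le> c" and T: "0 \<le> T"
    and le: "\<And>t. t \<in> {0..T} \<Longrightarrow> (\<phi> t)\<^sup>2 \<le> c\<^sup>2 + 2 * (LINT s:{0..t}|lborel. g s * \<phi> s)"
  shows "\<phi> T \<le> c + (LINT s:{0..T}|lborel. g s)"
proof -
  have B: "0 \<le> B" and K: "0 \<le> K" using \<phi>[of 0] g[of 0] T by auto
  have g\<phi>: "0 \<le> g s * \<phi> s" "g s * \<phi> s \<le> K * B" if "s \<in> {0..T}" for s
    using \<phi>[OF that] g[OF that] by (auto intro!: mult_mono K)
  have int_g: "set_integrable lborel {a..b} g" if "0 \<le> a" "b \<le> T" for a b
    using g that by (intro set_integrable_bounded_Icc[where K = K]) auto
  have int_g\<phi>: "set_integrable lborel {a..b} (\<lambda>s. g s * \<phi> s)" if "0 \<le> a" "b \<le> T" for a b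
    using g\<phi> that by (intro set_integrable_bounded_Icc[where K = "K * B"]) auto
  have main: "\<phi> T \<le> sqrt (c\<^sup>2 + \<epsilon>) + (LINT s:{0..T}|lborel. g s)" if \<epsilon>: "\<epsilon> > 0" for \<epsilon>
  proof -
    define R where "R t = c\<^sup>2 + \<epsilon> + 2 * (LINT s:{0..t}|lborel. g s * \<phi> s)" for t
    have R_diff: "R t - R s = 2 * (LINT r:{s..t}|lborel. g r * \<phi> r)" if "0 \<le> s" "s \<le> t" "t \<le> T" for s t
      using that by (simp add: R_def set_integral_Icc_split[OF _ int_g\<phi>, of 0 t s])
    have R_incr: "0 \<le> R t - R s" "R t - R s \<le> 2 * (K * B) * (t - s)" if st: "0 \<le> s" "s \<le> t" "t \<le> T" for s t
    proof -
      have "0 \<le> (LINT r:{s..t}|lborel. g r * \<phi> r)"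
        unfolding set_lebesgue_integral_def
        by (intro Bochner_Integration.integral_nonneg) (use g\<phi> st in \<open>auto simp: indicator_def\<close>)
      then show "0 \<le> R t - R s" using R_diff[OF st] by simp
      have "norm (LINT r:{s..t}|lborel. g r * \<phi> r) \<le> (K * B) * (t - s)"
        by (rule norm_set_integral_Icc_le) (use g\<phi> st in auto)
      then show "R t - R s \<le> 2 * (K * B) * (t - s)" using R_diff[OF st] by simp
    qed
    have R0: "R 0 = c\<^sup>2 + \<epsilon>"
    proof -
      have "norm (LINT r:{0..0}|lborel. g r * \<phi> r) \<le> (K * B) * (0 - 0)"
        by (rule norm_set_integral_Icc_le) (use g\<phi> T in auto)
      then show ?thesis by (simp add: R_def)
    qed
    have R_pos: "\<epsilon> \<le> R t" if "0 \<le> t" "t \<le> T" for t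
      using R_incr(1)[of 0 t] that R0 zero_le_power2[of c] by linarith
    define \<Phi> where "\<Phi> t = sqrt (R t) - (LINT s:{0..t}|lborel. g s)" for t
    have "\<Phi> T \<le> \<Phi> 0"
    proof (rule quadratic_increments_imp_le[OF _ T])
      fix s t assume st: "0 \<le> s" "s \<le> t" "t \<le> T"
      define I where "I = (LINT r:{s..t}|lborel. g r)"
      have I: "0 \<le> I" "I \<le> K * (t - s)"
      proof -
        show "0 \<le> I" unfolding I_def set_lebesgue_integral_def
          by (intro Bochner_Integration.integral_nonneg) (use g st in \<open>auto simp: indicator_def\<close>)
        have "norm I \<le> K * (t - s)"
          unfolding I_def by (rule norm_set_integral_Icc_le) (use g st in auto)
        then show "I \<le> K * (t - s)" by simp
      qed
      have pos: "0 < sqrt (R s)" "sqrt (R s) \<le> sqrt (R t)" "\<epsilon> \<le> R s"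
        using R_pos[of s] R_incr(1)[OF st] st \<epsilon> by auto
      have "(LINT r:{s..t}|lborel. g r * \<phi> r) \<le> (LINT r:{s..t}|lborel. sqrt (R t) * g r)"
      proof (rule set_integral_mono)
        show "set_integrable lborel {s..t} (\<lambda>r. g r * \<phi> r)" using st by (intro int_g\<phi>) auto
        show "set_integrable lborel {s..t} (\<lambda>r. sqrt (R t) * g r)"
          using st by (intro set_integrable_mult_right int_g) auto
        fix r assume r: "r \<in> {s..t}"
        have "(\<phi> r)\<^sup>2 \<le> R r" using le[of r] r st \<epsilon> by (simp add: R_def)
        also have "\<dots> \<le> R t" using R_incr(1)[of r t] r st by auto
        finally have "\<phi> r \<le> sqrt (R t)" by (rule real_le_rsqrt)
        then show "g r * \<phi> r \<le> sqrt (R t) * g r"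
          using g(1)[of r] r st by (subst mult.commute) (intro mult_right_mono, auto)
      qed
      also have "\<dots> = sqrt (R t) * I" by (simp add: I_def)
      finally have R1: "R t - R s \<le> 2 * (sqrt (R t) * I)" using R_diff[OF st] by simp
      have "R t - R s = (sqrt (R t) - sqrt (R s)) * (sqrt (R t) + sqrt (R s))"
        using R_pos[of s] R_pos[of t] st \<epsilon> by (simp add: algebra_simps)
      also have "\<dots> \<ge> (sqrt (R t) - sqrt (R s)) * (2 * sqrt (R s))"
        using pos by (intro mult_left_mono) auto
      finally have R2: "(sqrt (R t) - sqrt (R s)) * (2 * sqrt (R s)) \<le> R t - R s" .
      \<comment> \<open>the increment of \<open>sqrt R\<close> has to be compared with \<open>I\<close>\<close>
      define d where "d = sqrt (R t) - sqrt (R s)"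
      have d0: "0 \<le> d" using pos by (simp add: d_def)
      have "d * sqrt (R s) \<le> (d + sqrt (R s)) * I"
        using R1 R2 by (simp add: d_def)
      then have "(d - I) * sqrt (R s) \<le> d * I" by (simp add: algebra_simps)
      moreover have "d * sqrt \<epsilon> \<le> (K * B) * (t - s)"
      proof -
        have "d * sqrt \<epsilon> \<le> d * sqrt (R s)" using pos d0 \<epsilon> by (intro mult_left_mono) auto
        also have "\<dots> \<le> (K * B) * (t - s)" using R2 R_incr(2)[OF st] by (simp add: d_def)
        finally show ?thesis .
      qed
      ultimately have "(d - I) * sqrt (R s) * sqrt \<epsilon> \<le> (K * B) * (t - s) * (K * (t - s))"
      proof -
        have "(d - I) * sqrt (R s) * sqrt \<epsilon> \<le> d * I * sqrt \<epsilon>"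
          using \<open>(d - I) * sqrt (R s) \<le> d * I\<close> \<epsilon> by (intro mult_right_mono) auto
        also have "\<dots> = (d * sqrt \<epsilon>) * I" by simp
        also have "\<dots> \<le> ((K * B) * (t - s)) * (K * (t - s))"
          using \<open>d * sqrt \<epsilon> \<le> (K * B) * (t - s)\<close> I K B st by (intro mult_mono[of "d * sqrt \<epsilon>"]) auto
        finally show ?thesis .
      qed
      have "d - I \<le> (K * K * B / \<epsilon>) * (t - s)\<^sup>2"
      proof (cases "d \<le> I")
        case True
        then show ?thesis
          using K B \<epsilon> by (intro order_trans[OF _ mult_nonneg_nonneg]) auto
      next
        case False
        then have "(d - I) * (sqrt \<epsilon> * sqrt \<epsilon>) \<le> (d - I) * (sqrt (R s) * sqrt \<epsilon>)"
          using pos \<epsilon> by (intro mult_left_mono mult_right_mono) auto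
        then have "(d - I) * \<epsilon> \<le> (K * B) * (t - s) * (K * (t - s))"
          using \<open>(d - I) * sqrt (R s) * sqrt \<epsilon> \<le> (K * B) * (t - s) * (K * (t - s))\<close> \<epsilon>
          by (simp add: mult.assoc)
        then show ?thesis using \<epsilon> by (simp add: field_simps power2_eq_square)
      qed
      moreover have "\<Phi> t - \<Phi> s = d - I"
        using st by (simp add: \<Phi>_def d_def I_def set_integral_Icc_split[OF _ int_g, of 0 t s])
      ultimately show "\<Phi> t - \<Phi> s \<le> (K * K * B / \<epsilon>) * (t - s)\<^sup>2" by simp
    qed
    moreover have "\<Phi> 0 \<le> sqrt (c\<^sup>2 + \<epsilon>)"
    proof -
      have "norm (LINT r:{0..0}|lborel. g r) \<le> K * (0 - 0)"
        by (rule norm_set_integral_Icc_le) (use g T in auto)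
      then show ?thesis by (simp add: \<Phi>_def R0)
    qed
    moreover have "\<phi> T \<le> sqrt (R T)"
      using le[of T] T \<epsilon> by (intro real_le_rsqrt) (simp add: R_def)
    ultimately show ?thesis by (simp add: \<Phi>_def)
  qed
  have "((\<lambda>\<epsilon>. sqrt (c\<^sup>2 + \<epsilon>) + (LINT s:{0..T}|lborel. g s)) \<longlongrightarrow> sqrt (c\<^sup>2 + 0) + (LINT s:{0..T}|lborel. g s)) (at_right 0)"
    by (intro tendsto_intros)
  then have "\<phi> T \<le> sqrt (c\<^sup>2 + 0) + (LINT s:{0..T}|lborel. g s)"
    by (rule tendsto_lowerbound) (auto intro!: eventually_at_rightI[of 0 1] main)
  then show ?thesis using c by simp
qed

text \<open>A contraction semigroup whose time parameter runs over the whole line, so that continuity and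
  measurability can be stated without restriction; the semigroup law is only required for
  nonnegative times. Freezing a semigroup at negative times gives an example.\<close>

locale contraction_flow =
  fixes P :: "real \<Rightarrow> 'h::{real_inner, banach, second_countable_topology} \<Rightarrow>\<^sub>L 'h"
  assumes flow_0: "P 0 y = y"
    and flow_add: "0 \<le> s \<Longrightarrow> 0 \<le> t \<Longrightarrow> P (s + t) y = P s (P t y)"
    and flow_contraction: "norm (P t y) \<le> norm y"
    and flow_continuous: "continuous_on UNIV (\<lambda>p. P (fst p) (snd p))"
begin

lemma flow_tendsto:
  "(f \<longlongrightarrow> a) F \<Longrightarrow> (g \<longlongrightarrow> b) F \<Longrightarrow> ((\<lambda>n. P (f n) (g n)) \<longlongrightarrow> P a b) F"
  using continuous_on_tendsto_compose[OF flow_continuous tendsto_Pair[of f a F g b]] by simp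

lemma flow_continuous_on:
  "continuous_on A f \<Longrightarrow> continuous_on A g \<Longrightarrow> continuous_on A (\<lambda>n. P (f n) (g n))"
  using continuous_on_compose2[OF flow_continuous continuous_on_Pair[of A f g]] by simp

lemma flow_measurable [measurable (raw)]:
  "f \<in> borel_measurable M \<Longrightarrow> g \<in> borel_measurable M \<Longrightarrow> (\<lambda>w. P (f w) (g w)) \<in> borel_measurable M"
  using borel_measurable_compose_pair[of "\<lambda>t. P t", OF borel_measurable_continuous_onI[OF flow_continuous]] .

definition duhamel :: "(real \<Rightarrow> 'h) \<Rightarrow> real \<Rightarrow> 'h" where
  "duhamel f t = (LINT s:{0..t}|lborel. P (t - s) (f s))"

context
  fixes f :: "real \<Rightarrow> 'h" and T K :: real
  assumes f_meas [measurable]: "f \<in> borel_measurable borel"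
    and f_bound: "\<And>s. s \<in> {0..T} \<Longrightarrow> norm (f s) \<le> K"
begin

lemma flow_integrand_bound: "s \<in> {0..T} \<Longrightarrow> norm (P r (f s)) \<le> K"
  using flow_contraction f_bound order_trans by blast

lemma flow_integrable: "0 \<le> a \<Longrightarrow> b \<le> T \<Longrightarrow> set_integrable lborel {a..b} (\<lambda>s. P (t - s) (f s))"
  by (intro set_integrable_bounded_Icc[where K = K] flow_integrand_bound) auto

lemma duhamel_step:
  assumes "0 \<le> t" "t \<le> u" "u \<le> T"
  shows "duhamel f u = P (u - t) (duhamel f t) + (LINT s:{t..u}|lborel. P (u - s) (f s))"
proof -
  have "duhamel f u = (LINT s:{0..t}|lborel. P (u - s) (f s)) + (LINT s:{t..u}|lborel. P (u - s) (f s))"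
    unfolding duhamel_def by (rule set_integral_Icc_split) (use assms in \<open>auto intro: flow_integrable\<close>)
  also have "(LINT s:{0..t}|lborel. P (u - s) (f s)) = P (u - t) (duhamel f t)"
  proof -
    have "(LINT s:{0..t}|lborel. P (u - s) (f s)) = (LINT s:{0..t}|lborel. P (u - t) (P (t - s) (f s)))"
    proof (rule set_lebesgue_integral_cong)
      show "\<forall>s. s \<in> {0..t} \<longrightarrow> P (u - s) (f s) = P (u - t) (P (t - s) (f s))"
      proof (intro allI impI)
        fix s assume "s \<in> {0..t}"
        then have "P (u - t + (t - s)) (f s) = P (u - t) (P (t - s) (f s))"
          using assms by (intro flow_add) auto
        moreover have "u - t + (t - s) = u - s" by simp
        ultimately show "P (u - s) (f s) = P (u - t) (P (t - s) (f s))" by metis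
      qed
    qed simp
    also have "\<dots> = (LINT s|lborel. P (u - t) (indicator {0..t} s *\<^sub>R P (t - s) (f s)))"
      by (simp add: set_lebesgue_integral_def blinfun.scaleR_right)
    also have "\<dots> = P (u - t) (duhamel f t)"
      unfolding duhamel_def set_lebesgue_integral_def
      by (rule integral_bounded_linear[OF blinfun.bounded_linear_right])
        (use flow_integrable[where a = 0 and b = t and t = t] assms in \<open>auto simp: set_integrable_def\<close>)
    finally show ?thesis .
  qed
  finally show ?thesis .
qed

end

text \<open>Formally, the derivative of \<open>norm (z t) ^ 2\<close> is \<open>2 (inner (A z) z + inner f z)\<close> with
  \<open>inner (A z) z \<le> 0\<close>. A mild solution need not be differentiable, so time is divided into steps of
  length \<open>h\<close>. Restarting the equation at \<open>t\<close> and using the contraction property,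
  \<open>norm (z (t + h)) ^ 2\<close> exceeds \<open>norm (z t) ^ 2\<close> by at most \<open>(K h) ^ 2\<close> plus twice the integral over
  the step of \<open>inner (P h (z t)) (P (t + h - s) (f s))\<close>. The square terms sum to \<open>O(h)\<close>, and as
  \<open>h \<rightarrow> 0\<close> the integrands converge to \<open>inner (z s) (f s)\<close> boundedly.\<close>

lemma energy_inequality:
  fixes f z :: "real \<Rightarrow> 'h"
  assumes f_meas [measurable]: "f \<in> borel_measurable borel"
    and f_bound: "\<And>s. s \<in> {0..T} \<Longrightarrow> norm (f s) \<le> K"
    and z_cont: "continuous_on UNIV z"
    and z_eq: "\<And>t. t \<in> {0..T} \<Longrightarrow> z t = P t x + duhamel f t"
    and T: "0 \<le> T"
  shows "(norm (z T))\<^sup>2 \<le> (norm x)\<^sup>2 + 2 * (LINT s:{0..T}|lborel. inner (f s) (z s))"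
proof (cases "T = 0")
  case True
  have "duhamel f 0 = 0"
    using norm_set_integral_Icc_le[of "\<lambda>s. P (0 - s) (f s)" 0 0 K] flow_integrand_bound[OF f_meas f_bound] T
    unfolding duhamel_def by auto
  moreover have "(LINT s:{0..0}|lborel. inner (f s) (z s)) = 0"
  proof -
    have [measurable]: "z \<in> borel_measurable borel" by (rule borel_measurable_continuous_onI[OF z_cont])
    have "(LINT s:{0..0}|lborel. inner (f s) (z s)) = (LINT s:{0<..0}|lborel. inner (f s) (z s))"
      by (rule set_integral_Ioc_eq_Icc[symmetric]) measurable
    also have "\<dots> = 0" by (simp add: set_lebesgue_integral_def)
    finally show ?thesis .
  qed
  ultimately show ?thesis using True z_eq[of 0] by (simp add: flow_0)
next
  case False
  then have T0: "T > 0" using T by simp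
  have K0: "0 \<le> K" using order_trans[OF norm_ge_zero f_bound[of 0]] T by simp
  have z_meas [measurable]: "z \<in> borel_measurable borel" by (rule borel_measurable_continuous_onI[OF z_cont])
  obtain B where B: "\<And>s. s \<in> {0..T} \<Longrightarrow> norm (z s) \<le> B"
    using continuous_bounded_Icc[OF z_cont] by blast
  have z_step: "z u = P (u - t) (z t) + (LINT s:{t<..u}|lborel. P (u - s) (f s))" if "0 \<le> t" "t \<le> u" "u \<le> T" for t u
  proof -
    have "z u = P (u - t + t) x + duhamel f u" using z_eq[of u] that by (simp only: diff_add_cancel atLeastAtMost_iff) simp
    also have "P (u - t + t) x = P (u - t) (P t x)" using that by (intro flow_add) auto
    also have "duhamel f u = P (u - t) (duhamel f t) + (LINT s:{t..u}|lborel. P (u - s) (f s))"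
      by (rule duhamel_step[OF f_meas f_bound]) (use that in auto)
    also have "P (u - t) (P t x) + (P (u - t) (duhamel f t) + (LINT s:{t..u}|lborel. P (u - s) (f s)))
       = P (u - t) (z t) + (LINT s:{t<..u}|lborel. P (u - s) (f s))"
      using z_eq[of t] that by (simp add: blinfun.add_right set_integral_Ioc_eq_Icc)
    finally show ?thesis .
  qed
  define h where "h n = T / real (Suc n)" for n
  have h: "0 < h n" "real (Suc n) * h n = T" for n using T0 by (auto simp: h_def)
  \<comment> \<open>\<open>\<tau> n s\<close> is the right end point of the grid cell of mesh \<open>h n\<close> that contains \<open>s\<close>\<close>
  define \<tau> where "\<tau> n s = h n * of_int \<lceil>s / h n\<rceil>" for n s
  have \<tau>: "s \<le> \<tau> n s" "\<tau> n s < s + h n" for n s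
  proof -
    have "s / h n \<le> of_int \<lceil>s / h n\<rceil>" "of_int \<lceil>s / h n\<rceil> < s / h n + 1" by linarith+
    then have "s \<le> of_int \<lceil>s / h n\<rceil> * h n" "of_int \<lceil>s / h n\<rceil> * h n < (s / h n + 1) * h n"
      using h(1)[of n] by (simp_all only: pos_divide_le_eq mult_strict_right_mono)
    moreover have "(s / h n + 1) * h n = s + h n" using h(1)[of n] by (simp add: field_simps)
    ultimately show "s \<le> \<tau> n s" "\<tau> n s < s + h n"
      by (simp_all only: \<tau>_def mult.commute)
  qed
  have \<tau>_meas [measurable]: "\<tau> n \<in> borel_measurable borel" for n unfolding \<tau>_def by measurable
  \<comment> \<open>on a grid cell \<open>g n\<close> is the integrand of the cross term in the expansion of the squared norm\<close>
  define g where "g n s = inner (P (h n) (z (\<tau> n s - h n))) (P (\<tau> n s - s) (f s))" for n s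
  have g_meas [measurable]: "g n \<in> borel_measurable borel" for n unfolding g_def by measurable
  have \<tau>_grid: "\<tau> n s = real (Suc k) * h n" if "s \<in> {real k * h n<..real (Suc k) * h n}" for n k s
  proof -
    have "\<lceil>s / h n\<rceil> = int (Suc k)"
      by (rule ceiling_unique) (use that h(1)[of n] in \<open>auto simp: field_simps\<close>)
    then show ?thesis by (simp add: \<tau>_def)
  qed
  have \<tau>_range: "\<tau> n s - h n \<in> {0..T}" if "s \<in> {0<..T}" for n s
  proof -
    have "0 < \<lceil>s / h n\<rceil>" using that h(1)[of n] by simp
    then have "1 \<le> real_of_int \<lceil>s / h n\<rceil>" by linarith
    then have "h n * 1 \<le> \<tau> n s" unfolding \<tau>_def using h(1)[of n] by (intro mult_left_mono) auto
    then show ?thesis using \<tau>(2)[of n s] that by auto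
  qed
  have g_bound: "norm (g n s) \<le> B * K" if "s \<in> {0<..T}" for n s
  proof -
    have "norm (g n s) \<le> norm (P (h n) (z (\<tau> n s - h n))) * norm (P (\<tau> n s - s) (f s))"
      unfolding g_def real_norm_def by (rule Cauchy_Schwarz_ineq2)
    also have "\<dots> \<le> B * K"
    proof (rule mult_mono)
      show "norm (P (h n) (z (\<tau> n s - h n))) \<le> B"
        using order_trans[OF flow_contraction B[OF \<tau>_range[OF that]]] .
      show "norm (P (\<tau> n s - s) (f s)) \<le> K"
        using order_trans[OF flow_contraction f_bound] that by simp
      show "0 \<le> B" using order_trans[OF norm_ge_zero B[of 0]] T by simp
    qed simp
    finally show ?thesis .
  qed
  have g_int: "set_integrable lborel {a<..b} (g n)" if "0 \<le> a" "b \<le> T" for a b n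
  proof -
    have "set_integrable lborel {a..b} (\<lambda>s. indicator {0<..T} s *\<^sub>R g n s)"
      using g_bound order_trans[OF norm_ge_zero B[of 0]] T K0
      by (intro set_integrable_bounded_Icc[where K = "B * K"]) (auto simp: indicator_def)
    then have "set_integrable lborel {a<..b} (\<lambda>s. indicator {0<..T} s *\<^sub>R g n s)"
      by (rule set_integrable_subset) auto
    then show ?thesis
      by (rule set_integrable_cong[THEN iffD1, rotated -1]) (use that in auto)
  qed
  have grid: "(norm (z (real k * h n)))\<^sup>2 \<le> (norm x)\<^sup>2 + 2 * (LINT s:{0<..real k * h n}|lborel. g n s) + real k * (K * h n)\<^sup>2"
    if "k \<le> Suc n" for n k
    using that
  proof (induction k)
    case 0
    have "duhamel f 0 = 0"
      using norm_set_integral_Icc_le[of "\<lambda>s. P (0 - s) (f s)" 0 0 K] flow_integrand_bound[OF f_meas f_bound] T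
      unfolding duhamel_def by auto
    then show ?case using z_eq[of 0] T by (simp add: flow_0 set_lebesgue_integral_def)
  next
    case (Suc k)
    define t u where "t = real k * h n" and "u = real (Suc k) * h n"
    have "u \<le> real (Suc n) * h n" unfolding u_def using Suc.prems h(1)[of n] by (intro mult_right_mono) auto
    then have tu: "0 \<le> t" "t < u" "u \<le> T" "u - t = h n"
      using h[of n] by (auto simp: t_def u_def algebra_simps)
    define J where "J = (LINT s:{t<..u}|lborel. P (u - s) (f s))"
    have J_int: "set_integrable lborel {t<..u} (\<lambda>s. P (u - s) (f s))"
      by (rule set_integrable_subset[OF flow_integrable[OF f_meas f_bound, where a = t and b = u]]) (use tu in auto)
    have J_norm: "norm J \<le> K * h n"
    proof -
      have "norm (LINT s:{t..u}|lborel. P (u - s) (f s)) \<le> K * (u - t)"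
        by (rule norm_set_integral_Icc_le) (use tu order_trans[OF flow_contraction f_bound] in auto)
      then show ?thesis using tu by (simp add: J_def set_integral_Ioc_eq_Icc)
    qed
    have "inner (P (h n) (z t)) J = (LINT s:{t<..u}|lborel. g n s)"
    proof -
      have "inner (P (h n) (z t)) J = (LINT s|lborel. inner (P (h n) (z t)) (indicator {t<..u} s *\<^sub>R P (u - s) (f s)))"
        unfolding J_def set_lebesgue_integral_def
        by (rule integral_bounded_linear[OF bounded_linear_inner_right, symmetric])
          (use J_int in \<open>simp add: set_integrable_def\<close>)
      also have "\<dots> = (LINT s:{t<..u}|lborel. g n s)"
        unfolding set_lebesgue_integral_def
      proof (rule Bochner_Integration.integral_cong[OF refl])
        fix s
        show "inner (P (h n) (z t)) (indicator {t<..u} s *\<^sub>R P (u - s) (f s)) = indicator {t<..u} s *\<^sub>R g n s"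
        proof (cases "s \<in> {t<..u}")
          case True
          then have "\<tau> n s = u" using \<tau>_grid[of s k n] by (simp add: t_def u_def)
          moreover have "u - h n = t" using tu by simp
          ultimately show ?thesis using True by (simp add: g_def)
        qed simp
      qed
      finally show ?thesis .
    qed
    moreover have "z u = P (h n) (z t) + J" using z_step[of t u] tu by (simp add: J_def)
    ultimately have "(norm (z u))\<^sup>2 = (norm (P (h n) (z t)))\<^sup>2 + 2 * (LINT s:{t<..u}|lborel. g n s) + (norm J)\<^sup>2"
      unfolding power2_norm_eq_inner by (simp add: inner_add_left inner_add_right inner_commute)
    also have "\<dots> \<le> (norm (z t))\<^sup>2 + 2 * (LINT s:{t<..u}|lborel. g n s) + (K * h n)\<^sup>2"
      by (intro add_mono power_mono J_norm flow_contraction order_refl) auto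
    also have "\<dots> \<le> (norm x)\<^sup>2 + 2 * (LINT s:{0<..t}|lborel. g n s) + real k * (K * h n)\<^sup>2
        + 2 * (LINT s:{t<..u}|lborel. g n s) + (K * h n)\<^sup>2"
      using Suc by (simp add: t_def)
    also have "(LINT s:{0<..u}|lborel. g n s) = (LINT s:{0<..t}|lborel. g n s) + (LINT s:{t<..u}|lborel. g n s)"
    proof -
      have "{0<..u} = {0<..t} \<union> {t<..u}" using tu by auto
      then show ?thesis using set_integral_Un[OF _ g_int[of 0 t n] g_int[of t u n]] tu by auto
    qed
    then have "(norm x)\<^sup>2 + 2 * (LINT s:{0<..t}|lborel. g n s) + real k * (K * h n)\<^sup>2
        + 2 * (LINT s:{t<..u}|lborel. g n s) + (K * h n)\<^sup>2
        = (norm x)\<^sup>2 + 2 * (LINT s:{0<..u}|lborel. g n s) + real (Suc k) * (K * h n)\<^sup>2"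
      by (simp add: algebra_simps)
    finally show ?case by (simp add: u_def)
  qed
  have "(norm (z T))\<^sup>2 \<le> (norm x)\<^sup>2 + 2 * (LINT s:{0<..T}|lborel. g n s) + K\<^sup>2 * T * h n" for n
  proof -
    have "real (Suc n) * (K * h n)\<^sup>2 = K\<^sup>2 * (real (Suc n) * h n) * h n"
      by (simp only: power2_eq_square ac_simps)
    then have "real (Suc n) * (K * h n)\<^sup>2 = K\<^sup>2 * T * h n" by (simp only: h(2))
    then show ?thesis using grid[of "Suc n" n] by (simp only: h(2) order_refl)
  qed
  moreover have h0: "h \<longlonglongrightarrow> 0"
    using tendsto_mult_right_zero[OF LIMSEQ_inverse_real_of_nat, of T]
    by (simp add: h_def[abs_def] divide_inverse)
  have "(\<lambda>n. LINT s:{0<..T}|lborel. g n s) \<longlonglongrightarrow> (LINT s:{0<..T}|lborel. inner (z s) (f s))"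
    unfolding set_lebesgue_integral_def
  proof (rule integral_dominated_convergence)
    show "integrable lborel (\<lambda>s. indicator {0<..T} s * (B * K) :: real)"
      by (intro integrable_mult_left integrable_real_indicator) (use T in auto)
    show "AE s in lborel. (\<lambda>n. indicator {0<..T} s *\<^sub>R g n s) \<longlonglongrightarrow> indicator {0<..T} s *\<^sub>R inner (z s) (f s)"
    proof (intro AE_I2 tendsto_intros)
      fix s
      have "(\<lambda>n. \<tau> n s) \<longlonglongrightarrow> s"
      proof (rule tendsto_sandwich[of "\<lambda>_. s" _ _ "\<lambda>n. s + h n"])
        show "(\<lambda>n. s + h n) \<longlonglongrightarrow> s" using tendsto_add[OF tendsto_const h0, of s] by simp
      qed (use \<tau> in \<open>auto intro!: always_eventually less_imp_le\<close>)
      then have 1: "(\<lambda>n. \<tau> n s - h n) \<longlonglongrightarrow> s - 0" "(\<lambda>n. \<tau> n s - s) \<longlonglongrightarrow> s - s"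
        by (intro tendsto_intros h0; simp)+
      have "isCont z s" using z_cont by (simp add: continuous_on_eq_continuous_at)
      then have 2: "(\<lambda>n. z (\<tau> n s - h n)) \<longlonglongrightarrow> z s" using 1(1) by (intro isCont_tendsto_compose[of s z]) auto
      have "(\<lambda>n. g n s) \<longlonglongrightarrow> inner (P 0 (z s)) (P (s - s) (f s))"
        unfolding g_def by (intro tendsto_inner flow_tendsto h0 2 1(2) tendsto_const)
      then show "(\<lambda>n. g n s) \<longlonglongrightarrow> inner (z s) (f s)" by (simp add: flow_0)
    qed
    show "\<And>n. AE s in lborel. norm (indicator {0<..T} s *\<^sub>R g n s) \<le> indicator {0<..T} s * (B * K)"
      using g_bound by (auto simp: indicator_def)
  qed simp_all
  then have "(\<lambda>n. (norm x)\<^sup>2 + 2 * (LINT s:{0<..T}|lborel. g n s) + K\<^sup>2 * T * h n)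
      \<longlonglongrightarrow> (norm x)\<^sup>2 + 2 * (LINT s:{0<..T}|lborel. inner (z s) (f s)) + K\<^sup>2 * T * 0"
    by (intro tendsto_intros h0)
  ultimately have "(norm (z T))\<^sup>2 \<le> (norm x)\<^sup>2 + 2 * (LINT s:{0<..T}|lborel. inner (z s) (f s)) + K\<^sup>2 * T * 0"
    by (intro LIMSEQ_le_const) auto
  then show ?thesis by (simp add: set_integral_Ioc_eq_Icc inner_commute)
qed

end

section \<open>Picard iteration for equations with Lipschitz nonlinearity\<close>

lemma set_integral_exp:
  fixes c t :: real
  assumes "c \<noteq> 0" "0 \<le> t"
  shows "(LINT s:{0..t}|lborel. exp (c * s)) = (exp (c * t) - 1) / c"
proof -
  have "(\<integral>s. exp (c * s) * indicator {0..t} s \<partial>lborel) = exp (c * t) / c - exp (c * 0) / c"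
    by (rule integral_FTC_Icc_real) (use assms in \<open>auto intro!: derivative_eq_intros continuous_intros\<close>)
  then show ?thesis
    by (simp add: set_lebesgue_integral_def mult.commute diff_divide_distrib)
qed

text \<open>Rounding the time down to the grid of mesh \<open>1 / (n + 1)\<close> leaves countably many times, and the
  rounded processes converge because the paths are continuous.\<close>

lemma measurable_of_continuous_paths:
  fixes Y :: "real \<Rightarrow> 'w \<Rightarrow> 'b::metric_space"
  assumes meas: "\<And>s. Y s \<in> borel_measurable N"
    and cont: "\<And>\<omega>. \<omega> \<in> space N \<Longrightarrow> continuous_on UNIV (\<lambda>s. Y s \<omega>)"
  shows "(\<lambda>p. Y (fst p) (snd p)) \<in> borel_measurable (borel \<Otimes>\<^sub>M N)"
proof (rule borel_measurable_LIMSEQ_metric)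
  define \<rho> where "\<rho> n s = of_int \<lfloor>real (Suc n) * s\<rfloor> / real (Suc n)" for n and s :: real
  show "(\<lambda>p. Y (\<rho> n (fst p)) (snd p)) \<in> borel_measurable (borel \<Otimes>\<^sub>M N)" for n
  proof -
    have [measurable]: "(\<lambda>p. Y (of_int i / real (Suc n)) (snd p)) \<in> borel_measurable (borel \<Otimes>\<^sub>M N)" for i :: int
      by (rule measurable_compose[OF measurable_snd meas])
    have "(\<lambda>p. (\<lambda>i p. Y (of_int i / real (Suc n)) (snd p)) \<lfloor>real (Suc n) * fst p\<rfloor> p) \<in> borel_measurable (borel \<Otimes>\<^sub>M N)"
      by (rule measurable_compose_countable) measurable
    then show ?thesis by (simp add: \<rho>_def)
  qed
  fix p :: "real \<times> 'w" assume "p \<in> space (borel \<Otimes>\<^sub>M N)"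
  then have "snd p \<in> space N" by (auto simp: space_pair_measure)
  then have "isCont (\<lambda>s. Y s (snd p)) (fst p)" using cont by (simp add: continuous_on_eq_continuous_at)
  moreover have "(\<lambda>n. \<rho> n (fst p)) \<longlonglongrightarrow> fst p"
  proof (rule LIMSEQ_I)
    fix r :: real assume "r > 0"
    then obtain m :: nat where m: "1 / r < real m" using reals_Archimedean2 by blast
    have "norm (\<rho> n (fst p) - fst p) < r" if "n \<ge> m" for n
    proof -
      have "\<bar>of_int \<lfloor>real (Suc n) * fst p\<rfloor> - real (Suc n) * fst p\<bar> \<le> 1" by linarith
      then have "\<bar>(of_int \<lfloor>real (Suc n) * fst p\<rfloor> - real (Suc n) * fst p) / real (Suc n)\<bar> \<le> 1 / real (Suc n)"
        by (simp add: divide_right_mono)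
      moreover have "(of_int \<lfloor>real (Suc n) * fst p\<rfloor> - real (Suc n) * fst p) / real (Suc n) = \<rho> n (fst p) - fst p"
        by (simp add: \<rho>_def diff_divide_distrib del: of_nat_Suc)
      moreover have "1 / real (Suc n) < r"
      proof -
        have "1 / r < real (Suc n)" using m that by linarith
        then show ?thesis using \<open>r > 0\<close> by (simp add: field_simps)
      qed
      ultimately show ?thesis unfolding real_norm_def by (metis order_le_less_trans)
    qed
    then show "\<exists>no. \<forall>n\<ge>no. norm (\<rho> n (fst p) - fst p) < r" by blast
  qed
  ultimately show "(\<lambda>n. Y (\<rho> n (fst p)) (snd p)) \<longlonglongrightarrow> Y (fst p) (snd p)"
    by (rule isCont_tendsto_compose)
qed

context contraction_flow
begin

text \<open>Dominated convergence: the indicators of \<open>[0, u n]\<close> converge to that of \<open>[0, t]\<close> except at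
  \<open>s = t\<close>.\<close>

lemma duhamel_continuous:
  assumes [measurable]: "f \<in> borel_measurable borel"
    and bound: "\<And>T. \<exists>K. \<forall>s\<in>{0..T}. norm (f s) \<le> K"
  shows "continuous_on UNIV (duhamel f)"
proof (rule continuous_at_imp_continuous_on, rule ballI)
  fix t :: real
  show "isCont (duhamel f) t"
    unfolding continuous_at_sequentially
  proof (intro allI impI)
    fix u :: "nat \<Rightarrow> real" assume u: "u \<longlonglongrightarrow> t"
    then obtain T where T: "\<And>n. \<bar>u n\<bar> \<le> T"
      using convergent_imp_Bseq[OF convergentI[OF u]] unfolding Bseq_def by auto
    obtain K where K: "\<And>s. s \<in> {0..T} \<Longrightarrow> norm (f s) \<le> K" using bound by blast
    have "(\<lambda>n. LINT s|lborel. indicator {0..u n} s *\<^sub>R P (u n - s) (f s))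
        \<longlonglongrightarrow> (LINT s|lborel. indicator {0..t} s *\<^sub>R P (t - s) (f s))"
    proof (rule integral_dominated_convergence)
      show "integrable lborel (\<lambda>s. indicator {0..T} s * K :: real)"
        by (intro integrable_mult_left integrable_real_indicator) (auto simp: emeasure_lborel_Icc_eq)
      show "AE s in lborel. (\<lambda>n. indicator {0..u n} s *\<^sub>R P (u n - s) (f s)) \<longlonglongrightarrow> indicator {0..t} s *\<^sub>R P (t - s) (f s)"
        using AE_lborel_singleton[of t]
      proof eventually_elim
        fix s assume s: "s \<noteq> t"
        have "(\<lambda>n. indicator {0..u n} s :: real) \<longlonglongrightarrow> indicator {0..t} s"
        proof (rule tendsto_eventually)
          show "eventually (\<lambda>n. (indicator {0..u n} s :: real) = indicator {0..t} s) sequentially"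
          proof (cases "s < t")
            case True
            then have "eventually (\<lambda>n. s < u n) sequentially" by (rule order_tendstoD[OF u])
            then show ?thesis by eventually_elim (use True in \<open>auto simp: indicator_def\<close>)
          next
            case False
            then have "eventually (\<lambda>n. u n < s) sequentially" using s by (intro order_tendstoD[OF u]) simp
            then show ?thesis by eventually_elim (use False s in \<open>auto simp: indicator_def\<close>)
          qed
        qed
        then show "(\<lambda>n. indicator {0..u n} s *\<^sub>R P (u n - s) (f s)) \<longlonglongrightarrow> indicator {0..t} s *\<^sub>R P (t - s) (f s)"
          by (intro tendsto_scaleR flow_tendsto tendsto_diff u tendsto_const)
      qed
      show "AE s in lborel. norm (indicator {0..u n} s *\<^sub>R P (u n - s) (f s)) \<le> indicator {0..T} s * K" for n
      proof (rule AE_I2)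
        fix s
        show "norm (indicator {0..u n} s *\<^sub>R P (u n - s) (f s)) \<le> indicator {0..T} s * K"
          using T[of n] order_trans[OF flow_contraction K, of s "u n - s"] order_trans[OF norm_ge_zero K, of s]
          by (auto simp: indicator_def)
      qed
    qed simp_all
    then show "(duhamel f \<circ> u) \<longlonglongrightarrow> duhamel f t"
      by (simp add: duhamel_def set_lebesgue_integral_def o_def)
  qed
qed

lemma norm_duhamel_diff_le:
  assumes [measurable]: "f \<in> borel_measurable borel" "g \<in> borel_measurable borel"
    and "\<And>s. s \<in> {0..t} \<Longrightarrow> norm (f s) \<le> K" "\<And>s. s \<in> {0..t} \<Longrightarrow> norm (g s) \<le> K"
    and le: "\<And>s. s \<in> {0..t} \<Longrightarrow> norm (f s - g s) \<le> m s"
    and m: "set_integrable lborel {0..t} m"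
  shows "norm (duhamel f t - duhamel g t) \<le> (LINT s:{0..t}|lborel. m s)"
proof -
  have int: "set_integrable lborel {0..t} (\<lambda>s. P (t - s) (f s))" "set_integrable lborel {0..t} (\<lambda>s. P (t - s) (g s))"
    by (intro set_integrable_bounded_Icc[where K = K] order_trans[OF flow_contraction assms(3)]
        order_trans[OF flow_contraction assms(4)]; simp)+
  have "duhamel f t - duhamel g t = (LINT s:{0..t}|lborel. P (t - s) (f s) - P (t - s) (g s))"
    unfolding duhamel_def by (rule set_integral_diff(2)[OF int, symmetric])
  then have "norm (duhamel f t - duhamel g t) \<le> (LINT s:{0..t}|lborel. norm (P (t - s) (f s) - P (t - s) (g s)))"
    using set_integral_norm_bound[OF set_integral_diff(1)[OF int]] by simp
  also have "\<dots> \<le> (LINT s:{0..t}|lborel. m s)"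
  proof (rule set_integral_mono)
    show "set_integrable lborel {0..t} (\<lambda>s. norm (P (t - s) (f s) - P (t - s) (g s)))"
      using set_integrable_norm[OF set_integral_diff(1)[OF int]] .
    show "norm (P (t - s) (f s) - P (t - s) (g s)) \<le> m s" if "s \<in> {0..t}" for s
      using order_trans[OF flow_contraction le[OF that], of "t - s"] by (simp add: blinfun.diff_right)
  qed (rule m)
  finally show ?thesis .
qed

fun picard :: "(real \<Rightarrow> 'h \<Rightarrow> 'h) \<Rightarrow> 'h \<Rightarrow> (real \<Rightarrow> 'h) \<Rightarrow> nat \<Rightarrow> real \<Rightarrow> 'h" where
  "picard G x v 0 t = x"
| "picard G x v (Suc n) t = P t x + duhamel (\<lambda>s. G s (picard G x v n s + v s)) t"

text \<open>Evaluating at \<open>max 0 t\<close> freezes the limit at negative times, which makes it continuous on the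
  whole line.\<close>

definition picard_limit :: "(real \<Rightarrow> 'h \<Rightarrow> 'h) \<Rightarrow> 'h \<Rightarrow> (real \<Rightarrow> 'h) \<Rightarrow> real \<Rightarrow> 'h" where
  "picard_limit G x v t = lim (\<lambda>n. picard G x v n (max 0 t))"

context
  fixes G :: "real \<Rightarrow> 'h \<Rightarrow> 'h" and L C :: real and x :: 'h
  assumes G_meas: "(\<lambda>p. G (fst p) (snd p)) \<in> borel_measurable borel"
    and G_lipschitz: "\<And>s y y'. norm (G s y - G s y') \<le> L * norm (y - y')"
    and G_zero: "\<And>s. norm (G s 0) \<le> C"
    and L: "0 < L"
begin

lemmas G_compose = borel_measurable_compose_pair[OF G_meas]

lemma G_growth: "norm (G s y) \<le> C + L * norm y"
  using norm_triangle_ineq[of "G s y - G s 0" "G s 0"] G_lipschitz[of s y 0] G_zero[of s] by simp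

context
  fixes v :: "real \<Rightarrow> 'h"
  assumes v_cont: "continuous_on UNIV v"
begin

abbreviation "it \<equiv> picard G x v"

lemma v_meas: "v \<in> borel_measurable borel"
  by (rule borel_measurable_continuous_onI[OF v_cont])

lemma G_bounded_along:
  assumes "\<And>s. s \<in> {0..T} \<Longrightarrow> norm (w s) \<le> B"
  shows "\<exists>K. \<forall>s\<in>{0..T}. norm (G s (w s + v s)) \<le> K"
proof -
  obtain Bv where Bv: "\<And>s. s \<in> {0..T} \<Longrightarrow> norm (v s) \<le> Bv"
    using continuous_bounded_Icc[OF v_cont] by blast
  have "norm (G s (w s + v s)) \<le> C + L * (B + Bv)" if "s \<in> {0..T}" for s
  proof -
    have "norm (w s + v s) \<le> B + Bv" using norm_triangle_ineq[of "w s" "v s"] assms[OF that] Bv[OF that] by linarith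
    then have "L * norm (w s + v s) \<le> L * (B + Bv)" using L by simp
    then show ?thesis using G_growth[of s "w s + v s"] by linarith
  qed
  then show ?thesis by blast
qed

lemma picard_continuous: "continuous_on UNIV (it n)"
proof (induction n)
  case 0
  then show ?case by simp
next
  case (Suc n)
  note [measurable (raw)] = G_compose and [measurable] = v_meas
  from Suc have [measurable]: "it n \<in> borel_measurable borel" by (rule borel_measurable_continuous_onI)
  have "continuous_on UNIV (duhamel (\<lambda>s. G s (it n s + v s)))"
  proof (rule duhamel_continuous)
    fix T :: real
    obtain B where "\<forall>s\<in>{0..T}. norm (it n s) \<le> B" using continuous_bounded_Icc[OF Suc] by blast
    then show "\<exists>K. \<forall>s\<in>{0..T}. norm (G s (it n s + v s)) \<le> K" by (intro G_bounded_along) auto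
  qed measurable
  then have "continuous_on UNIV (\<lambda>t. P t x + duhamel (\<lambda>s. G s (it n s + v s)) t)"
    by (intro continuous_on_add flow_continuous_on continuous_on_id continuous_on_const) simp
  then show ?case by simp
qed

lemma picard_measurable: "it n \<in> borel_measurable borel"
  by (rule borel_measurable_continuous_onI[OF picard_continuous])

text \<open>In the norm weighted by \<open>exp (- 2 L t)\<close> the iteration contracts by the factor 1/2, because the
  integral of \<open>exp (2 L s)\<close> up to \<open>t\<close> is at most \<open>exp (2 L t) / (2 L)\<close>.\<close>

lemma picard_contracts:
  assumes B: "\<And>s. s \<in> {0..T} \<Longrightarrow> norm (it 1 s - it 0 s) \<le> B" and t: "t \<in> {0..T}"
  shows "norm (it (Suc n) t - it n t) \<le> B * (1/2) ^ n * exp (2 * L * t)"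
  using t
proof (induction n arbitrary: t)
  case 0
  have "B * 1 \<le> B * exp (2 * L * t)"
    using order_trans[OF norm_ge_zero B[OF 0]] 0 L by (intro mult_left_mono) auto
  then show ?case using B[OF 0] by simp
next
  case (Suc n)
  note [measurable (raw)] = G_compose and [measurable] = v_meas picard_measurable
  have B0: "0 \<le> B" using order_trans[OF norm_ge_zero B[OF Suc.prems]] .
  obtain K where K: "\<And>m s. m \<in> {n, Suc n} \<Longrightarrow> s \<in> {0..T} \<Longrightarrow> norm (G s (it m s + v s)) \<le> K"
  proof -
    have "\<exists>K. \<forall>s\<in>{0..T}. norm (G s (it m s + v s)) \<le> K" for m
      using continuous_bounded_Icc[OF picard_continuous] G_bounded_along by metis
    then obtain K1 K2 where "\<forall>s\<in>{0..T}. norm (G s (it n s + v s)) \<le> K1"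
      "\<forall>s\<in>{0..T}. norm (G s (it (Suc n) s + v s)) \<le> K2" by meson
    then show ?thesis by (intro that[of "max K1 K2"]) (auto simp: le_max_iff_disj simp del: picard.simps)
  qed
  let ?m = "\<lambda>s. (L * B * (1/2) ^ n) * exp (2 * L * s)"
  have "norm (it (Suc (Suc n)) t - it (Suc n) t) =
      norm (duhamel (\<lambda>s. G s (it (Suc n) s + v s)) t - duhamel (\<lambda>s. G s (it n s + v s)) t)"
    unfolding picard.simps(2)[of _ _ _ "Suc n"] picard.simps(2)[of _ _ _ n t] by simp
  also have "\<dots> \<le> (LINT s:{0..t}|lborel. ?m s)"
  proof (rule norm_duhamel_diff_le)
    fix s assume s: "s \<in> {0..t}"
    then have sT: "s \<in> {0..T}" using Suc.prems by auto
    show "norm (G s (it (Suc n) s + v s)) \<le> K" "norm (G s (it n s + v s)) \<le> K"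
      by (rule K[OF _ sT]; simp)+
    have "norm (G s (it (Suc n) s + v s) - G s (it n s + v s)) \<le> L * norm (it (Suc n) s - it n s)"
      using G_lipschitz[of s "it (Suc n) s + v s" "it n s + v s"] by simp
    also have "\<dots> \<le> L * (B * (1/2) ^ n * exp (2 * L * s))"
      using L Suc.IH[OF sT] by (intro mult_left_mono) auto
    finally show "norm (G s (it (Suc n) s + v s) - G s (it n s + v s)) \<le> ?m s" by (simp add: mult.assoc)
  next
    show "set_integrable lborel {0..t} ?m"
      unfolding set_integrable_def by (rule borel_integrable_compact) (auto intro!: continuous_intros)
  qed measurable
  also have "\<dots> = (L * B * (1/2) ^ n) * ((exp (2 * L * t) - 1) / (2 * L))"
    using set_integral_exp[of "2 * L" t] L Suc.prems by simp
  also have "\<dots> \<le> (L * B * (1/2) ^ n) * (exp (2 * L * t) / (2 * L))"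
    using L B0 by (intro mult_left_mono divide_right_mono) auto
  also have "\<dots> = B * (1/2) ^ Suc n * exp (2 * L * t)" using L by (simp add: field_simps)
  finally show ?case .
qed

lemma picard_converges:
  assumes "0 \<le> T"
  shows "\<exists>B. (\<forall>n. \<forall>t\<in>{0..T}. norm (it n t) \<le> B) \<and> (\<forall>t\<in>{0..T}. convergent (\<lambda>n. it n t))"
proof -
  have "continuous_on UNIV (\<lambda>s. it 1 s - it 0 s)" by (intro continuous_on_diff picard_continuous)
  then obtain B where B: "\<And>s. s \<in> {0..T} \<Longrightarrow> norm (it 1 s - it 0 s) \<le> B"
    using continuous_bounded_Icc[of "\<lambda>s. it 1 s - it 0 s" T] by blast
  have B0: "0 \<le> B" using order_trans[OF norm_ge_zero B[of 0]] assms by simp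
  define K where "K = B * exp (2 * L * T)"
  have step: "norm (it (Suc n) t - it n t) \<le> K * (1/2) ^ n" if "t \<in> {0..T}" for n t
  proof -
    have "B * (1/2) ^ n * exp (2 * L * t) \<le> B * (1/2) ^ n * exp (2 * L * T)"
      using B0 L that by (intro mult_left_mono) auto
    then show ?thesis using picard_contracts[OF B that, of n] by (simp add: K_def ac_simps)
  qed
  have summ: "summable (\<lambda>n. K * (1/2) ^ n)" by (intro summable_mult summable_geometric) simp
  have tele: "it n t = x + (\<Sum>i<n. it (Suc i) t - it i t)" for n t
    using sum_lessThan_telescope[of "\<lambda>i. it i t" n] by (simp del: picard.simps(2))
  have bound: "norm (it n t) \<le> norm x + (\<Sum>i. K * (1/2) ^ i)" if t: "t \<in> {0..T}" for n t
  proof -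
    have "norm (\<Sum>i<n. it (Suc i) t - it i t) \<le> (\<Sum>i<n. K * (1/2) ^ i)"
      by (rule sum_norm_le) (rule step[OF t])
    also have "\<dots> \<le> (\<Sum>i. K * (1/2) ^ i)"
      by (rule sum_le_suminf[OF summ]) (use B0 in \<open>auto simp: K_def\<close>)
    finally show ?thesis
      using norm_triangle_ineq[of x "\<Sum>i<n. it (Suc i) t - it i t"] tele[of n t] by simp
  qed
  have conv: "convergent (\<lambda>n. it n t)" if t: "t \<in> {0..T}" for t
  proof -
    have "summable (\<lambda>i. it (Suc i) t - it i t)"
      by (rule summable_comparison_test[OF _ summ]) (use step[OF t] in blast)
    then have "(\<lambda>n. x + (\<Sum>i<n. it (Suc i) t - it i t)) \<longlonglongrightarrow> x + (\<Sum>i. it (Suc i) t - it i t)"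
      by (intro tendsto_intros summable_LIMSEQ)
    then show ?thesis unfolding tele[symmetric] by (rule convergentI)
  qed
  show ?thesis using bound conv by blast
qed

abbreviation "solution \<equiv> picard_limit G x v"

lemma picard_tendsto_solution: "0 \<le> t \<Longrightarrow> (\<lambda>n. it n t) \<longlonglongrightarrow> solution t"
  using picard_converges[of t] by (auto simp: picard_limit_def convergent_LIMSEQ_iff)

lemma solution_measurable: "solution \<in> borel_measurable borel"
proof (rule borel_measurable_LIMSEQ_metric)
  note [measurable] = picard_measurable
  show "(\<lambda>t. it n (max 0 t)) \<in> borel_measurable borel" for n by measurable
  show "(\<lambda>n. it n (max 0 t)) \<longlonglongrightarrow> solution t" for t
    using picard_tendsto_solution[of "max 0 t"] by (simp add: picard_limit_def)
qed

lemma solution_bounded: "\<exists>B. \<forall>s\<in>{0..T}. norm (solution s) \<le> B"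
proof (cases "0 \<le> T")
  case True
  then obtain B where "\<forall>n. \<forall>t\<in>{0..T}. norm (it n t) \<le> B" using picard_converges by blast
  then have "norm (solution s) \<le> B" if "s \<in> {0..T}" for s
    using that by (intro LIMSEQ_le_const2[OF tendsto_norm[OF picard_tendsto_solution]]) auto
  then show ?thesis by blast
qed auto

text \<open>Pointwise convergence of the iterates and their common bound on \<open>[0, t]\<close> suffice to pass to
  the limit in the integral. Continuity of the limit then follows from the equation itself.\<close>

lemma solution_eq:
  assumes t: "0 \<le> t"
  shows "solution t = P t x + duhamel (\<lambda>s. G s (solution s + v s)) t"
proof (rule LIMSEQ_unique)
  note [measurable (raw)] = G_compose and [measurable] = v_meas picard_measurable solution_measurable
  show "(\<lambda>n. it (Suc n) t) \<longlonglongrightarrow> solution t" by (rule LIMSEQ_Suc[OF picard_tendsto_solution[OF t]])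
  obtain B where B: "\<And>n s. s \<in> {0..t} \<Longrightarrow> norm (it n s) \<le> B" using picard_converges[OF t] by blast
  obtain Bv where Bv: "\<And>s. s \<in> {0..t} \<Longrightarrow> norm (v s) \<le> Bv"
    using continuous_bounded_Icc[OF v_cont] by blast
  define K where "K = C + L * (B + Bv)"
  have K: "norm (G s (it n s + v s)) \<le> K" if "s \<in> {0..t}" for s n
  proof -
    have "norm (it n s + v s) \<le> B + Bv" using norm_triangle_ineq[of "it n s" "v s"] B[OF that, of n] Bv[OF that] by linarith
    then have "L * norm (it n s + v s) \<le> L * (B + Bv)" using L by simp
    then show ?thesis using G_growth[of s "it n s + v s"] by (simp add: K_def)
  qed
  have "(\<lambda>n. LINT s|lborel. indicator {0..t} s *\<^sub>R P (t - s) (G s (it n s + v s)))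
      \<longlonglongrightarrow> (LINT s|lborel. indicator {0..t} s *\<^sub>R P (t - s) (G s (solution s + v s)))"
  proof (rule integral_dominated_convergence)
    show "integrable lborel (\<lambda>s. indicator {0..t} s * K :: real)"
      by (intro integrable_mult_left integrable_real_indicator) (auto simp: emeasure_lborel_Icc_eq)
    show "AE s in lborel. (\<lambda>n. indicator {0..t} s *\<^sub>R P (t - s) (G s (it n s + v s)))
        \<longlonglongrightarrow> indicator {0..t} s *\<^sub>R P (t - s) (G s (solution s + v s))"
    proof (rule AE_I2)
      fix s
      show "(\<lambda>n. indicator {0..t} s *\<^sub>R P (t - s) (G s (it n s + v s)))
        \<longlonglongrightarrow> indicator {0..t} s *\<^sub>R P (t - s) (G s (solution s + v s))"
      proof (cases "s \<in> {0..t}")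
        case True
        then have s: "(\<lambda>n. it n s) \<longlonglongrightarrow> solution s" by (intro picard_tendsto_solution) simp
        have "(\<lambda>n. G s (it n s + v s) - G s (solution s + v s)) \<longlonglongrightarrow> 0"
        proof (rule Lim_null_comparison[OF always_eventually])
          show "\<forall>n. norm (G s (it n s + v s) - G s (solution s + v s)) \<le> L * norm (it n s - solution s)"
            using G_lipschitz[of s "it n s + v s" "solution s + v s" for n] by simp
          have "(\<lambda>n. L * norm (it n s - solution s)) \<longlonglongrightarrow> L * norm (solution s - solution s)"
            by (intro tendsto_intros s)
          then show "(\<lambda>n. L * norm (it n s - solution s)) \<longlonglongrightarrow> 0" by simp
        qed
        then have "(\<lambda>n. G s (it n s + v s)) \<longlonglongrightarrow> G s (solution s + v s)" by (simp add: LIM_zero_iff)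
        then show ?thesis by (intro tendsto_intros)
      qed simp
    qed
    show "AE s in lborel. norm (indicator {0..t} s *\<^sub>R P (t - s) (G s (it n s + v s))) \<le> indicator {0..t} s * K" for n
      using order_trans[OF flow_contraction K] by (auto simp: indicator_def)
  qed simp_all
  then have "(\<lambda>n. P t x + duhamel (\<lambda>s. G s (it n s + v s)) t) \<longlonglongrightarrow> P t x + duhamel (\<lambda>s. G s (solution s + v s)) t"
    unfolding duhamel_def set_lebesgue_integral_def by (intro tendsto_intros)
  then show "(\<lambda>n. it (Suc n) t) \<longlonglongrightarrow> P t x + duhamel (\<lambda>s. G s (solution s + v s)) t" by simp
qed

lemma solution_rhs_bounded: "\<exists>K. \<forall>s\<in>{0..T}. norm (G s (solution s + v s)) \<le> K"
  using solution_bounded[of T] G_bounded_along by metis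

lemma solution_continuous: "continuous_on {0..} solution"
proof -
  note [measurable (raw)] = G_compose and [measurable] = v_meas picard_measurable solution_measurable
  have "continuous_on UNIV (duhamel (\<lambda>s. G s (solution s + v s)))"
    by (rule duhamel_continuous) (measurable, rule solution_rhs_bounded)
  then have "continuous_on UNIV (\<lambda>t. P t x + duhamel (\<lambda>s. G s (solution s + v s)) t)"
    by (intro continuous_on_add flow_continuous_on continuous_on_id continuous_on_const)
  then show ?thesis
    by (rule continuous_on_eq[OF continuous_on_subset]) (use solution_eq in auto)
qed

end

text \<open>The value at \<open>r\<close> depends on the iterates and on \<open>V\<close> only at times in \<open>[0, r]\<close>. Clamping the time
  to this interval gives functions that are jointly measurable with respect to \<open>N\<close>, and the
  integral in \<open>s\<close> preserves measurability in \<open>\<omega>\<close>.\<close>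

lemma picard_adapted:
  assumes V_meas: "\<And>s. s \<in> {0..t} \<Longrightarrow> V s \<in> borel_measurable N"
    and V_cont: "\<And>\<omega>. \<omega> \<in> space N \<Longrightarrow> continuous_on UNIV (\<lambda>s. V s \<omega>)"
    and r: "r \<in> {0..t}"
  shows "(\<lambda>\<omega>. picard G x (\<lambda>s. V s \<omega>) n r) \<in> borel_measurable N"
  using r
proof (induction n arbitrary: r)
  case 0
  then show ?case by simp
next
  case (Suc n)
  note [measurable (raw)] = G_compose
  define c where "c s = max 0 (min r s)" for s :: real
  have c_cont: "continuous_on UNIV c" unfolding c_def by (intro continuous_intros)
  have c_in: "c s \<in> {0..r}" for s using Suc.prems by (auto simp: c_def)
  have c_id: "c s = s" if "s \<in> {0..r}" for s using that by (auto simp: c_def)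
  have [measurable]: "(\<lambda>p. picard G x (\<lambda>s. V s (snd p)) n (c (fst p))) \<in> borel_measurable (borel \<Otimes>\<^sub>M N)"
  proof (rule measurable_of_continuous_paths)
    show "(\<lambda>\<omega>. picard G x (\<lambda>s. V s \<omega>) n (c s)) \<in> borel_measurable N" for s
      by (rule Suc.IH) (use c_in[of s] Suc.prems in auto)
    show "continuous_on UNIV (\<lambda>s. picard G x (\<lambda>s. V s \<omega>) n (c s))" if "\<omega> \<in> space N" for \<omega>
      by (rule continuous_on_compose2[OF picard_continuous[OF V_cont[OF that]] c_cont]) simp
  qed
  have [measurable]: "(\<lambda>p. V (c (fst p)) (snd p)) \<in> borel_measurable (borel \<Otimes>\<^sub>M N)"
  proof (rule measurable_of_continuous_paths)
    show "V (c s) \<in> borel_measurable N" for s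
      by (rule V_meas) (use c_in[of s] Suc.prems in auto)
    show "continuous_on UNIV (\<lambda>s. V (c s) \<omega>)" if "\<omega> \<in> space N" for \<omega>
      by (rule continuous_on_compose2[OF V_cont[OF that] c_cont]) simp
  qed
  have eq: "duhamel (\<lambda>s. G s (picard G x (\<lambda>s. V s \<omega>) n s + V s \<omega>)) r
      = (LINT s|lborel. indicator {0..r} s *\<^sub>R P (r - s) (G s (picard G x (\<lambda>s. V s \<omega>) n (c s) + V (c s) \<omega>)))" for \<omega>
    unfolding duhamel_def set_lebesgue_integral_def
    by (intro Bochner_Integration.integral_cong refl) (auto simp: indicator_def c_id)
  have "(\<lambda>q. (\<lambda>p. indicator {0..r} (fst p) *\<^sub>R P (r - fst p) (G (fst p) (picard G x (\<lambda>s. V s (snd p)) n (c (fst p)) + V (c (fst p)) (snd p)))) (snd q, fst q))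
      \<in> borel_measurable (N \<Otimes>\<^sub>M lborel)"
    by measurable
  then have [measurable]: "(\<lambda>\<omega>. LINT s|lborel. indicator {0..r} s *\<^sub>R P (r - s) (G s (picard G x (\<lambda>s. V s \<omega>) n (c s) + V (c s) \<omega>)))
      \<in> borel_measurable N"
    by (intro sigma_finite_measure.borel_measurable_lebesgue_integral sigma_finite_lborel) (simp add: case_prod_beta')
  show ?case unfolding picard.simps eq by measurable
qed

end

end

section \<open>Mean-square limits of Gaussian variables\<close>

text \<open>The description by the characteristic function includes the degenerate case \<open>v = 0\<close>.\<close>

definition centred_gaussian :: "'w measure \<Rightarrow> ('w \<Rightarrow> real) \<Rightarrow> real \<Rightarrow> bool" where
  "centred_gaussian M X v \<longleftrightarrow>
     X \<in> borel_measurable M \<and> (\<forall>\<xi>. char (distr M borel X) \<xi> = complex_of_real (exp (- (v * \<xi>\<^sup>2) / 2)))"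

lemma char_distr_eq:
  assumes [measurable]: "X \<in> borel_measurable M"
  shows "char (distr M borel X) \<xi> = (CLINT \<omega>|M. iexp (\<xi> * X \<omega>))"
  unfolding char_def by (simp add: integral_distr)

lemma std_normal_density_le_1: "std_normal_density x \<le> 1"
proof -
  have "1 / sqrt (2 * pi) \<le> 1" using pi_gt3 by (simp add: real_le_rsqrt)
  moreover have "exp (- x\<^sup>2 / 2) \<le> 1" by simp
  ultimately show ?thesis
    unfolding std_normal_density_def using mult_mono[of "1 / sqrt (2 * pi)" 1 "exp (- x\<^sup>2 / 2)" 1] by simp
qed

lemma std_normal_small_ball:
  assumes "0 \<le> a"
  shows "emeasure std_normal_distribution {- a..a} \<le> ennreal (2 * a)"
proof -
  have "emeasure std_normal_distribution {- a..a} = (\<integral>\<^sup>+ x. ennreal (std_normal_density x) * indicator {- a..a} x \<partial>lborel)"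
    by (simp add: emeasure_density)
  also have "\<dots> \<le> (\<integral>\<^sup>+ x. indicator {- a..a} x \<partial>lborel)"
    using std_normal_density_le_1 by (intro nn_integral_mono) (auto simp: indicator_def)
  also have "\<dots> = ennreal (2 * a)" using assms by simp
  finally show ?thesis .
qed

lemma std_normal_tail_pos: "0 < emeasure std_normal_distribution {a<..}"
proof (rule ccontr)
  assume "\<not> ?thesis"
  then have "{a<..} \<in> null_sets std_normal_distribution" by (auto simp: null_sets_def)
  then have "AE x in lborel. x \<in> {a<..} \<longrightarrow> ennreal (std_normal_density x) = 0"
    by (subst (asm) null_sets_density_iff) auto
  then have "AE x in lborel. x \<notin> {a<..<a + 1}"
  proof eventually_elim
    case (elim x)
    then show ?case using normal_density_pos[of 1 0 x] by (auto simp: ennreal_eq_0_iff not_le)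
  qed
  then have "emeasure lborel {a<..<a + 1} = 0"
    by (subst (asm) AE_iff_measurable[of "{a<..<a + 1}"]) auto
  then show False by simp
qed

context prob_space
begin

lemma centred_gaussian_cong_AE:
  assumes "centred_gaussian M X v" and [measurable]: "Y \<in> borel_measurable M" and "AE \<omega> in M. X \<omega> = Y \<omega>"
  shows "centred_gaussian M Y v"
proof -
  have [measurable]: "X \<in> borel_measurable M" using assms(1) by (simp add: centred_gaussian_def)
  have "(CLINT \<omega>|M. iexp (\<xi> * X \<omega>)) = (CLINT \<omega>|M. iexp (\<xi> * Y \<omega>))" for \<xi>
    by (rule integral_cong_AE) (use assms(3) in auto)
  then show ?thesis using assms(1) by (simp add: centred_gaussian_def char_distr_eq)
qed

lemma centred_gaussian_zero: "centred_gaussian M (\<lambda>\<omega>. 0) 0"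
proof -
  have "char (distr M borel (\<lambda>\<omega>. 0)) \<xi> = 1" for \<xi>
    by (subst char_distr_eq) (simp_all add: prob_space)
  then show ?thesis by (simp add: centred_gaussian_def)
qed

lemma centred_gaussian_normal:
  assumes X: "distributed M lborel X (\<lambda>r. ennreal (normal_density 0 s r))" and s: "s > 0"
  shows "centred_gaussian M X (s\<^sup>2)"
proof -
  have X_meas [measurable]: "X \<in> borel_measurable M" using distributed_measurable[OF X] by simp
  have "distributed M lborel (\<lambda>\<omega>. X \<omega> / s) (\<lambda>r. ennreal (std_normal_density r))"
    using X normal_standard_normal_convert[OF s, of X 0] by simp
  then have "distr M lborel (\<lambda>\<omega>. X \<omega> / s) = std_normal_distribution" by (rule distributed_distr_eq_density)
  moreover have "distr M lborel (\<lambda>\<omega>. X \<omega> / s) = distr M borel (\<lambda>\<omega>. X \<omega> / s)"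
    by (rule distr_cong) auto
  ultimately have d: "distr M borel (\<lambda>\<omega>. X \<omega> / s) = std_normal_distribution" by simp
  have "char (distr M borel X) \<xi> = complex_of_real (exp (- (s\<^sup>2 * \<xi>\<^sup>2) / 2))" for \<xi>
  proof -
    have "char (distr M borel X) \<xi> = (CLINT \<omega>|M. iexp (\<xi> * X \<omega>))" by (rule char_distr_eq) measurable
    also have "\<dots> = (CLINT \<omega>|M. iexp ((\<xi> * s) * (X \<omega> / s)))" using s by simp
    also have "\<dots> = char (distr M borel (\<lambda>\<omega>. X \<omega> / s)) (\<xi> * s)" by (rule char_distr_eq[symmetric]) measurable
    also have "\<dots> = complex_of_real (exp (- (s\<^sup>2 * \<xi>\<^sup>2) / 2))"
      unfolding d char_std_normal_distribution by (simp add: power_mult_distrib mult.commute)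
    finally show ?thesis .
  qed
  then show ?thesis by (simp add: centred_gaussian_def)
qed

lemma centred_gaussian_add:
  assumes X: "centred_gaussian M X v" and Y: "centred_gaussian M Y w"
    and XF: "X \<in> borel_measurable F" "space F = space M"
    and indep: "indep_set (sets F) {Y -` B \<inter> space M | B. B \<in> sets borel}"
  shows "centred_gaussian M (\<lambda>\<omega>. X \<omega> + Y \<omega>) (v + w)"
proof -
  have [measurable]: "X \<in> borel_measurable M" "Y \<in> borel_measurable M"
    using X Y by (auto simp: centred_gaussian_def)
  have "indep_var borel X borel Y"
    unfolding indep_var_def indep_vars_def2
  proof (intro conjI ballI)
    show "random_variable (case_bool borel borel i) (case_bool X Y i)" for i by (cases i) auto
    show "indep_sets (\<lambda>i. {case_bool X Y i -` A \<inter> space M | A. A \<in> sets (case_bool borel borel i)}) UNIV"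
    proof (rule indep_sets_mono_sets)
      show "indep_sets (case_bool (sets F) {Y -` B \<inter> space M | B. B \<in> sets borel}) UNIV"
        using indep by (simp add: indep_set_def)
      show "{case_bool X Y i -` A \<inter> space M | A. A \<in> sets (case_bool borel borel i)}
          \<subseteq> (case i of True \<Rightarrow> sets F | False \<Rightarrow> {Y -` B \<inter> space M | B. B \<in> sets borel})" for i
        using measurable_sets[OF XF(1)] XF(2) by (cases i) auto
    qed
  qed
  from char_distr_add[OF this] show ?thesis
    using X Y by (auto simp: centred_gaussian_def distrib_right add_divide_distrib exp_add[symmetric] of_real_mult[symmetric]
        simp del: of_real_mult)
qed

lemma centred_gaussian_distr:
  assumes X: "centred_gaussian M X v" and v: "v > 0"
  shows "distr M borel X = distr std_normal_distribution borel (\<lambda>r. sqrt v * r)"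
proof (rule Levy_uniqueness)
  have X_meas [measurable]: "X \<in> borel_measurable M" using X by (simp add: centred_gaussian_def)
  interpret N: prob_space std_normal_distribution by (rule prob_space_normal_density) simp
  show "real_distribution (distr M borel X)" by (rule real_distribution_distr) measurable
  show "real_distribution (distr std_normal_distribution borel (\<lambda>r. sqrt v * r))"
    by (rule N.real_distribution_distr) measurable
  show "char (distr M borel X) = char (distr std_normal_distribution borel (\<lambda>r. sqrt v * r))"
  proof
    fix \<xi>
    have "char (distr std_normal_distribution borel (\<lambda>r. sqrt v * r)) \<xi>
        = (CLINT r|std_normal_distribution. iexp (\<xi> * (sqrt v * r)))"
      by (rule char_distr_eq) measurable
    also have "\<dots> = char std_normal_distribution (\<xi> * sqrt v)" by (simp add: char_def ac_simps)
    also have "\<dots> = complex_of_real (exp (- (v * \<xi>\<^sup>2) / 2))"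
      unfolding char_std_normal_distribution using v by (simp add: power_mult_distrib mult.commute)
    finally show "char (distr M borel X) \<xi> = char (distr std_normal_distribution borel (\<lambda>r. sqrt v * r)) \<xi>"
      using X by (simp add: centred_gaussian_def)
  qed
qed

lemma centred_gaussian_small_ball:
  assumes X: "centred_gaussian M X v" and c0: "0 < c0" "c0 \<le> v" and \<delta>: "0 \<le> \<delta>"
  shows "emeasure M {\<omega> \<in> space M. \<bar>X \<omega>\<bar> \<le> \<delta>} \<le> ennreal (2 * (\<delta> / sqrt c0))"
proof -
  have X_meas [measurable]: "X \<in> borel_measurable M" using X by (simp add: centred_gaussian_def)
  have "emeasure M {\<omega> \<in> space M. \<bar>X \<omega>\<bar> \<le> \<delta>} = emeasure (distr M borel X) {- \<delta>..\<delta>}"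
    by (subst emeasure_distr) (auto intro!: arg_cong[where f = "emeasure M"])
  also have "\<dots> = emeasure std_normal_distribution {r. sqrt v * r \<in> {- \<delta>..\<delta>}}"
    using c0 by (subst centred_gaussian_distr[OF X]) (auto simp: emeasure_distr vimage_def)
  also have "\<dots> \<le> emeasure std_normal_distribution {- (\<delta> / sqrt c0)..\<delta> / sqrt c0}"
  proof (rule emeasure_mono)
    have "\<bar>r\<bar> * sqrt c0 \<le> \<delta>" if "\<bar>sqrt v * r\<bar> \<le> \<delta>" for r
    proof -
      have "\<bar>r\<bar> * sqrt c0 \<le> \<bar>r\<bar> * sqrt v" using c0 by (intro mult_left_mono) auto
      also have "\<dots> \<le> \<delta>" using that c0 by (simp add: abs_mult mult.commute)
      finally show ?thesis .
    qed
    then show "{r. sqrt v * r \<in> {- \<delta>..\<delta>}} \<subseteq> {- (\<delta> / sqrt c0)..\<delta> / sqrt c0}"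
    proof (intro subsetI)
      fix r assume *: "\<And>r. \<bar>sqrt v * r\<bar> \<le> \<delta> \<Longrightarrow> \<bar>r\<bar> * sqrt c0 \<le> \<delta>" and "r \<in> {r. sqrt v * r \<in> {- \<delta>..\<delta>}}"
      then have "\<bar>r\<bar> * sqrt c0 \<le> \<delta>" by (intro *) auto
      then have "\<bar>r\<bar> \<le> \<delta> / sqrt c0" using c0 by (simp add: pos_le_divide_eq)
      then show "r \<in> {- (\<delta> / sqrt c0)..\<delta> / sqrt c0}" by (simp add: abs_le_iff)
    qed
  qed simp
  also have "\<dots> \<le> ennreal (2 * (\<delta> / sqrt c0))" using c0 \<delta> by (intro std_normal_small_ball) simp
  finally show ?thesis .
qed

lemma centred_gaussian_tail:
  assumes X: "centred_gaussian M X v" and c0: "0 < c0" "c0 \<le> v" and c: "0 \<le> c"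
  shows "emeasure std_normal_distribution {c / sqrt c0<..} \<le> emeasure M {\<omega> \<in> space M. c < X \<omega>}"
proof -
  have X_meas [measurable]: "X \<in> borel_measurable M" using X by (simp add: centred_gaussian_def)
  have "emeasure std_normal_distribution {c / sqrt c0<..} \<le> emeasure std_normal_distribution {r. sqrt v * r \<in> {c<..}}"
  proof (rule emeasure_mono)
    show "{c / sqrt c0<..} \<subseteq> {r. sqrt v * r \<in> {c<..}}"
    proof
      fix r assume "r \<in> {c / sqrt c0<..}"
      then have "c < r * sqrt c0" using c0 by (simp add: pos_divide_less_eq)
      also have "r * sqrt c0 \<le> r * sqrt v"
      proof (rule mult_left_mono)
        have "0 \<le> c / sqrt c0" using c c0 by simp
        then show "0 \<le> r" using \<open>r \<in> {c / sqrt c0<..}\<close> by auto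
      qed (use c0 in simp)
      finally show "r \<in> {r. sqrt v * r \<in> {c<..}}" by (simp add: mult.commute)
    qed
  qed simp
  also have "\<dots> = emeasure (distr M borel X) {c<..}"
    using c0 by (subst centred_gaussian_distr[OF X]) (auto simp: emeasure_distr vimage_def)
  also have "\<dots> = emeasure M {\<omega> \<in> space M. c < X \<omega>}"
    by (subst emeasure_distr) (auto intro!: arg_cong[where f = "emeasure M"])
  finally show ?thesis .
qed

lemma L2_limit_in_probability:
  assumes [measurable]: "\<And>n. X n \<in> borel_measurable M" "Y \<in> borel_measurable M"
    and lim: "(\<lambda>n. \<integral>\<^sup>+ \<omega>. ennreal ((X n \<omega> - Y \<omega>)\<^sup>2) \<partial>M) \<longlonglongrightarrow> 0" and r: "0 < r"
  shows "(\<lambda>n. emeasure M {\<omega> \<in> space M. r \<le> \<bar>X n \<omega> - Y \<omega>\<bar>}) \<longlonglongrightarrow> 0"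
proof (rule tendsto_sandwich[OF always_eventually always_eventually tendsto_const])
  show "\<forall>n. emeasure M {\<omega> \<in> space M. r \<le> \<bar>X n \<omega> - Y \<omega>\<bar>}
      \<le> ennreal (1 / r\<^sup>2) * (\<integral>\<^sup>+ \<omega>. ennreal ((X n \<omega> - Y \<omega>)\<^sup>2) \<partial>M)"
  proof
    fix n
    have "{\<omega> \<in> space M. r \<le> \<bar>X n \<omega> - Y \<omega>\<bar>} = {\<omega> \<in> space M. 1 \<le> ennreal (1 / r\<^sup>2) * ennreal ((X n \<omega> - Y \<omega>)\<^sup>2)}"
    proof (intro Collect_cong conj_cong refl)
      fix \<omega>
      have "r \<le> \<bar>X n \<omega> - Y \<omega>\<bar> \<longleftrightarrow> r\<^sup>2 \<le> (X n \<omega> - Y \<omega>)\<^sup>2"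
        using r abs_le_square_iff[of r "X n \<omega> - Y \<omega>"] by simp
      also have "\<dots> \<longleftrightarrow> 1 \<le> 1 / r\<^sup>2 * (X n \<omega> - Y \<omega>)\<^sup>2" using r by (simp add: field_simps)
      also have "\<dots> \<longleftrightarrow> ennreal 1 \<le> ennreal (1 / r\<^sup>2 * (X n \<omega> - Y \<omega>)\<^sup>2)" by (subst ennreal_le_iff) auto
      finally show "r \<le> \<bar>X n \<omega> - Y \<omega>\<bar> \<longleftrightarrow> 1 \<le> ennreal (1 / r\<^sup>2) * ennreal ((X n \<omega> - Y \<omega>)\<^sup>2)"
        by (simp add: ennreal_mult'[symmetric])
    qed
    then show "emeasure M {\<omega> \<in> space M. r \<le> \<bar>X n \<omega> - Y \<omega>\<bar>}
      \<le> ennreal (1 / r\<^sup>2) * (\<integral>\<^sup>+ \<omega>. ennreal ((X n \<omega> - Y \<omega>)\<^sup>2) \<partial>M)"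
      using nn_integral_Markov_inequality[of "\<lambda>\<omega>. ennreal ((X n \<omega> - Y \<omega>)\<^sup>2)" "space M" M "ennreal (1 / r\<^sup>2)"]
      by (simp cong: nn_integral_cong)
  qed
  have "(\<lambda>n. ennreal (1 / r\<^sup>2) * (\<integral>\<^sup>+ \<omega>. ennreal ((X n \<omega> - Y \<omega>)\<^sup>2) \<partial>M)) \<longlonglongrightarrow> ennreal (1 / r\<^sup>2) * 0"
    by (intro ennreal_tendsto_cmult lim) simp
  then show "(\<lambda>n. ennreal (1 / r\<^sup>2) * (\<integral>\<^sup>+ \<omega>. ennreal ((X n \<omega> - Y \<omega>)\<^sup>2) \<partial>M)) \<longlonglongrightarrow> 0" by simp
qed auto

text \<open>Variances bounded below by \<open>c0\<close> give, uniformly in \<open>n\<close>, a small probability of being near 0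
  and a positive probability of exceeding a given level. Both pass to a limit in probability, at the
  price of shifting the thresholds by the distance between \<open>X n\<close> and \<open>Y\<close>.\<close>

lemma L2_limit_of_gaussians_nondegenerate:
  assumes gauss: "\<And>n. centred_gaussian M (X n) (v n)" and c0: "0 < c0" "eventually (\<lambda>n. c0 \<le> v n) sequentially"
    and Y_meas [measurable]: "Y \<in> borel_measurable M"
    and lim: "(\<lambda>n. \<integral>\<^sup>+ \<omega>. ennreal ((X n \<omega> - Y \<omega>)\<^sup>2) \<partial>M) \<longlonglongrightarrow> 0"
  shows "AE \<omega> in M. Y \<omega> \<noteq> 0" "\<not> (AE \<omega> in M. Y \<omega> \<le> c)"
proof -
  have X_meas [measurable]: "X n \<in> borel_measurable M" for n using gauss by (simp add: centred_gaussian_def)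
  note prob_lim = L2_limit_in_probability[of X Y, OF X_meas Y_meas lim]
  have zero: "emeasure M {\<omega> \<in> space M. Y \<omega> = 0} \<le> ennreal (2 * (\<delta> / sqrt c0))" if \<delta>: "\<delta> > 0" for \<delta>
  proof (rule tendsto_lowerbound)
    have "(\<lambda>n. ennreal (2 * (\<delta> / sqrt c0)) + emeasure M {\<omega> \<in> space M. \<delta> \<le> \<bar>X n \<omega> - Y \<omega>\<bar>})
        \<longlonglongrightarrow> ennreal (2 * (\<delta> / sqrt c0)) + 0"
      by (intro tendsto_add tendsto_const prob_lim \<delta>)
    then show "(\<lambda>n. ennreal (2 * (\<delta> / sqrt c0)) + emeasure M {\<omega> \<in> space M. \<delta> \<le> \<bar>X n \<omega> - Y \<omega>\<bar>})
        \<longlonglongrightarrow> ennreal (2 * (\<delta> / sqrt c0))" by simp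
    show "eventually (\<lambda>n. emeasure M {\<omega> \<in> space M. Y \<omega> = 0}
        \<le> ennreal (2 * (\<delta> / sqrt c0)) + emeasure M {\<omega> \<in> space M. \<delta> \<le> \<bar>X n \<omega> - Y \<omega>\<bar>}) sequentially"
      using c0(2)
    proof eventually_elim
      case (elim n)
      have "emeasure M {\<omega> \<in> space M. Y \<omega> = 0}
          \<le> emeasure M ({\<omega> \<in> space M. \<bar>X n \<omega>\<bar> \<le> \<delta>} \<union> {\<omega> \<in> space M. \<delta> \<le> \<bar>X n \<omega> - Y \<omega>\<bar>})"
        by (rule emeasure_mono) auto
      also have "\<dots> \<le> emeasure M {\<omega> \<in> space M. \<bar>X n \<omega>\<bar> \<le> \<delta>} + emeasure M {\<omega> \<in> space M. \<delta> \<le> \<bar>X n \<omega> - Y \<omega>\<bar>}"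
        by (rule emeasure_subadditive) auto
      also have "\<dots> \<le> ennreal (2 * (\<delta> / sqrt c0)) + emeasure M {\<omega> \<in> space M. \<delta> \<le> \<bar>X n \<omega> - Y \<omega>\<bar>}"
        by (intro add_right_mono centred_gaussian_small_ball[OF gauss c0(1) elim]) (use \<delta> in simp)
      finally show ?case .
    qed
  qed simp
  have "((\<lambda>\<delta>. ennreal (2 * (\<delta> / sqrt c0))) \<longlongrightarrow> ennreal (2 * (0 / sqrt c0))) (at_right 0)"
    using c0(1) by (intro tendsto_ennrealI tendsto_intros) auto
  then have "emeasure M {\<omega> \<in> space M. Y \<omega> = 0} \<le> ennreal (2 * (0 / sqrt c0))"
    by (rule tendsto_lowerbound) (rule eventually_at_rightI[of 0 1], rule zero, auto)
  then have "emeasure M {\<omega> \<in> space M. \<not> Y \<omega> \<noteq> 0} = 0" by simp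
  then show "AE \<omega> in M. Y \<omega> \<noteq> 0" by (subst AE_iff_measurable[OF _ refl]) auto
  show "\<not> (AE \<omega> in M. Y \<omega> \<le> c)"
  proof
    assume "AE \<omega> in M. Y \<omega> \<le> c"
    then have null: "emeasure M {\<omega> \<in> space M. \<not> Y \<omega> \<le> c} = 0"
      by (subst (asm) AE_iff_measurable[OF _ refl]) auto
    define p where "p = emeasure std_normal_distribution {(\<bar>c\<bar> + 1) / sqrt c0<..}"
    have "p \<le> 0"
    proof (rule tendsto_lowerbound[OF prob_lim[of 1]])
      show "eventually (\<lambda>n. p \<le> emeasure M {\<omega> \<in> space M. 1 \<le> \<bar>X n \<omega> - Y \<omega>\<bar>}) sequentially"
        using c0(2)
      proof eventually_elim
        case (elim n)
        have "p \<le> emeasure M {\<omega> \<in> space M. \<bar>c\<bar> + 1 < X n \<omega>}"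
          unfolding p_def by (rule centred_gaussian_tail[OF gauss c0(1) elim]) simp
        also have "\<dots> \<le> emeasure M ({\<omega> \<in> space M. \<not> Y \<omega> \<le> c} \<union> {\<omega> \<in> space M. 1 \<le> \<bar>X n \<omega> - Y \<omega>\<bar>})"
          by (rule emeasure_mono) auto
        also have "\<dots> \<le> emeasure M {\<omega> \<in> space M. \<not> Y \<omega> \<le> c} + emeasure M {\<omega> \<in> space M. 1 \<le> \<bar>X n \<omega> - Y \<omega>\<bar>}"
          by (rule emeasure_subadditive) auto
        finally show ?case using null by simp
      qed
    qed auto
    then show False using std_normal_tail_pos[of "(\<bar>c\<bar> + 1) / sqrt c0"] by (simp add: p_def)
  qed
qed

end

section \<open>Nondegeneracy of Wiener integrals\<close>

text \<open>A list of triples \<open>(a, b, k)\<close> represents the step function with values in \<open>H\<close> that is the sum of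
  \<open>k\<close> on \<open>(a, b]\<close>; this is its stochastic integral up to the time \<open>\<tau>\<close>. Truncating at \<open>\<tau>\<close> makes it
  possible to add the intervals between successive end points one at a time.\<close>

definition truncated_integral ::
    "(real \<Rightarrow> 'h \<Rightarrow> 'w \<Rightarrow> real) \<Rightarrow> (real \<times> real \<times> 'h) list \<Rightarrow> real \<Rightarrow> 'w \<Rightarrow> real" where
  "truncated_integral W xs \<tau> \<omega> = (\<Sum>(a, b, k)\<leftarrow>xs. W (min b \<tau>) k \<omega> - W (min a \<tau>) k \<omega>)"

definition active_vector :: "(real \<times> real \<times> 'h::real_vector) list \<Rightarrow> real \<Rightarrow> 'h" where
  "active_vector xs s = (\<Sum>(a, b, k)\<leftarrow>xs. if a < s \<and> s \<le> b then k else 0)"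

lemma active_vector_Nil [simp]: "active_vector [] s = 0"
  by (simp add: active_vector_def)

lemma active_vector_Cons [simp]:
  "active_vector ((a, b, k) # xs) s = (if a < s \<and> s \<le> b then k else 0) + active_vector xs s"
  by (simp add: active_vector_def)

lemma truncated_integral_Nil [simp]: "truncated_integral W [] \<tau> \<omega> = 0"
  by (simp add: truncated_integral_def)

lemma truncated_integral_Cons [simp]:
  "truncated_integral W ((a, b, k) # xs) \<tau> \<omega>
    = (W (min b \<tau>) k \<omega> - W (min a \<tau>) k \<omega>) + truncated_integral W xs \<tau> \<omega>"
  by (simp add: truncated_integral_def)

lemma active_vector_measurable [measurable]:
  fixes xs :: "(real \<times> real \<times> 'h::{real_normed_vector, second_countable_topology}) list"
  shows "active_vector xs \<in> borel_measurable borel"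
proof (induction xs)
  case Nil
  have "active_vector [] = (\<lambda>s. 0 :: 'h)" by (rule ext) simp
  then show ?case by simp
next
  case (Cons x xs)
  obtain a b k where x: "x = (a, b, k)" by (cases x)
  have "active_vector (x # xs) = (\<lambda>s. (if a < s \<and> s \<le> b then k else 0) + active_vector xs s)"
    unfolding x by (rule ext) simp
  then show ?case using Cons by simp
qed

lemma active_vector_bounded:
  fixes xs :: "(real \<times> real \<times> 'h::real_normed_vector) list"
  shows "\<exists>K. \<forall>s. norm (active_vector xs s) \<le> K"
proof (induction xs)
  case (Cons x xs)
  obtain a b k where x: "x = (a, b, k)" by (cases x)
  obtain K where K: "\<And>s. norm (active_vector xs s) \<le> K" using Cons by blast
  have "norm (active_vector (x # xs) s) \<le> norm k + K" for s
    unfolding x active_vector_Cons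
    by (rule order_trans[OF norm_triangle_ineq add_mono[OF _ K]]) simp
  then show ?case by blast
qed auto

text \<open>The adjoint of the operator-valued step function, applied to \<open>z\<close>: the adjoint of \<open>u \<otimes> h\<close> maps
  \<open>z\<close> to \<open>inner z u *\<^sub>R h\<close>.\<close>

definition component :: "'h::real_inner \<Rightarrow> (real \<times> real \<times> 'h \<times> 'h) list \<Rightarrow> (real \<times> real \<times> 'h) list" where
  "component z = map (\<lambda>(a, b, h, u). (a, b, inner z u *\<^sub>R h))"

lemma component_step_integrand:
  fixes xs :: "(real \<times> real \<times> 'h::real_inner \<times> 'h) list"
  shows "inner (active_vector (component z xs) s) y = inner z (step_integrand xs s y)"
proof (induction xs)
  case Nil
  then show ?case by (simp add: component_def step_integrand_def)
next
  case (Cons x xs)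
  obtain a b h u where x: "x = (a, b, h, u)" by (cases x)
  have 1: "active_vector (component z (x # xs)) s
      = (if a < s \<and> s \<le> b then inner z u *\<^sub>R h else 0) + active_vector (component z xs) s"
    by (simp add: x component_def)
  have 2: "step_integrand (x # xs) s
      = (if a < s \<and> s \<le> b then blinfun_scaleR_left u o\<^sub>L blinfun_inner_left h else 0) + step_integrand xs s"
    by (simp add: x step_integrand_def)
  show ?case
    unfolding 1 2 using Cons
    by (simp add: blinfun.add_left inner_add_left inner_add_right inner_commute)
qed

text \<open>The variance of the \<open>z\<close>-component of a step integral is the integral of the squared norm of the
  adjoint step function at \<open>z\<close>. Testing the adjoint against the single vector \<open>y\<close> bounds it from
  below by \<open>\<phi>\<close>, up to the Hilbert--Schmidt distance to \<open>\<Phi>\<close>, and \<open>\<phi>\<close> is at least \<open>\<phi> t / 2\<close> on an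
  interval \<open>[r, t]\<close>.\<close>

lemma step_variance_bounded_below:
  fixes xs :: "nat \<Rightarrow> (real \<times> real \<times> 'h \<times> 'h::{real_inner, banach, second_countable_topology}) list"
  assumes lim: "(\<lambda>n. \<integral>\<^sup>+ s\<in>{0..t}. hs_norm_sq (step_integrand (xs n) s - \<Phi> s) \<partial>lborel) \<longlonglongrightarrow> 0"
    and t: "0 < t" and y: "norm y \<le> 1"
    and \<phi>_cont: "continuous_on UNIV \<phi>" and \<phi>: "\<And>s. s \<in> {0..t} \<Longrightarrow> \<phi> s = inner z (\<Phi> s y)" and pos: "0 < \<phi> t"
  shows "\<exists>c>0. eventually (\<lambda>n. c \<le> (LINT s:{0..t}|lborel. (norm (active_vector (component z (xs n)) s))\<^sup>2)) sequentially"
proof -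
  define k where "k n s = active_vector (component z (xs n)) s" for n s
  define v where "v n = (LINT s:{0..t}|lborel. (norm (k n s))\<^sup>2)" for n
  define m where "m = \<phi> t / 2"
  have z: "0 < norm z" using \<phi>[of t] pos t by auto
  have m: "0 < m" using pos by (simp add: m_def)
  obtain r where r: "0 \<le> r" "r < t" and \<phi>_ge: "\<And>s. s \<in> {r..t} \<Longrightarrow> m \<le> \<phi> s"
  proof -
    have "isCont \<phi> t" using \<phi>_cont by (simp add: continuous_on_eq_continuous_at)
    then obtain d where d: "d > 0" "\<And>s. dist s t < d \<Longrightarrow> dist (\<phi> s) (\<phi> t) < m"
      unfolding continuous_at_eps_delta using m by meson
    show ?thesis
    proof (rule that[of "max 0 (t - d / 2)"])
      fix s assume "s \<in> {max 0 (t - d / 2)..t}"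
      then have "dist s t < d" using d by (auto simp: dist_real_def)
      from d(2)[OF this] show "m \<le> \<phi> s" unfolding dist_real_def abs_less_iff m_def by linarith
    qed (use d t in auto)
  qed
  have v_int: "set_integrable lborel {0..t} (\<lambda>s. (norm (k n s))\<^sup>2)" for n
  proof -
    obtain K where "\<And>s. norm (k n s) \<le> K" unfolding k_def using active_vector_bounded by blast
    then show ?thesis
      unfolding k_def by (intro set_integrable_bounded_Icc[where K = "K\<^sup>2"]) (simp_all add: power_mono)
  qed
  \<comment> \<open>a real lower bound of the squared Hilbert--Schmidt distance that contains the variance with a minus sign\<close>
  define g where "g n s = (m\<^sup>2 * indicator {r..t} s - 2 * (indicator {0..t} s *\<^sub>R (norm (k n s))\<^sup>2)) / (2 * (norm z)\<^sup>2)" for n s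
  have g_le: "ennreal (g n s) \<le> hs_norm_sq (step_integrand (xs n) s - \<Phi> s) * indicator {0..t} s" for n s
  proof (cases "s \<in> {r..t}")
    case True
    then have s: "s \<in> {0..t}" using r by auto
    define T where "T = step_integrand (xs n) s - \<Phi> s"
    have "\<bar>inner (k n s) y\<bar> \<le> norm (k n s) * norm y" by (rule Cauchy_Schwarz_ineq2)
    also have "\<dots> \<le> norm (k n s) * 1" using y by (intro mult_left_mono) auto
    finally have "\<bar>inner (k n s) y\<bar> \<le> norm (k n s)" by simp
    moreover have "\<bar>inner z (T y)\<bar> \<le> norm z * norm (T y)" by (rule Cauchy_Schwarz_ineq2)
    moreover have "inner z (T y) = inner (k n s) y - \<phi> s"
      using \<phi>[OF s] by (simp add: T_def k_def component_step_integrand blinfun.diff_left inner_diff_right)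
    ultimately have "m \<le> norm (k n s) + norm z * norm (T y)" using \<phi>_ge[OF True] by linarith
    then have "m\<^sup>2 \<le> (norm (k n s) + norm z * norm (T y))\<^sup>2" using m by (intro power_mono) auto
    also have "\<dots> \<le> 2 * (norm (k n s))\<^sup>2 + 2 * ((norm z)\<^sup>2 * (norm (T y))\<^sup>2)"
      using zero_le_power2[of "norm (k n s) - norm z * norm (T y)"]
      by (simp add: power2_sum power2_diff power_mult_distrib)
    finally have "g n s \<le> (norm (T y))\<^sup>2"
      using z True s by (simp add: g_def pos_divide_le_eq algebra_simps)
    then show ?thesis
      using norm_apply_le_hs_norm_sq[OF y, of T] s unfolding T_def by (simp add: order_trans[OF ennreal_leI])
  next
    case False
    then have "g n s \<le> 0" by (simp add: g_def divide_nonpos_nonneg)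
    then show ?thesis by (simp add: ennreal_neg)
  qed
  have ind_int: "integrable lborel (\<lambda>s. m\<^sup>2 * indicator {r..t} s :: real)"
    by (intro integrable_mult_right integrable_real_indicator) (auto simp: emeasure_lborel_Icc_eq)
  have g_integral: "(LINT s|lborel. g n s) = (m\<^sup>2 * (t - r) - 2 * v n) / (2 * (norm z)\<^sup>2)" for n
    using ind_int v_int[of n] r unfolding g_def v_def set_lebesgue_integral_def set_integrable_def by simp
  define c where "c = m\<^sup>2 * (t - r) / 4"
  have c: "0 < c" using m r by (simp add: c_def)
  have "eventually (\<lambda>n. (\<integral>\<^sup>+ s\<in>{0..t}. hs_norm_sq (step_integrand (xs n) s - \<Phi> s) \<partial>lborel) < ennreal (c / (norm z)\<^sup>2)) sequentially"
    by (rule order_tendstoD[OF lim]) (use c z in simp)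
  then have "eventually (\<lambda>n. c \<le> v n) sequentially"
  proof eventually_elim
    case (elim n)
    have "(\<integral>\<^sup>+ s. ennreal (g n s) \<partial>lborel) < ennreal (c / (norm z)\<^sup>2)"
      by (rule le_less_trans[OF nn_integral_mono[OF g_le] elim])
    then have "enn2real (\<integral>\<^sup>+ s. ennreal (g n s) \<partial>lborel) \<le> c / (norm z)\<^sup>2"
      using c by (intro enn2real_leI) auto
    moreover have "integrable lborel (g n)"
      using ind_int v_int[of n] unfolding g_def set_integrable_def by simp
    then have "(LINT s|lborel. g n s) \<le> enn2real (\<integral>\<^sup>+ s. ennreal (g n s) \<partial>lborel)"
      by (simp add: real_lebesgue_integral_def)
    ultimately have "(m\<^sup>2 * (t - r) - 2 * v n) / (2 * (norm z)\<^sup>2) \<le> c / (norm z)\<^sup>2"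
      using g_integral by simp
    then have "(m\<^sup>2 * (t - r) - 2 * v n) / 2 / (norm z)\<^sup>2 \<le> c / (norm z)\<^sup>2" by (simp only: divide_divide_eq_left)
    then have "(m\<^sup>2 * (t - r) - 2 * v n) / 2 \<le> c"
      using z by (subst (asm) divide_le_cancel) auto
    moreover have "w / 4 \<le> u" if "(w - 2 * u) / 2 \<le> w / 4" for w u :: real using that by (simp add: field_simps)
    ultimately show ?case unfolding c_def by blast
  qed
  then show ?thesis using c unfolding v_def k_def by blast
qed

lemma wiener_integral_approximation:
  fixes W :: "real \<Rightarrow> 'h::{real_inner, banach, second_countable_topology} \<Rightarrow> 'w \<Rightarrow> real"
  assumes "is_wiener_integral M W t \<Phi> I"
  shows "\<exists>xs. (\<forall>n a b h u. (a, b, h, u) \<in> set (xs n) \<longrightarrow> 0 \<le> a \<and> a \<le> b \<and> b \<le> t) \<and>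
    (\<lambda>n. \<integral>\<^sup>+ s\<in>{0..t}. hs_norm_sq (step_integrand (xs n) s - \<Phi> s) \<partial>lborel) \<longlonglongrightarrow> 0 \<and>
    (\<lambda>n. \<integral>\<^sup>+ \<omega>. ennreal ((norm (step_integral W (xs n) \<omega> - I \<omega>))\<^sup>2) \<partial>M) \<longlonglongrightarrow> 0"
proof -
  from assms obtain xs :: "nat \<Rightarrow> (real \<times> real \<times> 'h \<times> 'h) list" where
    xs: "\<forall>n. \<forall>(a, b, h, u)\<in>set (xs n). 0 \<le> a \<and> a \<le> b \<and> b \<le> t"
    and lim: "(\<lambda>n. \<integral>\<^sup>+ s\<in>{0..t}. hs_norm_sq (step_integrand (xs n) s - \<Phi> s) \<partial>lborel) \<longlonglongrightarrow> 0"
    "(\<lambda>n. \<integral>\<^sup>+ \<omega>. ennreal ((norm (step_integral W (xs n) \<omega> - I \<omega>))\<^sup>2) \<partial>M) \<longlonglongrightarrow> 0"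
    unfolding is_wiener_integral_def by (elim conjE exE)
  have "0 \<le> a \<and> a \<le> b \<and> b \<le> t" if "(a, b, h, u) \<in> set (xs n)" for n a b h u
    using bspec[OF spec[OF xs, of n] that] by simp
  then have "\<forall>n a b h u. (a, b, h, u) \<in> set (xs n) \<longrightarrow> 0 \<le> a \<and> a \<le> b \<and> b \<le> t" by blast
  with lim show ?thesis by (intro exI[of _ xs] conjI)
qed

context prob_space
begin

context
  fixes Filt :: "real \<Rightarrow> 'a measure"
  assumes filtration: "usual_filtration M Filt"
begin

lemma filtration_subalgebra_M: "0 \<le> t \<Longrightarrow> subalgebra M (Filt t)"
  using filtration by (simp only: usual_filtration_def)

lemma filtration_space: "0 \<le> t \<Longrightarrow> space (Filt t) = space M"
  using filtration_subalgebra_M by (simp only: subalgebra_def)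

lemma filtration_subalgebra:
  assumes "0 \<le> s" "s \<le> t" shows "subalgebra (Filt t) (Filt s)"
proof -
  have "\<forall>s t. 0 \<le> s \<and> s \<le> t \<longrightarrow> sets (Filt s) \<subseteq> sets (Filt t)"
    using filtration unfolding usual_filtration_def by (elim conjE)
  then have "sets (Filt s) \<subseteq> sets (Filt t)" using assms by blast
  then show ?thesis using filtration_space[of s] filtration_space[of t] assms by (simp add: subalgebra_def)
qed

lemma filtration_null_sets:
  assumes "N \<in> null_sets M" "N' \<subseteq> N" "0 \<le> t" shows "N' \<in> sets (Filt t)"
proof -
  have "\<forall>N\<in>null_sets M. \<forall>N'\<subseteq>N. N' \<in> sets (Filt 0)"
    using filtration unfolding usual_filtration_def by (elim conjE)
  then have "N' \<in> sets (Filt 0)" using assms by blast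
  then show ?thesis using filtration_subalgebra[OF order_refl assms(3)] by (auto simp: subalgebra_def)
qed

text \<open>The filtration contains all subsets of null sets.\<close>

lemma measurable_filtration_cong_AE:
  fixes g f :: "'a \<Rightarrow> 'b::topological_space"
  assumes t: "0 \<le> t" and g: "g \<in> borel_measurable (Filt t)" and f: "f \<in> borel_measurable M"
    and eq: "AE \<omega> in M. f \<omega> = g \<omega>"
  shows "f \<in> borel_measurable (Filt t)"
proof (rule measurableI)
  obtain N where N: "N \<in> null_sets M" "{\<omega> \<in> space M. \<not> f \<omega> = g \<omega>} \<subseteq> N"
    using eq by (auto elim!: AE_E simp: null_sets_def)
  have small: "N' \<in> sets (Filt t)" if "N' \<subseteq> N" for N'
    by (rule filtration_null_sets[OF N(1) that t])
  fix B :: "'b set" assume B: "B \<in> sets borel"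
  have "f -` B \<inter> space (Filt t) = (g -` B \<inter> space (Filt t) - N) \<union> (f -` B \<inter> space (Filt t) \<inter> N)"
    using N(2) unfolding filtration_space[OF t] by auto
  also have "\<dots> \<in> sets (Filt t)"
    using measurable_sets[OF g B] small by (intro sets.Un sets.Diff) auto
  finally show "f -` B \<inter> space (Filt t) \<in> sets (Filt t)" .
qed simp

context
  fixes W :: "real \<Rightarrow> 'h::{real_inner, banach, second_countable_topology} \<Rightarrow> 'a \<Rightarrow> real"
  assumes wiener: "cylindrical_wiener M Filt W"
begin

lemma wiener_measurable_filtration:
  assumes "0 \<le> s" "s \<le> t" shows "W s k \<in> borel_measurable (Filt t)"
proof -
  have "W s k \<in> borel_measurable (Filt s)"
  proof -
    have "\<forall>h. adapted Filt (\<lambda>t. W t h)" using wiener unfolding cylindrical_wiener_def by (elim conjE)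
    then show ?thesis using assms(1) unfolding adapted_def by blast
  qed
  then show ?thesis using measurable_from_subalg[OF filtration_subalgebra[OF assms]] by blast
qed

lemma wiener_measurable: "0 \<le> s \<Longrightarrow> W s k \<in> borel_measurable M"
  using wiener_measurable_filtration[of s s k] measurable_from_subalg[OF filtration_subalgebra_M] by blast

lemma wiener_linear:
  assumes "0 \<le> t"
  shows "AE \<omega> in M. W t (a *\<^sub>R g + b *\<^sub>R h) \<omega> = a * W t g \<omega> + b * W t h \<omega>"
proof -
  have "\<forall>t\<ge>0. \<forall>a b g h. AE \<omega> in M. W t (a *\<^sub>R g + b *\<^sub>R h) \<omega> = a * W t g \<omega> + b * W t h \<omega>"
    using wiener unfolding cylindrical_wiener_def by (elim conjE)
  with assms show ?thesis by blast
qed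

lemma wiener_add: "0 \<le> t \<Longrightarrow> AE \<omega> in M. W t (g + h) \<omega> = W t g \<omega> + W t h \<omega>"
  using wiener_linear[of t 1 g 1 h] by simp

lemma wiener_scale: "0 \<le> t \<Longrightarrow> AE \<omega> in M. W t (a *\<^sub>R g) \<omega> = a * W t g \<omega>"
  using wiener_linear[of t a g 0 0] by simp

lemma wiener_zero: "0 \<le> t \<Longrightarrow> AE \<omega> in M. W t 0 \<omega> = 0"
  using wiener_linear[of t 0 0 0 0] by simp

lemma wiener_increment:
  assumes "0 \<le> s" "s < t" "k \<noteq> 0"
  shows "distributed M lborel (\<lambda>\<omega>. W t k \<omega> - W s k \<omega>) (\<lambda>r. ennreal (normal_density 0 (sqrt (t - s) * norm k) r))"
    and "indep_set (sets (Filt s)) {(\<lambda>\<omega>. W t k \<omega> - W s k \<omega>) -` B \<inter> space M | B. B \<in> sets borel}"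
proof -
  have "\<forall>s t h. 0 \<le> s \<and> s < t \<and> h \<noteq> 0 \<longrightarrow>
        distributed M lborel (\<lambda>\<omega>. W t h \<omega> - W s h \<omega>)
          (\<lambda>r. ennreal (normal_density 0 (sqrt (t - s) * norm h) r)) \<and>
        indep_set (sets (Filt s)) {(\<lambda>\<omega>. W t h \<omega> - W s h \<omega>) -` B \<inter> space M | B. B \<in> sets borel}"
    using wiener unfolding cylindrical_wiener_def by (elim conjE)
  with assms show "distributed M lborel (\<lambda>\<omega>. W t k \<omega> - W s k \<omega>) (\<lambda>r. ennreal (normal_density 0 (sqrt (t - s) * norm k) r))"
    and "indep_set (sets (Filt s)) {(\<lambda>\<omega>. W t k \<omega> - W s k \<omega>) -` B \<inter> space M | B. B \<in> sets borel}"
    by blast+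
qed

lemma truncated_integral_measurable:
  assumes "\<And>a b k. (a, b, k) \<in> set xs \<Longrightarrow> 0 \<le> a \<and> a \<le> b" and "0 \<le> \<tau>"
  shows "truncated_integral W xs \<tau> \<in> borel_measurable (Filt \<tau>)"
  using assms(1)
proof (induction xs)
  case Nil
  have "truncated_integral W [] \<tau> = (\<lambda>\<omega>. 0)" by (rule ext) simp
  then show ?case by simp
next
  case (Cons x xs)
  obtain a b k where x: "x = (a, b, k)" by (cases x)
  have ab: "0 \<le> a" "a \<le> b" using Cons.prems[of a b k] x by auto
  have "W (min b \<tau>) k \<in> borel_measurable (Filt \<tau>)" "W (min a \<tau>) k \<in> borel_measurable (Filt \<tau>)"
    using ab assms(2) by (auto intro!: wiener_measurable_filtration)
  moreover have "truncated_integral W xs \<tau> \<in> borel_measurable (Filt \<tau>)"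
    by (rule Cons.IH) (use Cons.prems in auto)
  moreover have "truncated_integral W (x # xs) \<tau>
      = (\<lambda>\<omega>. (W (min b \<tau>) k \<omega> - W (min a \<tau>) k \<omega>) + truncated_integral W xs \<tau> \<omega>)"
    unfolding x by (rule ext) simp
  ultimately show ?case by simp
qed

text \<open>Between \<open>\<tau>'\<close> and \<open>\<tau>\<close> there is no end point, so the step function is constant on
  \<open>(\<tau>', \<tau>]\<close> and the integral grows by the increment of \<open>W\<close> in that direction.\<close>

lemma truncated_integral_increment:
  assumes "\<And>a b k. (a, b, k) \<in> set xs \<Longrightarrow> 0 \<le> a \<and> a \<le> b \<and> (a \<le> \<tau>' \<or> \<tau> \<le> a) \<and> (b \<le> \<tau>' \<or> \<tau> \<le> b)"
    and \<tau>: "0 \<le> \<tau>'" "\<tau>' < \<tau>"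
  shows "AE \<omega> in M. truncated_integral W xs \<tau> \<omega>
    = truncated_integral W xs \<tau>' \<omega> + (W \<tau> (active_vector xs \<tau>) \<omega> - W \<tau>' (active_vector xs \<tau>) \<omega>)"
  using assms(1)
proof (induction xs)
  case Nil
  show ?case using wiener_zero[of \<tau>] wiener_zero[of \<tau>'] \<tau> by auto
next
  case (Cons x xs)
  obtain a b k where x: "x = (a, b, k)" by (cases x)
  have ab: "0 \<le> a" "a \<le> b" "a \<le> \<tau>' \<or> \<tau> \<le> a" "b \<le> \<tau>' \<or> \<tau> \<le> b" using Cons.prems[of a b k] x by auto
  have IH: "AE \<omega> in M. truncated_integral W xs \<tau> \<omega>
    = truncated_integral W xs \<tau>' \<omega> + (W \<tau> (active_vector xs \<tau>) \<omega> - W \<tau>' (active_vector xs \<tau>) \<omega>)"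
    by (rule Cons.IH) (use Cons.prems in auto)
  show ?case
  proof (cases "a < \<tau> \<and> \<tau> \<le> b")
    case True
    have "AE \<omega> in M. W \<tau> (k + active_vector xs \<tau>) \<omega> = W \<tau> k \<omega> + W \<tau> (active_vector xs \<tau>) \<omega>"
      "AE \<omega> in M. W \<tau>' (k + active_vector xs \<tau>) \<omega> = W \<tau>' k \<omega> + W \<tau>' (active_vector xs \<tau>) \<omega>"
      using \<tau> by (auto intro!: wiener_add)
    with IH show ?thesis
      by eventually_elim (use True ab \<tau> in \<open>simp add: x min_def\<close>)
  next
    case False
    from IH show ?thesis
      by eventually_elim (use False ab \<tau> in \<open>auto simp: x min_def\<close>)
  qed
qed

lemma truncated_integral_gaussian_0:
  assumes xs: "\<And>a b k. (a, b, k) \<in> set xs \<Longrightarrow> 0 \<le> a \<and> a \<le> b"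
  shows "centred_gaussian M (truncated_integral W xs 0) (LINT s:{0..0}|lborel. (norm (active_vector xs s))\<^sup>2)"
proof -
  have "truncated_integral W xs 0 \<omega> = 0" for \<omega>
    using xs
  proof (induction xs)
    case (Cons x xs)
    obtain a b k where x: "x = (a, b, k)" by (cases x)
    have "0 \<le> a" "a \<le> b" using Cons.prems[of a b k] x by auto
    moreover have "truncated_integral W xs 0 \<omega> = 0" by (rule Cons.IH) (use Cons.prems in auto)
    ultimately show ?case by (simp add: x min_absorb2)
  qed simp
  then have "truncated_integral W xs 0 = (\<lambda>\<omega>. 0)" by (rule ext)
  moreover have "(LINT s:{0..0}|lborel. (norm (active_vector xs s))\<^sup>2) = 0"
  proof -
    have "(LINT s:{0<..0}|lborel. (norm (active_vector xs s))\<^sup>2) = (LINT s:{0..0}|lborel. (norm (active_vector xs s))\<^sup>2)"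
      by (rule set_integral_Ioc_eq_Icc) measurable
    then show ?thesis by (simp only: set_lebesgue_integral_def) simp
  qed
  ultimately show ?thesis using centred_gaussian_zero by simp
qed

text \<open>Induction over the number of end points before \<open>\<tau>\<close>. Let \<open>\<tau>'\<close> be the last of them. The integral
  up to \<open>\<tau>'\<close> is measurable at time \<open>\<tau>'\<close> and hence independent of the increment over \<open>(\<tau>', \<tau>]\<close>, so
  the variances add up.\<close>

lemma truncated_integral_gaussian:
  assumes xs: "\<And>a b k. (a, b, k) \<in> set xs \<Longrightarrow> 0 \<le> a \<and> a \<le> b" and "0 \<le> \<tau>"
  shows "centred_gaussian M (truncated_integral W xs \<tau>) (LINT s:{0..\<tau>}|lborel. (norm (active_vector xs s))\<^sup>2)"
  using assms(2)
proof (induction "card {e \<in> (\<Union>(a, b, k)\<in>set xs. {a, b}). 0 < e \<and> e < \<tau>}" arbitrary: \<tau> rule: less_induct)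
  case less
  define E where "E = (\<Union>(a, b, k)\<in>set xs. {a, b})"
  have E_fin: "finite E" unfolding E_def by (rule finite_UN_I) auto
  have E_I: "a \<in> E" "b \<in> E" if "(a, b, k) \<in> set xs" for a b k unfolding E_def using that by force+
  have f_meas: "(\<lambda>s. (norm (active_vector xs s))\<^sup>2) \<in> borel_measurable borel" by measurable
  obtain K where K: "\<And>s. norm (active_vector xs s) \<le> K" using active_vector_bounded by blast
  have f_int: "set_integrable lborel {a..b} (\<lambda>s. (norm (active_vector xs s))\<^sup>2)" for a b
    by (rule set_integrable_bounded_Icc[where K = "K\<^sup>2", OF f_meas]) (simp add: K power_mono)
  show ?case
  proof (cases "\<tau> = 0")
    case True
    then show ?thesis using truncated_integral_gaussian_0[of xs] xs by blast
  next
    case False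
    then have \<tau>: "0 < \<tau>" using less.prems by simp
    define E' where "E' = insert 0 {e \<in> E. 0 < e \<and> e < \<tau>}"
    \<comment> \<open>the last end point before \<open>\<tau>\<close>, or 0\<close>
    define \<tau>' where "\<tau>' = Max E'"
    have E'_fin: "finite E'" "E' \<noteq> {}" using E_fin by (auto simp: E'_def)
    have \<tau>'_in: "\<tau>' \<in> E'" unfolding \<tau>'_def using E'_fin by (rule Max_in)
    have \<tau>': "0 \<le> \<tau>'" "\<tau>' < \<tau>" using \<tau>'_in \<tau> by (auto simp: E'_def)
    have gap: "e \<le> \<tau>' \<or> \<tau> \<le> e" if "e \<in> E" for e
    proof (cases "0 < e \<and> e < \<tau>")
      case True
      then have "e \<in> E'" using that by (simp add: E'_def)
      then show ?thesis unfolding \<tau>'_def using E'_fin by simp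
    next
      case False
      then show ?thesis using \<tau>' by auto
    qed
    have prev: "centred_gaussian M (truncated_integral W xs \<tau>') (LINT s:{0..\<tau>'}|lborel. (norm (active_vector xs s))\<^sup>2)"
    proof (cases "\<tau>' = 0")
      case True
      then show ?thesis using truncated_integral_gaussian_0[of xs] xs by blast
    next
      case False
      then have "\<tau>' \<in> {e \<in> E. 0 < e \<and> e < \<tau>}" using \<tau>'_in by (simp add: E'_def)
      then have "{e \<in> E. 0 < e \<and> e < \<tau>'} \<subset> {e \<in> E. 0 < e \<and> e < \<tau>}" using \<tau>' by auto
      then have "card {e \<in> E. 0 < e \<and> e < \<tau>'} < card {e \<in> E. 0 < e \<and> e < \<tau>}"
        using E_fin by (intro psubset_card_mono) auto
      then show ?thesis unfolding E_def using \<tau>'(1) by (rule less.hyps)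
    qed
    define k where "k = active_vector xs \<tau>"
    have const: "active_vector xs s = k" if "s \<in> {\<tau>'<..\<tau>}" for s
    proof -
      have "active_vector ys s = active_vector ys \<tau>" if "set ys \<subseteq> set xs" for ys
        using that
      proof (induction ys)
        case (Cons y ys)
        obtain a b l where y: "y = (a, b, l)" by (cases y)
        have "a \<le> \<tau>' \<or> \<tau> \<le> a" "b \<le> \<tau>' \<or> \<tau> \<le> b"
          using gap E_I[of a b l] Cons.prems y by auto
        then have "(a < s \<and> s \<le> b) = (a < \<tau> \<and> \<tau> \<le> b)" using \<open>s \<in> {\<tau>'<..\<tau>}\<close> by auto
        moreover have "active_vector ys s = active_vector ys \<tau>" using Cons by simp
        ultimately show ?case unfolding y active_vector_Cons by simp
      qed simp
      then show ?thesis by (simp add: k_def)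
    qed
    have var: "(LINT s:{0..\<tau>}|lborel. (norm (active_vector xs s))\<^sup>2)
        = (LINT s:{0..\<tau>'}|lborel. (norm (active_vector xs s))\<^sup>2) + (\<tau> - \<tau>') * (norm k)\<^sup>2"
    proof -
      have "(LINT s:{\<tau>'..\<tau>}|lborel. (norm (active_vector xs s))\<^sup>2) = (LINT s:{\<tau>'<..\<tau>}|lborel. (norm (active_vector xs s))\<^sup>2)"
        by (rule set_integral_Ioc_eq_Icc[OF f_meas, symmetric])
      also have "\<dots> = (LINT s:{\<tau>'<..\<tau>}|lborel. (norm k)\<^sup>2)"
        by (rule set_lebesgue_integral_cong) (auto simp: const)
      also have "\<dots> = (\<tau> - \<tau>') * (norm k)\<^sup>2" using \<tau>' by (simp add: set_lebesgue_integral_def)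
      finally show ?thesis using set_integral_Icc_split[OF f_meas f_int, of 0 \<tau>' \<tau>] \<tau>' by simp
    qed
    have incr: "AE \<omega> in M. truncated_integral W xs \<tau> \<omega> = truncated_integral W xs \<tau>' \<omega> + (W \<tau> k \<omega> - W \<tau>' k \<omega>)"
      unfolding k_def
      by (rule truncated_integral_increment[OF _ \<tau>']) (use xs gap E_I in blast)
    have meas_filt: "truncated_integral W xs r \<in> borel_measurable (Filt r)" if "0 \<le> r" for r
      by (rule truncated_integral_measurable[OF _ that]) (rule xs)
    have meas: "truncated_integral W xs \<tau> \<in> borel_measurable M"
      by (rule measurable_from_subalg[OF filtration_subalgebra_M meas_filt]) (rule less.prems)+
    show ?thesis
    proof (cases "k = 0")
      case True
      have "AE \<omega> in M. truncated_integral W xs \<tau>' \<omega> = truncated_integral W xs \<tau> \<omega>"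
        using incr wiener_zero[OF less.prems] wiener_zero[OF \<tau>'(1)]
        by eventually_elim (simp add: True)
      from centred_gaussian_cong_AE[OF prev meas this] show ?thesis using var True by simp
    next
      case False
      have "centred_gaussian M (\<lambda>\<omega>. W \<tau> k \<omega> - W \<tau>' k \<omega>) ((sqrt (\<tau> - \<tau>') * norm k)\<^sup>2)"
        by (rule centred_gaussian_normal[OF wiener_increment(1)[OF \<tau>' False]]) (use False \<tau>' in simp)
      from centred_gaussian_add[OF prev this meas_filt[OF \<tau>'(1)] filtration_space[OF \<tau>'(1)]
          wiener_increment(2)[OF \<tau>' False]]
      have "centred_gaussian M (\<lambda>\<omega>. truncated_integral W xs \<tau>' \<omega> + (W \<tau> k \<omega> - W \<tau>' k \<omega>))
        ((LINT s:{0..\<tau>}|lborel. (norm (active_vector xs s))\<^sup>2))"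
        using var \<tau>' by (simp add: power_mult_distrib)
      moreover have "AE \<omega> in M. truncated_integral W xs \<tau>' \<omega> + (W \<tau> k \<omega> - W \<tau>' k \<omega>) = truncated_integral W xs \<tau> \<omega>"
        using incr by eventually_elim (rule sym)
      ultimately show ?thesis by (intro centred_gaussian_cong_AE[OF _ meas])
    qed
  qed
qed

lemma component_step_integral:
  assumes "\<And>a b h u. (a, b, h, u) \<in> set xs \<Longrightarrow> 0 \<le> a \<and> a \<le> b \<and> b \<le> t"
  shows "AE \<omega> in M. truncated_integral W (component z xs) t \<omega> = inner z (step_integral W xs \<omega>)"
  using assms
proof (induction xs)
  case Nil
  then show ?case by (simp add: component_def step_integral_def)
next
  case (Cons x xs)
  obtain a b h u where x: "x = (a, b, h, u)" by (cases x)
  have ab: "0 \<le> a" "a \<le> b" "b \<le> t" using Cons.prems[of a b h u] x by auto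
  have "AE \<omega> in M. truncated_integral W (component z xs) t \<omega> = inner z (step_integral W xs \<omega>)"
    by (rule Cons.IH) (use Cons.prems in auto)
  moreover have "AE \<omega> in M. W b (inner z u *\<^sub>R h) \<omega> = inner z u * W b h \<omega>"
    "AE \<omega> in M. W a (inner z u *\<^sub>R h) \<omega> = inner z u * W a h \<omega>"
    using ab by (auto intro!: wiener_scale)
  ultimately show ?case
    by eventually_elim
      (use ab in \<open>simp add: x component_def step_integral_def min_absorb1 inner_add_right algebra_simps\<close>)
qed

lemma step_integral_measurable:
  assumes "\<And>a b h u. (a, b, h, u) \<in> set xs \<Longrightarrow> 0 \<le> a \<and> a \<le> b \<and> b \<le> t"
  shows "step_integral W xs \<in> borel_measurable (Filt t)"
  using assms
proof (induction xs)
  case Nil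
  have "step_integral W [] = (\<lambda>\<omega>. 0)" by (rule ext) (simp add: step_integral_def)
  then show ?case by simp
next
  case (Cons x xs)
  obtain a b h u where x: "x = (a, b, h, u)" by (cases x)
  have ab: "0 \<le> a" "a \<le> b" "b \<le> t" using Cons.prems[of a b h u] x by auto
  then have "W b h \<in> borel_measurable (Filt t)" "W a h \<in> borel_measurable (Filt t)"
    by (auto intro!: wiener_measurable_filtration)
  moreover have "step_integral W xs \<in> borel_measurable (Filt t)"
    by (rule Cons.IH) (use Cons.prems in auto)
  moreover have "step_integral W (x # xs) = (\<lambda>\<omega>. (W b h \<omega> - W a h \<omega>) *\<^sub>R u + step_integral W xs \<omega>)"
    unfolding x by (rule ext) (simp add: step_integral_def)
  ultimately show ?case by simp
qed

text \<open>The \<open>z\<close>-components of the approximating step integrals are centred Gaussian with variances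
  bounded below, and they converge in mean square.\<close>

lemma wiener_integral_nondegenerate:
  assumes I: "is_wiener_integral M W t \<Phi> I" and t: "0 < t" and y: "norm y \<le> 1"
    and \<phi>_cont: "continuous_on UNIV \<phi>" and \<phi>: "\<And>s. s \<in> {0..t} \<Longrightarrow> \<phi> s = inner z (\<Phi> s y)" and pos: "0 < \<phi> t"
  shows "AE \<omega> in M. inner z (I \<omega>) \<noteq> 0" "\<not> (AE \<omega> in M. inner z (I \<omega>) \<le> c)"
proof -
  obtain xs :: "nat \<Rightarrow> (real \<times> real \<times> 'h \<times> 'h) list" where
    xs': "\<forall>n a b h u. (a, b, h, u) \<in> set (xs n) \<longrightarrow> 0 \<le> a \<and> a \<le> b \<and> b \<le> t"
    and int_lim: "(\<lambda>n. \<integral>\<^sup>+ s\<in>{0..t}. hs_norm_sq (step_integrand (xs n) s - \<Phi> s) \<partial>lborel) \<longlonglongrightarrow> 0"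
    and lim: "(\<lambda>n. \<integral>\<^sup>+ \<omega>. ennreal ((norm (step_integral W (xs n) \<omega> - I \<omega>))\<^sup>2) \<partial>M) \<longlonglongrightarrow> 0"
    using wiener_integral_approximation[OF I] by (elim exE conjE)
  have xs: "0 \<le> a \<and> a \<le> b \<and> b \<le> t" if "(a, b, h, u) \<in> set (xs n)" for n a b h u
    using xs' that by blast
  have I_meas [measurable]: "I \<in> borel_measurable M" using I by (simp add: is_wiener_integral_def)
  have step_meas [measurable]: "step_integral W (xs n) \<in> borel_measurable M" for n
    by (rule measurable_from_subalg[OF filtration_subalgebra_M[OF less_imp_le[OF t]] step_integral_measurable[OF xs]])
  define v where "v n = (LINT s:{0..t}|lborel. (norm (active_vector (component z (xs n)) s))\<^sup>2)" for n
  obtain c0 where c0: "0 < c0" and v_ev: "eventually (\<lambda>n. c0 \<le> v n) sequentially"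
    using step_variance_bounded_below[OF int_lim t y \<phi>_cont \<phi> pos] unfolding v_def by blast
  have gauss: "centred_gaussian M (\<lambda>\<omega>. inner z (step_integral W (xs n) \<omega>)) (v n)" for n
  proof (rule centred_gaussian_cong_AE)
    have "0 \<le> a \<and> a \<le> b" if "(a, b, k) \<in> set (component z (xs n))" for a b k
      using that xs[of a b _ _ n] by (auto simp: component_def)
    then show "centred_gaussian M (truncated_integral W (component z (xs n)) t) (v n)"
      unfolding v_def using t by (intro truncated_integral_gaussian) auto
    show "AE \<omega> in M. truncated_integral W (component z (xs n)) t \<omega> = inner z (step_integral W (xs n) \<omega>)"
      by (rule component_step_integral[OF xs])
  qed measurable
  have L2: "(\<lambda>n. \<integral>\<^sup>+ \<omega>. ennreal ((inner z (step_integral W (xs n) \<omega>) - inner z (I \<omega>))\<^sup>2) \<partial>M) \<longlonglongrightarrow> 0"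
  proof (rule tendsto_sandwich[OF always_eventually always_eventually tendsto_const])
    show "\<forall>n. (\<integral>\<^sup>+ \<omega>. ennreal ((inner z (step_integral W (xs n) \<omega>) - inner z (I \<omega>))\<^sup>2) \<partial>M)
        \<le> ennreal ((norm z)\<^sup>2) * (\<integral>\<^sup>+ \<omega>. ennreal ((norm (step_integral W (xs n) \<omega> - I \<omega>))\<^sup>2) \<partial>M)"
    proof
      fix n
      have "(\<integral>\<^sup>+ \<omega>. ennreal ((inner z (step_integral W (xs n) \<omega>) - inner z (I \<omega>))\<^sup>2) \<partial>M)
        \<le> (\<integral>\<^sup>+ \<omega>. ennreal ((norm z)\<^sup>2) * ennreal ((norm (step_integral W (xs n) \<omega> - I \<omega>))\<^sup>2) \<partial>M)"
      proof (rule nn_integral_mono)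
        fix \<omega>
        have "\<bar>inner z (step_integral W (xs n) \<omega> - I \<omega>)\<bar> \<le> norm z * norm (step_integral W (xs n) \<omega> - I \<omega>)"
          by (rule Cauchy_Schwarz_ineq2)
        from power_mono[OF this, of 2]
        have "(inner z (step_integral W (xs n) \<omega>) - inner z (I \<omega>))\<^sup>2 \<le> (norm z)\<^sup>2 * (norm (step_integral W (xs n) \<omega> - I \<omega>))\<^sup>2"
          by (simp add: power_mult_distrib inner_diff_right)
        then show "ennreal ((inner z (step_integral W (xs n) \<omega>) - inner z (I \<omega>))\<^sup>2)
          \<le> ennreal ((norm z)\<^sup>2) * ennreal ((norm (step_integral W (xs n) \<omega> - I \<omega>))\<^sup>2)"
          by (simp add: ennreal_mult'[symmetric] ennreal_leI)
      qed
      also have "\<dots> = ennreal ((norm z)\<^sup>2) * (\<integral>\<^sup>+ \<omega>. ennreal ((norm (step_integral W (xs n) \<omega> - I \<omega>))\<^sup>2) \<partial>M)"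
        by (rule nn_integral_cmult) measurable
      finally show "(\<integral>\<^sup>+ \<omega>. ennreal ((inner z (step_integral W (xs n) \<omega>) - inner z (I \<omega>))\<^sup>2) \<partial>M)
        \<le> ennreal ((norm z)\<^sup>2) * (\<integral>\<^sup>+ \<omega>. ennreal ((norm (step_integral W (xs n) \<omega> - I \<omega>))\<^sup>2) \<partial>M)" .
    qed
    have "(\<lambda>n. ennreal ((norm z)\<^sup>2) * (\<integral>\<^sup>+ \<omega>. ennreal ((norm (step_integral W (xs n) \<omega> - I \<omega>))\<^sup>2) \<partial>M))
        \<longlonglongrightarrow> ennreal ((norm z)\<^sup>2) * 0"
      by (intro ennreal_tendsto_cmult lim) simp
    then show "(\<lambda>n. ennreal ((norm z)\<^sup>2) * (\<integral>\<^sup>+ \<omega>. ennreal ((norm (step_integral W (xs n) \<omega> - I \<omega>))\<^sup>2) \<partial>M))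
        \<longlonglongrightarrow> 0" by simp
  qed auto
  have Y_meas: "(\<lambda>\<omega>. inner z (I \<omega>)) \<in> borel_measurable M" by measurable
  show "AE \<omega> in M. inner z (I \<omega>) \<noteq> 0" "\<not> (AE \<omega> in M. inner z (I \<omega>) \<le> c)"
    by (rule L2_limit_of_gaussians_nondegenerate[OF gauss c0 v_ev Y_meas L2])+
qed

text \<open>Along a subsequence the step integrals converge almost surely, and they are measurable at time
  \<open>t\<close>.\<close>

lemma wiener_integral_measurable_filtration:
  assumes I: "is_wiener_integral M W t \<Phi> I" and t: "0 \<le> t"
  shows "I \<in> borel_measurable (Filt t)"
proof -
  obtain xs :: "nat \<Rightarrow> (real \<times> real \<times> 'h \<times> 'h) list" where
    xs': "\<forall>n a b h u. (a, b, h, u) \<in> set (xs n) \<longrightarrow> 0 \<le> a \<and> a \<le> b \<and> b \<le> t"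
    and "(\<lambda>n. \<integral>\<^sup>+ s\<in>{0..t}. hs_norm_sq (step_integrand (xs n) s - \<Phi> s) \<partial>lborel) \<longlonglongrightarrow> 0"
    and lim: "(\<lambda>n. \<integral>\<^sup>+ \<omega>. ennreal ((norm (step_integral W (xs n) \<omega> - I \<omega>))\<^sup>2) \<partial>M) \<longlonglongrightarrow> 0"
    using wiener_integral_approximation[OF I] by (elim exE conjE)
  have xs: "0 \<le> a \<and> a \<le> b \<and> b \<le> t" if "(a, b, h, u) \<in> set (xs n)" for n a b h u
    using xs' that by blast
  have I_meas [measurable]: "I \<in> borel_measurable M" using I by (simp add: is_wiener_integral_def)
  have step: "step_integral W (xs n) \<in> borel_measurable (Filt t)" for n
    by (rule step_integral_measurable[OF xs])
  then have step_M [measurable]: "step_integral W (xs n) \<in> borel_measurable M" for n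
    using measurable_from_subalg[OF filtration_subalgebra_M[OF t]] by blast
  define u where "u n \<omega> = (norm (step_integral W (xs n) \<omega> - I \<omega>))\<^sup>2" for n \<omega>
  have u_meas [measurable]: "u n \<in> borel_measurable M" for n unfolding u_def by measurable
  have lim_u: "(\<lambda>n. \<integral>\<^sup>+ \<omega>. ennreal (u n \<omega>) \<partial>M) \<longlonglongrightarrow> 0" using lim by (simp add: u_def)
  then have "eventually (\<lambda>n. (\<integral>\<^sup>+ \<omega>. ennreal (u n \<omega>) \<partial>M) < 1) sequentially"
    by (rule order_tendstoD) simp
  then obtain N where N: "\<And>n. n \<ge> N \<Longrightarrow> (\<integral>\<^sup>+ \<omega>. ennreal (u n \<omega>) \<partial>M) < 1"
    unfolding eventually_sequentially by blast
  have u_int: "integrable M (u (n + N))" for n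
    by (rule integrableI_bounded) (use N[of "n + N"] in \<open>auto simp: u_def intro: less_trans\<close>)
  have "(\<integral>\<^sup>+ \<omega>. ennreal (u (n + N) \<omega>) \<partial>M) = ennreal (\<integral>\<omega>. u (n + N) \<omega> \<partial>M)" for n
    by (rule nn_integral_eq_integral[OF u_int]) (simp add: u_def)
  then have "(\<lambda>n. ennreal (\<integral>\<omega>. u (n + N) \<omega> \<partial>M)) \<longlonglongrightarrow> ennreal 0"
    using LIMSEQ_ignore_initial_segment[OF lim_u, of N] by (simp only: ennreal_0)
  moreover have u_nonneg: "0 \<le> u n \<omega>" for n \<omega> by (simp add: u_def)
  ultimately have "(\<lambda>n. \<integral>\<omega>. u (n + N) \<omega> \<partial>M) \<longlonglongrightarrow> 0"
    by (subst (asm) tendsto_ennreal_iff) auto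
  moreover have "norm (u n \<omega>) = u n \<omega>" for n \<omega> using u_nonneg by simp
  ultimately have "(\<lambda>n. \<integral>\<omega>. norm (u (n + N) \<omega>) \<partial>M) \<longlonglongrightarrow> 0" by (simp only:)
  from tendsto_L1_AE_subseq[OF u_int this]
  obtain r :: "nat \<Rightarrow> nat" where r: "AE \<omega> in M. (\<lambda>n. u (r n + N) \<omega>) \<longlonglongrightarrow> 0" by blast
  define g where "g \<omega> = lim (\<lambda>n. step_integral W (xs (r n + N)) \<omega>)" for \<omega>
  have g: "g \<in> borel_measurable (Filt t)"
    unfolding g_def by (rule borel_measurable_lim_metric) (rule step)
  have "AE \<omega> in M. I \<omega> = g \<omega>"
    using r
  proof eventually_elim
    case (elim \<omega>)
    then have "(\<lambda>n. sqrt (u (r n + N) \<omega>)) \<longlonglongrightarrow> sqrt 0" by (intro tendsto_intros)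
    then have "(\<lambda>n. norm (step_integral W (xs (r n + N)) \<omega> - I \<omega>)) \<longlonglongrightarrow> 0" by (simp add: u_def)
    then have "(\<lambda>n. step_integral W (xs (r n + N)) \<omega>) \<longlonglongrightarrow> I \<omega>"
      using LIM_zero_iff tendsto_norm_zero_iff by blast
    then show ?case unfolding g_def by (rule limI[symmetric])
  qed
  from measurable_filtration_cong_AE[OF t g I_meas this] show ?thesis .
qed

end

end

end

section \<open>Convergence of the approximating equations\<close>

lemma psi_norm_le_1: "norm (psi h) \<le> 1"
  by (simp add: psi_def pos_divide_le_eq add_pos_nonneg)

lemma continuous_psi: "continuous_on UNIV psi"
  unfolding psi_def by (intro continuous_intros) (smt (verit) norm_ge_zero)

text \<open>The map \<^const>\<open>psi\<close> is continuous and bounded by 1, so on sets of finite measure dominated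
  convergence applies to the products with a square integrable function.\<close>

lemma pseudo_weak_of_pointwise:
  fixes f :: "nat \<Rightarrow> 's \<Rightarrow> 'h::{real_inner, banach, second_countable_topology}"
  assumes f [measurable]: "\<And>n. f n \<in> borel_measurable N" and g [measurable]: "g \<in> borel_measurable N"
    and lim: "\<And>z. z \<in> space N \<Longrightarrow> (\<lambda>n. f n z) \<longlonglongrightarrow> g z"
  shows "pseudo_weakly_converges N f g"
  unfolding pseudo_weakly_converges_def
proof (intro conjI allI ballI impI f g)
  fix B assume B [measurable]: "B \<in> sets N" and fin: "emeasure N B < \<infinity>"
  let ?\<nu> = "density N (indicator B)"
  have psi_meas [measurable]: "psi \<in> borel_measurable (borel :: 'h measure)"
    by (rule borel_measurable_continuous_onI[OF continuous_psi])
  have "emeasure ?\<nu> (space ?\<nu>) = emeasure N B"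
    by (simp add: emeasure_density)
  then interpret finite_measure ?\<nu> using fin by (intro finite_measureI) auto
  have psi_L2: "(\<lambda>z. psi (u z)) \<in> L2 ?\<nu>" if u: "u \<in> borel_measurable N" for u :: "'s \<Rightarrow> 'h"
    unfolding L2_def
  proof (intro CollectI conjI)
    have [measurable]: "(\<lambda>z. psi (u z)) \<in> borel_measurable N" by (rule measurable_compose[OF u psi_meas])
    then show "(\<lambda>z. psi (u z)) \<in> borel_measurable ?\<nu>" by simp
    show "integrable ?\<nu> (\<lambda>z. (norm (psi (u z)))\<^sup>2)"
    proof (rule integrable_const_bound[where B = 1])
      show "AE z in ?\<nu>. norm ((norm (psi (u z)))\<^sup>2) \<le> 1" by (simp add: psi_norm_le_1 power_le_one)
    qed measurable
  qed
  have [measurable]: "(\<lambda>z. psi (f n z)) \<in> borel_measurable N" "(\<lambda>z. psi (g z)) \<in> borel_measurable N" for n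
    by (rule measurable_compose[OF f psi_meas] measurable_compose[OF g psi_meas])+
  show "weakly_converges_L2 ?\<nu> (\<lambda>n z. psi (f n z)) (\<lambda>z. psi (g z))"
    unfolding weakly_converges_L2_def
  proof (intro conjI allI ballI psi_L2 f g)
    fix k :: "'s \<Rightarrow> 'h" assume "k \<in> L2 ?\<nu>"
    then have k_meas [measurable]: "k \<in> borel_measurable N" and k_int: "integrable ?\<nu> (\<lambda>z. (norm (k z))\<^sup>2)"
      by (auto simp: L2_def)
    show "(\<lambda>n. \<integral>z. inner (psi (f n z)) (k z) \<partial>?\<nu>) \<longlonglongrightarrow> (\<integral>z. inner (psi (g z)) (k z) \<partial>?\<nu>)"
    proof (rule integral_dominated_convergence)
      show "integrable ?\<nu> (\<lambda>z. 1 + (norm (k z))\<^sup>2)"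
        by (intro Bochner_Integration.integrable_add k_int integrable_const)
      show "AE z in ?\<nu>. (\<lambda>n. inner (psi (f n z)) (k z)) \<longlonglongrightarrow> inner (psi (g z)) (k z)"
      proof (rule AE_I2)
        fix z assume "z \<in> space ?\<nu>"
        then have "(\<lambda>n. psi (f n z)) \<longlonglongrightarrow> psi (g z)"
          by (intro isCont_tendsto_compose[OF _ lim]) (use continuous_psi in \<open>auto simp: continuous_on_eq_continuous_at\<close>)
        then show "(\<lambda>n. inner (psi (f n z)) (k z)) \<longlonglongrightarrow> inner (psi (g z)) (k z)" by (intro tendsto_intros)
      qed
      show "AE z in ?\<nu>. norm (inner (psi (f n z)) (k z)) \<le> 1 + (norm (k z))\<^sup>2" for n
      proof (rule AE_I2)
        fix z
        have "norm (inner (psi (f n z)) (k z)) \<le> norm (psi (f n z)) * norm (k z)"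
          by (simp add: Cauchy_Schwarz_ineq2)
        also have "\<dots> \<le> 1 * norm (k z)" by (intro mult_right_mono psi_norm_le_1) simp
        also have "\<dots> \<le> 1 + (norm (k z))\<^sup>2"
        proof -
          have "2 * norm (k z) \<le> 1 + (norm (k z))\<^sup>2"
            using zero_le_power2[of "norm (k z) - 1"] by (simp add: power2_diff)
          then show ?thesis using norm_ge_zero[of "k z"] by linarith
        qed
        finally show "norm (inner (psi (f n z)) (k z)) \<le> 1 + (norm (k z))\<^sup>2" .
      qed
    qed measurable
  qed
qed

lemma AE_pair_snd:
  assumes "sigma_finite_measure M" "AE \<omega> in M. R \<omega>"
  shows "AE p in A \<Otimes>\<^sub>M M. R (snd p)"
proof -
  interpret sigma_finite_measure M by fact
  obtain N where N: "{\<omega> \<in> space M. \<not> R \<omega>} \<subseteq> N" "emeasure M N = 0" "N \<in> sets M"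
    using assms(2) by (rule AE_E)
  have "space A \<times> N \<in> null_sets (A \<Otimes>\<^sub>M M)"
    using N by (auto simp: null_sets_def emeasure_pair_measure_Times)
  then show ?thesis
    by (rule AE_I') (use N(1) in \<open>auto simp: space_pair_measure\<close>)
qed

text \<open>The equation with \<open>D\<^sub>F = UNIV\<close>. Only the decay of the semigroup is kept from its generator,
  and of the stochastic convolution only that it is adapted with continuous paths.\<close>

locale whole_space_equation = prob_space M
  for M :: "'w measure" +
  fixes Filt :: "real \<Rightarrow> 'w measure"
    and S :: "real \<Rightarrow> 'h::{real_inner, banach, second_countable_topology} \<Rightarrow>\<^sub>L 'h"
    and \<beta> :: real and V :: "real \<Rightarrow> 'w \<Rightarrow> 'h" and F :: "real \<Rightarrow> 'h \<Rightarrow> 'h set" and x :: 'h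
  assumes Filt: "\<And>t. t \<ge> 0 \<Longrightarrow> subalgebra M (Filt t)"
    and Filt_mono: "\<And>s t. 0 \<le> s \<Longrightarrow> s \<le> t \<Longrightarrow> subalgebra (Filt t) (Filt s)"
    and sg: "c0_semigroup S"
    and decay: "\<And>t y. t \<ge> 0 \<Longrightarrow> norm (S t y) \<le> exp (- \<beta> * t) * norm y"
    and \<beta>: "\<beta> > 0"
    and V_adapted: "\<And>t. t \<ge> 0 \<Longrightarrow> V t \<in> borel_measurable (Filt t)"
    and V_cont: "\<And>\<omega>. \<omega> \<in> space M \<Longrightarrow> continuous_on {0..} (\<lambda>t. V t \<omega>)"
    and mdis: "\<And>t. t \<ge> 0 \<Longrightarrow> m_dissipative UNIV (F t)"
    and nonempty: "\<And>t y. t \<ge> 0 \<Longrightarrow> F t y \<noteq> {}"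
    and yosida_meas: "\<And>\<alpha>. \<alpha> > 0 \<Longrightarrow> (\<lambda>(t, y). yosida UNIV (F t) \<alpha> y)
      \<in> borel_measurable (restrict_space borel ({0..} \<times> UNIV))"
    and growth: "\<And>r. r > 0 \<Longrightarrow> growth_bound UNIV F r < \<infinity>"
begin

definition P where "P t = S (max 0 t)"

text \<open>By the decay assumption the rescaled semigroup is still a contraction. The energy inequality for
  this flow carries the exponential weights that appear in the final estimate.\<close>

definition P\<beta> where "P\<beta> t = exp (\<beta> * max 0 t) *\<^sub>R S (max 0 t)"

lemma semigroup_contraction: "t \<ge> 0 \<Longrightarrow> norm (S t y) \<le> norm y"
  using order_trans[OF decay mult_right_mono[of "exp (- \<beta> * t)" 1 "norm y"]] \<beta> by simp

lemma P_continuous: "continuous_on UNIV (\<lambda>p. P (fst p) (snd p))"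
  unfolding P_def by (rule contraction_semigroup_jointly_continuous[OF sg semigroup_contraction])

sublocale P: contraction_flow P
proof
  show "P 0 y = y" for y by (simp add: P_def semigroup_0[OF sg])
  show "P (s + t) y = P s (P t y)" if "0 \<le> s" "0 \<le> t" for s t y
    using that by (simp add: P_def max_def semigroup_add[OF sg])
  show "norm (P t y) \<le> norm y" for t y by (simp add: P_def semigroup_contraction)
qed (rule P_continuous)

sublocale P\<beta>: contraction_flow P\<beta>
proof
  show "P\<beta> 0 y = y" for y by (simp add: P\<beta>_def semigroup_0[OF sg])
  show "P\<beta> (s + t) y = P\<beta> s (P\<beta> t y)" if "0 \<le> s" "0 \<le> t" for s t y
    using that by (simp add: P\<beta>_def max_absorb2 semigroup_add[OF sg] blinfun.scaleR_left blinfun.scaleR_right distrib_left exp_add)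
  show "norm (P\<beta> t y) \<le> norm y" for t y
  proof -
    have "norm (P\<beta> t y) \<le> exp (\<beta> * max 0 t) * (exp (- \<beta> * max 0 t) * norm y)"
      unfolding P\<beta>_def using decay[of "max 0 t" y] by (simp add: blinfun.scaleR_left)
    also have "\<dots> = norm y" by (simp add: exp_minus field_simps)
    finally show ?thesis .
  qed
  have "continuous_on UNIV (\<lambda>p. exp (\<beta> * max 0 (fst p)) *\<^sub>R P (fst p) (snd p))"
    by (intro continuous_on_scaleR P_continuous continuous_intros)
  then show "continuous_on UNIV (\<lambda>p. P\<beta> (fst p) (snd p))" by (simp add: P\<beta>_def P_def blinfun.scaleR_left)
qed

definition G :: "real \<Rightarrow> real \<Rightarrow> 'h \<Rightarrow> 'h" where "G \<alpha> t = yosida UNIV (F (max 0 t)) \<alpha>"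

definition v :: "'w \<Rightarrow> real \<Rightarrow> 'h" where "v \<omega> t = V (max 0 t) \<omega>"

lemma v_cont: "\<omega> \<in> space M \<Longrightarrow> continuous_on UNIV (v \<omega>)"
  unfolding v_def by (rule continuous_on_compose2[OF V_cont]) (auto intro!: continuous_intros)

lemma G_meas:
  assumes "\<alpha> > 0"
  shows "(\<lambda>p. G \<alpha> (fst p) (snd p)) \<in> borel_measurable borel"
proof -
  have [measurable]: "(\<lambda>p::real \<times> 'h. (max 0 (fst p), snd p)) \<in> borel_measurable borel"
    by (intro borel_measurable_continuous_onI continuous_intros)
  have "(\<lambda>p::real \<times> 'h. (max 0 (fst p), snd p)) \<in> measurable borel (restrict_space borel ({0..} \<times> UNIV))"
    by (rule measurable_restrict_space2) auto
  note comp = measurable_compose[OF this yosida_meas[OF assms]]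
  have "(\<lambda>p. G \<alpha> (fst p) (snd p)) = (\<lambda>p. (\<lambda>(t, y). yosida UNIV (F t) \<alpha> y) (max 0 (fst p), snd p))"
    by (simp add: G_def)
  then show ?thesis using comp by (simp only:)
qed

lemma G_lipschitz: "\<alpha> > 0 \<Longrightarrow> norm (G \<alpha> s y - G \<alpha> s y') \<le> (1 / \<alpha>) * norm (y - y')"
  unfolding G_def by (rule yosida_lipschitz[OF mdis]) auto

lemma minimal_section_le_growth:
  assumes "t \<ge> 0" "norm y < r"
  shows "ennreal (norm (minimal_section (F t) y)) \<le> growth_bound UNIV F r"
  unfolding growth_bound_def
  by (rule SUP_upper2[of y], use assms in simp, rule SUP_upper2[of t]) (use assms in auto)

lemma yosida_le_growth:
  assumes "t \<ge> 0" "\<alpha> > 0" "norm y < r"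
  shows "ennreal (norm (yosida UNIV (F t) \<alpha> y)) \<le> growth_bound UNIV F r"
proof -
  have "norm (yosida UNIV (F t) \<alpha> y) \<le> norm (minimal_section (F t) y)"
    using assms nonempty by (intro yosida_le_minimal_section mdis) auto
  then show ?thesis using minimal_section_le_growth[OF assms(1,3)] ennreal_leI order_trans by blast
qed

text \<open>The open ball in \<^const>\<open>growth_bound\<close> does not contain \<open>y\<close>, but it contains the multiples
  \<open>c y\<close> with \<open>c < 1\<close>, and the Yosida approximation is continuous. For \<open>y = 0\<close> the ball is empty and
  the inequality can fail.\<close>

lemma yosida_le_growth_norm:
  assumes t: "t \<ge> 0" and \<alpha>: "\<alpha> > 0" and y: "y \<noteq> 0"
  shows "ennreal (norm (yosida UNIV (F t) \<alpha> y)) \<le> growth_bound UNIV F (norm y)"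
proof -
  define c where "c n = 1 - inverse (real (Suc n))" for n
  have c: "0 \<le> c n" "c n < 1" for n by (auto simp: c_def inverse_le_1_iff)
  have c_lim: "c \<longlonglongrightarrow> 1 - 0" unfolding c_def by (intro tendsto_intros LIMSEQ_inverse_real_of_nat)
  have "(\<lambda>n. (1 / \<alpha>) * norm (c n *\<^sub>R y - y)) \<longlonglongrightarrow> (1 / \<alpha>) * norm ((1 - 0) *\<^sub>R y - y)"
    by (intro tendsto_intros c_lim)
  then have z: "(\<lambda>n. (1 / \<alpha>) * norm (c n *\<^sub>R y - y)) \<longlonglongrightarrow> 0" by simp
  have "(\<lambda>n. yosida UNIV (F t) \<alpha> (c n *\<^sub>R y) - yosida UNIV (F t) \<alpha> y) \<longlonglongrightarrow> 0"
    by (rule Lim_null_comparison[OF always_eventually z]) (intro allI yosida_lipschitz mdis t \<alpha>)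
  then have "(\<lambda>n. yosida UNIV (F t) \<alpha> (c n *\<^sub>R y)) \<longlonglongrightarrow> yosida UNIV (F t) \<alpha> y" by (simp add: LIM_zero_iff)
  then have "(\<lambda>n. ennreal (norm (yosida UNIV (F t) \<alpha> (c n *\<^sub>R y)))) \<longlonglongrightarrow> ennreal (norm (yosida UNIV (F t) \<alpha> y))"
    by (intro tendsto_ennrealI tendsto_norm)
  then show ?thesis
  proof (rule LIMSEQ_le_const2)
    have "ennreal (norm (yosida UNIV (F t) \<alpha> (c n *\<^sub>R y))) \<le> growth_bound UNIV F (norm y)" for n
    using c[of n] y by (intro yosida_le_growth t \<alpha>) (simp add: mult_less_cancel_right1)
    then show "\<exists>N. \<forall>n\<ge>N. ennreal (norm (yosida UNIV (F t) \<alpha> (c n *\<^sub>R y))) \<le> growth_bound UNIV F (norm y)"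
      by blast
  qed
qed

definition a :: "real \<Rightarrow> real" where "a r = enn2real (growth_bound UNIV F r)"

lemma G_le_a:
  assumes "\<alpha> > 0" "r > 0" "norm y < r"
  shows "norm (G \<alpha> t y) \<le> a r"
proof -
  have "ennreal (norm (G \<alpha> t y)) \<le> growth_bound UNIV F r"
    unfolding G_def by (rule yosida_le_growth) (use assms in auto)
  also have "\<dots> = ennreal (a r)" using growth[OF assms(2)] by (simp add: a_def less_top)
  finally show ?thesis by (simp add: a_def)
qed

lemma a_nonneg: "0 \<le> a r"
  by (simp add: a_def)

lemma G_zero: "\<alpha> > 0 \<Longrightarrow> norm (G \<alpha> s 0) \<le> a 1"
  by (rule G_le_a) auto

lemma G_dissipative: "\<alpha> > 0 \<Longrightarrow> inner (G \<alpha> s y - G \<alpha> s y') (y - y') \<le> 0"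
proof -
  assume \<alpha>: "\<alpha> > 0"
  have "inner (G \<alpha> s y - G \<alpha> s y') (y - y') \<le> - \<alpha> * (norm (G \<alpha> s y - G \<alpha> s y'))\<^sup>2"
    unfolding G_def by (rule yosida_strongly_dissipative[OF mdis]) (use \<alpha> in auto)
  also have "\<dots> \<le> 0" using \<alpha> by simp
  finally show ?thesis .
qed

definition Z :: "real \<Rightarrow> real \<Rightarrow> 'w \<Rightarrow> 'h" where "Z \<alpha> t \<omega> = P.picard_limit (G \<alpha>) x (v \<omega>) t"

context
  fixes \<alpha> :: real
  assumes \<alpha>: "\<alpha> > 0"
begin

lemmas G_facts = G_meas[OF \<alpha>] G_lipschitz[OF \<alpha>] G_zero[OF \<alpha>]

lemma inverse_\<alpha>: "0 < 1 / \<alpha>"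
  using \<alpha> by simp

lemma Z_tendsto: "\<omega> \<in> space M \<Longrightarrow> 0 \<le> t \<Longrightarrow> (\<lambda>n. P.picard (G \<alpha>) x (v \<omega>) n t) \<longlonglongrightarrow> Z \<alpha> t \<omega>"
  unfolding Z_def by (rule P.picard_tendsto_solution[OF G_facts inverse_\<alpha> v_cont])

lemma Z_max: "Z \<alpha> (max 0 t) \<omega> = Z \<alpha> t \<omega>"
  by (simp only: Z_def P.picard_limit_def max.left_idem)

lemma Z_cont: "\<omega> \<in> space M \<Longrightarrow> continuous_on UNIV (\<lambda>t. Z \<alpha> t \<omega>)"
proof -
  assume "\<omega> \<in> space M"
  then have "continuous_on {0..} (\<lambda>t. Z \<alpha> t \<omega>)"
    unfolding Z_def by (rule P.solution_continuous[OF G_facts inverse_\<alpha> v_cont])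
  then have "continuous_on UNIV (\<lambda>t. Z \<alpha> (max 0 t) \<omega>)"
    by (rule continuous_on_compose2) (auto intro!: continuous_intros)
  then show ?thesis by (simp add: Z_max)
qed

lemma Z_eq: "\<omega> \<in> space M \<Longrightarrow> 0 \<le> t \<Longrightarrow> Z \<alpha> t \<omega> = P t x + P.duhamel (\<lambda>s. G \<alpha> s (Z \<alpha> s \<omega> + v \<omega> s)) t"
  unfolding Z_def by (rule P.solution_eq[OF G_facts inverse_\<alpha> v_cont])

lemma rhs_meas:
  assumes "\<omega> \<in> space M"
  shows "(\<lambda>s. G \<alpha> s (Z \<alpha> s \<omega> + v \<omega> s)) \<in> borel_measurable borel"
proof -
  have [measurable]: "(\<lambda>s. Z \<alpha> s \<omega>) \<in> borel_measurable borel" "v \<omega> \<in> borel_measurable borel"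
    by (rule borel_measurable_continuous_onI[OF Z_cont[OF assms]] borel_measurable_continuous_onI[OF v_cont[OF assms]])+
  show ?thesis by (rule borel_measurable_compose_pair[OF G_meas[OF \<alpha>]]) measurable
qed

lemma Z_adapted:
  assumes t: "0 \<le> t"
  shows "Z \<alpha> t \<in> borel_measurable (Filt t)"
proof (rule borel_measurable_LIMSEQ_metric)
  have sp: "space (Filt t) = space M" using Filt[OF t] by (simp add: subalgebra_def)
  have V_meas: "V (max 0 s) \<in> borel_measurable (Filt t)" if "s \<in> {0..t}" for s
    using that by (intro measurable_from_subalg[OF Filt_mono V_adapted]) auto
  show "(\<lambda>\<omega>. P.picard (G \<alpha>) x (v \<omega>) n t) \<in> borel_measurable (Filt t)" for n
    unfolding v_def[abs_def]
    by (rule P.picard_adapted[OF G_facts inverse_\<alpha>, where V = "\<lambda>s. V (max 0 s)" and t = t])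
      (use V_meas t v_cont sp in \<open>auto simp: v_def\<close>)
  show "(\<lambda>n. P.picard (G \<alpha>) x (v \<omega>) n t) \<longlonglongrightarrow> Z \<alpha> t \<omega>" if "\<omega> \<in> space (Filt t)" for \<omega>
    using that t by (intro Z_tendsto) (simp_all add: sp)
qed

lemma Z_mild_path:
  assumes \<omega>: "\<omega> \<in> space M"
  shows "mild_path S (\<lambda>t z. yosida UNIV (F t) \<alpha> (z + V t \<omega>)) x (\<lambda>t. 0) (\<lambda>t. Z \<alpha> t \<omega>)"
  unfolding mild_path_def
proof (intro conjI allI impI)
  show "continuous_on {0..} (\<lambda>t. Z \<alpha> t \<omega>)" by (rule continuous_on_subset[OF Z_cont[OF \<omega>]]) simp
  fix t :: real assume t: "0 \<le> t"
  have eq: "S (t - s) (yosida UNIV (F s) \<alpha> (Z \<alpha> s \<omega> + V s \<omega>)) = P (t - s) (G \<alpha> s (Z \<alpha> s \<omega> + v \<omega> s))"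
    if "s \<in> {0..t}" for s
    using that by (simp add: P_def G_def v_def)
  obtain K where K: "\<And>s. s \<in> {0..t} \<Longrightarrow> norm (G \<alpha> s (Z \<alpha> s \<omega> + v \<omega> s)) \<le> K"
    using P.solution_rhs_bounded[OF G_facts inverse_\<alpha> v_cont[OF \<omega>]] unfolding Z_def by blast
  have "set_integrable lborel {0..t} (\<lambda>s. P (t - s) (G \<alpha> s (Z \<alpha> s \<omega> + v \<omega> s)))"
    by (rule P.flow_integrable[OF rhs_meas[OF \<omega>] K]) auto
  then show "set_integrable lborel {0..t} (\<lambda>s. S (t - s) (yosida UNIV (F s) \<alpha> (Z \<alpha> s \<omega> + V s \<omega>)))"
    by (rule set_integrable_cong[THEN iffD2, rotated -1]) (auto simp: eq)
  have "(LINT s:{0..t}|lborel. S (t - s) (yosida UNIV (F s) \<alpha> (Z \<alpha> s \<omega> + V s \<omega>)))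
      = P.duhamel (\<lambda>s. G \<alpha> s (Z \<alpha> s \<omega> + v \<omega> s)) t"
    unfolding P.duhamel_def by (rule set_lebesgue_integral_cong) (auto simp: eq)
  then show "Z \<alpha> t \<omega> = S t x + (LINT s:{0..t}|lborel. S (t - s) (yosida UNIV (F s) \<alpha> (Z \<alpha> s \<omega> + V s \<omega>))) + 0"
    using Z_eq[OF \<omega> t] t by (simp add: P_def)
qed

text \<open>Dissipativity gives \<open>inner (G (Z + v)) Z \<le> norm (G v) * norm Z\<close>. Insert this into the energy
  inequality for the rescaled path \<open>exp (\<beta> s) Z s\<close> and apply the Ou-Iang inequality.\<close>

lemma Z_norm_le:
  assumes \<omega>: "\<omega> \<in> space M" and T: "0 \<le> T"
  shows "norm (Z \<alpha> T \<omega>) \<le> exp (- \<beta> * T) * norm x + (LINT s:{0..T}|lborel. exp (- \<beta> * (T - s)) * norm (G \<alpha> s (v \<omega> s)))"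
proof -
  define f where "f s = G \<alpha> s (Z \<alpha> s \<omega> + v \<omega> s)" for s
  define f\<beta> where "f\<beta> s = exp (\<beta> * s) *\<^sub>R f s" for s
  define z\<beta> where "z\<beta> s = exp (\<beta> * s) *\<^sub>R Z \<alpha> s \<omega>" for s
  define g where "g s = exp (\<beta> * s) * norm (G \<alpha> s (v \<omega> s))" for s
  have f_meas [measurable]: "f \<in> borel_measurable borel" unfolding f_def by (rule rhs_meas[OF \<omega>])
  have f\<beta>_meas [measurable]: "f\<beta> \<in> borel_measurable borel" unfolding f\<beta>_def by measurable
  have v_meas [measurable]: "v \<omega> \<in> borel_measurable borel" by (rule borel_measurable_continuous_onI[OF v_cont[OF \<omega>]])
  have z\<beta>_cont: "continuous_on UNIV z\<beta>" unfolding z\<beta>_def by (intro continuous_intros Z_cont[OF \<omega>])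
  have z\<beta>_meas [measurable]: "z\<beta> \<in> borel_measurable borel" by (rule borel_measurable_continuous_onI[OF z\<beta>_cont])
  have Gv_meas [measurable]: "(\<lambda>s. G \<alpha> s (v \<omega> s)) \<in> borel_measurable borel"
    by (rule borel_measurable_compose_pair[OF G_meas[OF \<alpha>]]) measurable
  have g_meas [measurable]: "g \<in> borel_measurable borel" unfolding g_def by measurable
  obtain Kv where Kv: "\<And>s. s \<in> {0..T} \<Longrightarrow> norm (v \<omega> s) \<le> Kv"
    using continuous_bounded_Icc[OF v_cont[OF \<omega>]] by blast
  have Kv0: "0 \<le> Kv" using order_trans[OF norm_ge_zero Kv[of 0]] T by simp
  have Gv: "norm (G \<alpha> s (v \<omega> s)) \<le> a (Kv + 1)" if "s \<in> {0..T}" for s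
    using Kv[OF that] Kv0 by (intro G_le_a \<alpha>) auto
  obtain Kz where Kz: "\<And>s. s \<in> {0..T} \<Longrightarrow> norm (z\<beta> s) \<le> Kz"
    using continuous_bounded_Icc[OF z\<beta>_cont] by blast
  obtain Kf where Kf: "\<And>s. s \<in> {0..T} \<Longrightarrow> norm (f s) \<le> Kf"
    using P.solution_rhs_bounded[OF G_facts inverse_\<alpha> v_cont[OF \<omega>]] unfolding f_def Z_def by blast
  have expT: "exp (\<beta> * s) \<le> exp (\<beta> * T)" if "s \<in> {0..T}" for s
    using that \<beta> by simp
  have f\<beta>_bound: "norm (f\<beta> s) \<le> exp (\<beta> * T) * Kf" if "s \<in> {0..T}" for s
    using expT[OF that] Kf[OF that] by (auto simp: f\<beta>_def intro!: mult_mono)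
  have g_bound: "0 \<le> g s" "g s \<le> exp (\<beta> * T) * a (Kv + 1)" if "s \<in> {0..T}" for s
    using expT[OF that] Gv[OF that] by (auto simp: g_def intro!: mult_mono)
  have z\<beta>_eq: "z\<beta> t = P\<beta> t x + P\<beta>.duhamel f\<beta> t" if t: "t \<in> {0..T}" for t
  proof -
    have "exp (\<beta> * t) *\<^sub>R P.duhamel f t = (LINT s:{0..t}|lborel. exp (\<beta> * t) *\<^sub>R P (t - s) (f s))"
      unfolding P.duhamel_def by simp
    also have "\<dots> = P\<beta>.duhamel f\<beta> t"
      unfolding P\<beta>.duhamel_def
    proof (rule set_lebesgue_integral_cong)
      show "\<forall>s. s \<in> {0..t} \<longrightarrow> exp (\<beta> * t) *\<^sub>R P (t - s) (f s) = P\<beta> (t - s) (f\<beta> s)"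
        by (simp add: P\<beta>_def P_def f\<beta>_def blinfun.scaleR_left blinfun.scaleR_right exp_add[symmetric] algebra_simps)
    qed simp
    finally have "exp (\<beta> * t) *\<^sub>R P.duhamel f t = P\<beta>.duhamel f\<beta> t" .
    moreover have "exp (\<beta> * t) *\<^sub>R P t x = P\<beta> t x" using t by (simp add: P\<beta>_def P_def blinfun.scaleR_left)
    ultimately show ?thesis using Z_eq[OF \<omega>, of t] t by (simp add: z\<beta>_def f_def[abs_def] scaleR_add_right)
  qed
  have energy: "(norm (z\<beta> t))\<^sup>2 \<le> (norm x)\<^sup>2 + 2 * (LINT s:{0..t}|lborel. g s * norm (z\<beta> s))" if t: "t \<in> {0..T}" for t
  proof -
    have "(norm (z\<beta> t))\<^sup>2 \<le> (norm x)\<^sup>2 + 2 * (LINT s:{0..t}|lborel. inner (f\<beta> s) (z\<beta> s))"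
      by (rule P\<beta>.energy_inequality[OF f\<beta>_meas f\<beta>_bound z\<beta>_cont z\<beta>_eq]) (use t in auto)
    also have "(LINT s:{0..t}|lborel. inner (f\<beta> s) (z\<beta> s)) \<le> (LINT s:{0..t}|lborel. g s * norm (z\<beta> s))"
    proof (rule set_integral_mono)
      show "set_integrable lborel {0..t} (\<lambda>s. inner (f\<beta> s) (z\<beta> s))"
      proof (rule set_integrable_bounded_Icc[where K = "exp (\<beta> * T) * Kf * Kz"])
        fix s assume "s \<in> {0..t}"
        then have s: "s \<in> {0..T}" using t by auto
        have "norm (inner (f\<beta> s) (z\<beta> s)) \<le> norm (f\<beta> s) * norm (z\<beta> s)" by (simp add: Cauchy_Schwarz_ineq2)
        also have "\<dots> \<le> exp (\<beta> * T) * Kf * Kz"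
          using f\<beta>_bound[OF s] Kz[OF s] order_trans[OF norm_ge_zero f\<beta>_bound[OF s]] by (intro mult_mono[of "norm (f\<beta> s)"]) auto
        finally show "norm (inner (f\<beta> s) (z\<beta> s)) \<le> exp (\<beta> * T) * Kf * Kz" .
      qed measurable
      show "set_integrable lborel {0..t} (\<lambda>s. g s * norm (z\<beta> s))"
      proof (rule set_integrable_bounded_Icc[where K = "exp (\<beta> * T) * a (Kv + 1) * Kz"])
        fix s assume "s \<in> {0..t}"
        then have s: "s \<in> {0..T}" using t by auto
        have "g s * norm (z\<beta> s) \<le> exp (\<beta> * T) * a (Kv + 1) * Kz"
          using g_bound[OF s] Kz[OF s] a_nonneg by (intro mult_mono[of "g s"]) auto
        then show "norm (g s * norm (z\<beta> s)) \<le> exp (\<beta> * T) * a (Kv + 1) * Kz" using g_bound[OF s] by simp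
      qed measurable
      fix s
      have "inner (f s) (Z \<alpha> s \<omega>) = inner (G \<alpha> s (Z \<alpha> s \<omega> + v \<omega> s) - G \<alpha> s (v \<omega> s)) ((Z \<alpha> s \<omega> + v \<omega> s) - v \<omega> s)
          + inner (G \<alpha> s (v \<omega> s)) (Z \<alpha> s \<omega>)"
        by (simp add: f_def inner_diff_left)
      also have "\<dots> \<le> 0 + norm (G \<alpha> s (v \<omega> s)) * norm (Z \<alpha> s \<omega>)"
        by (intro add_mono G_dissipative \<alpha> norm_cauchy_schwarz)
      finally have "exp (\<beta> * s) * exp (\<beta> * s) * inner (f s) (Z \<alpha> s \<omega>)
          \<le> exp (\<beta> * s) * exp (\<beta> * s) * (norm (G \<alpha> s (v \<omega> s)) * norm (Z \<alpha> s \<omega>))"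
        by (intro mult_left_mono) auto
      then show "inner (f\<beta> s) (z\<beta> s) \<le> g s * norm (z\<beta> s)"
        by (simp add: f\<beta>_def z\<beta>_def g_def ac_simps)
    qed
    finally show ?thesis by simp
  qed
  have "norm (z\<beta> T) \<le> norm x + (LINT s:{0..T}|lborel. g s)"
    by (rule ou_iang[where B = Kz and K = "exp (\<beta> * T) * a (Kv + 1)"])
      (use Kz g_bound energy T in auto)
  then have "exp (\<beta> * T) * norm (Z \<alpha> T \<omega>) \<le> norm x + (LINT s:{0..T}|lborel. g s)" by (simp add: z\<beta>_def)
  then have "exp (- \<beta> * T) * (exp (\<beta> * T) * norm (Z \<alpha> T \<omega>)) \<le> exp (- \<beta> * T) * (norm x + (LINT s:{0..T}|lborel. g s))"
    by (intro mult_left_mono) auto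
  moreover have "exp (- \<beta> * T) * (exp (\<beta> * T) * norm (Z \<alpha> T \<omega>)) = norm (Z \<alpha> T \<omega>)"
    by (simp add: mult.assoc[symmetric] exp_add[symmetric])
  moreover have "exp (- \<beta> * T) * (LINT s:{0..T}|lborel. g s)
      = (LINT s:{0..T}|lborel. exp (- \<beta> * (T - s)) * norm (G \<alpha> s (v \<omega> s)))"
    unfolding set_integral_mult_right[symmetric] g_def
    by (intro set_lebesgue_integral_cong) (auto simp: exp_add[symmetric] mult.assoc[symmetric] algebra_simps)
  ultimately show ?thesis by (simp only: distrib_left)
qed

end

text \<open>By \<open>Z_norm_le\<close> the paths stay, for all \<open>\<alpha>\<close>, in one ball on which the growth bound is finite.\<close>

lemma locally_uniform_bounds:
  assumes \<omega>: "\<omega> \<in> space M" and T: "0 \<le> T"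
  shows "\<exists>C. \<forall>\<alpha>>0. \<forall>s\<in>{0..T}. norm (G \<alpha> s (Z \<alpha> s \<omega> + v \<omega> s)) \<le> C"
proof -
  obtain Kv where Kv: "\<And>s. s \<in> {0..T} \<Longrightarrow> norm (v \<omega> s) \<le> Kv"
    using continuous_bounded_Icc[OF v_cont[OF \<omega>]] by blast
  have Kv0: "0 \<le> Kv" using order_trans[OF norm_ge_zero Kv[of 0]] T by simp
  \<comment> \<open>the summand 1 accounts for the open ball in \<^const>\<open>growth_bound\<close>\<close>
  define R where "R = norm x + a (Kv + 1) * T + Kv + 1"
  have R: "0 < R" using Kv0 a_nonneg[of "Kv + 1"] T by (simp add: R_def add_nonneg_pos)
  have "norm (G \<alpha> s (Z \<alpha> s \<omega> + v \<omega> s)) \<le> a R" if \<alpha>: "\<alpha> > 0" and s: "s \<in> {0..T}" for \<alpha> s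
  proof (rule G_le_a[OF \<alpha> R])
    have [measurable]: "v \<omega> \<in> borel_measurable borel" by (rule borel_measurable_continuous_onI[OF v_cont[OF \<omega>]])
    have [measurable]: "(\<lambda>s. G \<alpha> s (v \<omega> s)) \<in> borel_measurable borel"
      by (rule borel_measurable_compose_pair[OF G_meas[OF \<alpha>]]) measurable
    have "norm (LINT r:{0..s}|lborel. exp (- \<beta> * (s - r)) * norm (G \<alpha> r (v \<omega> r))) \<le> a (Kv + 1) * (s - 0)"
    proof (rule norm_set_integral_Icc_le)
      fix r assume r: "r \<in> {0..s}"
      have "norm (G \<alpha> r (v \<omega> r)) \<le> a (Kv + 1)"
        using Kv[of r] r s Kv0 by (intro G_le_a \<alpha>) auto
      moreover have "exp (- \<beta> * (s - r)) \<le> 1" using r \<beta> by simp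
      ultimately have "exp (- \<beta> * (s - r)) * norm (G \<alpha> r (v \<omega> r)) \<le> 1 * a (Kv + 1)"
        by (intro mult_mono) auto
      then show "norm (exp (- \<beta> * (s - r)) * norm (G \<alpha> r (v \<omega> r))) \<le> a (Kv + 1)" by simp
    qed (use s in auto)
    also have "\<dots> \<le> a (Kv + 1) * T" using s a_nonneg by (intro mult_left_mono) auto
    finally have I: "(LINT r:{0..s}|lborel. exp (- \<beta> * (s - r)) * norm (G \<alpha> r (v \<omega> r))) \<le> a (Kv + 1) * T" by simp
    have "exp (- \<beta> * s) * norm x \<le> 1 * norm x" using s \<beta> by (intro mult_right_mono) auto
    with I Z_norm_le[OF \<alpha> \<omega>, of s] s have "norm (Z \<alpha> s \<omega>) \<le> norm x + a (Kv + 1) * T" by simp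
    then show "norm (Z \<alpha> s \<omega> + v \<omega> s) < R"
      using norm_triangle_ineq[of "Z \<alpha> s \<omega>" "v \<omega> s"] Kv[OF s] by (simp add: R_def)
  qed
  then show ?thesis by blast
qed

text \<open>Both paths start at \<open>x\<close>, so the energy inequality bounds the square of their distance by an
  integral of \<open>inner (f \<alpha> - f \<gamma>) (Z \<alpha> - Z \<gamma>)\<close>, which is \<open>O(\<alpha> + \<gamma>)\<close> by \<open>yosida_komura\<close>.\<close>

lemma Z_difference:
  assumes \<omega>: "\<omega> \<in> space M" and t: "0 \<le> t"
    and C: "\<And>\<alpha> s. \<alpha> > 0 \<Longrightarrow> s \<in> {0..t} \<Longrightarrow> norm (G \<alpha> s (Z \<alpha> s \<omega> + v \<omega> s)) \<le> C"
    and \<alpha>: "\<alpha> > 0" and \<gamma>: "\<gamma> > 0"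
  shows "(norm (Z \<alpha> t \<omega> - Z \<gamma> t \<omega>))\<^sup>2 \<le> 4 * C\<^sup>2 * (\<alpha> + \<gamma>) * t"
proof -
  define f where "f \<alpha> s = G \<alpha> s (Z \<alpha> s \<omega> + v \<omega> s)" for \<alpha> s
  have C0: "0 \<le> C" using order_trans[OF norm_ge_zero C[of 1 0]] t by simp
  have f_meas [measurable]: "f \<alpha> \<in> borel_measurable borel" "f \<gamma> \<in> borel_measurable borel"
    unfolding f_def using rhs_meas \<alpha> \<gamma> \<omega> by auto
  have f_le: "norm (f \<alpha> s) \<le> C" "norm (f \<gamma> s) \<le> C" if "s \<in> {0..t}" for s
    unfolding f_def using C that \<alpha> \<gamma> by auto
  have z_cont: "continuous_on UNIV (\<lambda>s. Z \<alpha> s \<omega> - Z \<gamma> s \<omega>)"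
    by (intro continuous_on_diff Z_cont \<alpha> \<gamma> \<omega>)
  then have z_meas [measurable]: "(\<lambda>s. Z \<alpha> s \<omega> - Z \<gamma> s \<omega>) \<in> borel_measurable borel"
    by (rule borel_measurable_continuous_onI)
  have z_eq: "Z \<alpha> s \<omega> - Z \<gamma> s \<omega> = P s 0 + P.duhamel (\<lambda>r. f \<alpha> r - f \<gamma> r) s" if s: "s \<in> {0..t}" for s
  proof -
    have "P.duhamel (\<lambda>r. f \<alpha> r - f \<gamma> r) s = P.duhamel (f \<alpha>) s - P.duhamel (f \<gamma>) s"
      unfolding P.duhamel_def blinfun.diff_right
      by (rule set_integral_diff(2)) (rule P.flow_integrable[OF _ f_le(1)] P.flow_integrable[OF _ f_le(2)]; use s in auto)+
    then show ?thesis
      using Z_eq[OF \<alpha> \<omega>, of s] Z_eq[OF \<gamma> \<omega>, of s] s by (simp add: f_def[abs_def])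
  qed
  have diss: "inner (f \<alpha> s - f \<gamma> s) (Z \<alpha> s \<omega> - Z \<gamma> s \<omega>) \<le> 2 * C\<^sup>2 * (\<alpha> + \<gamma>)" if s: "s \<in> {0..t}" for s
  proof -
    have "inner (f \<alpha> s - f \<gamma> s) (Z \<alpha> s \<omega> - Z \<gamma> s \<omega>)
        = inner (f \<alpha> s - f \<gamma> s) ((Z \<alpha> s \<omega> + v \<omega> s) - (Z \<gamma> s \<omega> + v \<omega> s))" by simp
    also have "\<dots> \<le> - inner (f \<alpha> s - f \<gamma> s) (\<alpha> *\<^sub>R f \<alpha> s - \<gamma> *\<^sub>R f \<gamma> s)"
      unfolding f_def G_def by (rule yosida_komura[OF mdis]) (use \<alpha> \<gamma> in auto)
    also have "\<dots> \<le> norm (f \<alpha> s - f \<gamma> s) * norm (\<alpha> *\<^sub>R f \<alpha> s - \<gamma> *\<^sub>R f \<gamma> s)"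
      using Cauchy_Schwarz_ineq2[of "f \<alpha> s - f \<gamma> s" "\<alpha> *\<^sub>R f \<alpha> s - \<gamma> *\<^sub>R f \<gamma> s"] by linarith
    also have "\<dots> \<le> (C + C) * (\<alpha> * C + \<gamma> * C)"
    proof (rule mult_mono)
      show "norm (f \<alpha> s - f \<gamma> s) \<le> C + C"
        by (rule order_trans[OF norm_triangle_ineq4 add_mono[OF f_le[OF s]]])
      have "norm (\<alpha> *\<^sub>R f \<alpha> s) \<le> \<alpha> * C" "norm (\<gamma> *\<^sub>R f \<gamma> s) \<le> \<gamma> * C"
        using f_le[OF s] \<alpha> \<gamma> by auto
      then show "norm (\<alpha> *\<^sub>R f \<alpha> s - \<gamma> *\<^sub>R f \<gamma> s) \<le> \<alpha> * C + \<gamma> * C"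
        by (rule order_trans[OF norm_triangle_ineq4 add_mono])
    qed (use C0 in auto)
    also have "\<dots> = 2 * C\<^sup>2 * (\<alpha> + \<gamma>)" by (simp add: power2_eq_square algebra_simps)
    finally show ?thesis .
  qed
  have "(norm (Z \<alpha> t \<omega> - Z \<gamma> t \<omega>))\<^sup>2 \<le> (norm (0::'h))\<^sup>2 + 2 * (LINT s:{0..t}|lborel. inner (f \<alpha> s - f \<gamma> s) (Z \<alpha> s \<omega> - Z \<gamma> s \<omega>))"
  proof (rule P.energy_inequality[OF _ _ z_cont z_eq t])
    show "norm (f \<alpha> s - f \<gamma> s) \<le> C + C" if "s \<in> {0..t}" for s
      by (rule order_trans[OF norm_triangle_ineq4 add_mono[OF f_le[OF that]]])
  qed measurable
  also have "(LINT s:{0..t}|lborel. inner (f \<alpha> s - f \<gamma> s) (Z \<alpha> s \<omega> - Z \<gamma> s \<omega>)) \<le> (LINT s:{0..t}|lborel. 2 * C\<^sup>2 * (\<alpha> + \<gamma>))"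
  proof (rule set_integral_mono)
    obtain Kz where Kz: "\<And>s. s \<in> {0..t} \<Longrightarrow> norm (Z \<alpha> s \<omega> - Z \<gamma> s \<omega>) \<le> Kz"
      using continuous_bounded_Icc[OF z_cont] by blast
    show "set_integrable lborel {0..t} (\<lambda>s. inner (f \<alpha> s - f \<gamma> s) (Z \<alpha> s \<omega> - Z \<gamma> s \<omega>))"
    proof (rule set_integrable_bounded_Icc[where K = "(C + C) * Kz"])
      fix s assume s: "s \<in> {0..t}"
      have "norm (inner (f \<alpha> s - f \<gamma> s) (Z \<alpha> s \<omega> - Z \<gamma> s \<omega>)) \<le> norm (f \<alpha> s - f \<gamma> s) * norm (Z \<alpha> s \<omega> - Z \<gamma> s \<omega>)"
        by (simp add: Cauchy_Schwarz_ineq2)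
      also have "\<dots> \<le> (C + C) * Kz"
        by (rule mult_mono[OF order_trans[OF norm_triangle_ineq4 add_mono[OF f_le[OF s]]] Kz[OF s]]) (use C0 in auto)
      finally show "norm (inner (f \<alpha> s - f \<gamma> s) (Z \<alpha> s \<omega> - Z \<gamma> s \<omega>)) \<le> (C + C) * Kz" .
    qed measurable
    show "set_integrable lborel {0..t} (\<lambda>s. 2 * C\<^sup>2 * (\<alpha> + \<gamma>))"
      by (rule set_integrable_bounded_Icc[where K = "\<bar>2 * C\<^sup>2 * (\<alpha> + \<gamma>)\<bar>"]) auto
  qed (rule diss)
  also have "(LINT s:{0..t}|lborel. 2 * C\<^sup>2 * (\<alpha> + \<gamma>)) = 2 * C\<^sup>2 * (\<alpha> + \<gamma>) * t"
    using t by (simp add: set_lebesgue_integral_def)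
  finally show ?thesis by simp
qed

definition \<alpha>_seq :: "nat \<Rightarrow> real" where "\<alpha>_seq n = inverse (real (Suc n))"

lemma \<alpha>_seq_pos: "0 < \<alpha>_seq n"
  by (simp add: \<alpha>_seq_def)

lemma \<alpha>_seq_tendsto: "\<alpha>_seq \<longlonglongrightarrow> 0"
  unfolding \<alpha>_seq_def by (rule LIMSEQ_inverse_real_of_nat)

definition Zlim :: "real \<Rightarrow> 'w \<Rightarrow> 'h" where "Zlim t \<omega> = lim (\<lambda>n. Z (\<alpha>_seq n) t \<omega>)"

lemma Z_converges:
  assumes \<omega>: "\<omega> \<in> space M" and t: "0 \<le> t"
  shows "(\<lambda>n. Z (\<alpha>_seq n) t \<omega>) \<longlonglongrightarrow> Zlim t \<omega>"
proof -
  obtain C where C: "\<And>\<alpha> s. \<alpha> > 0 \<Longrightarrow> s \<in> {0..t} \<Longrightarrow> norm (G \<alpha> s (Z \<alpha> s \<omega> + v \<omega> s)) \<le> C"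
    using locally_uniform_bounds[OF \<omega> t] by blast
  have "Cauchy (\<lambda>n. Z (\<alpha>_seq n) t \<omega>)"
  proof (rule metric_CauchyI)
    fix e :: real assume e: "e > 0"
    have "(\<lambda>n. 4 * C\<^sup>2 * (\<alpha>_seq n + \<alpha>_seq n) * t) \<longlonglongrightarrow> 4 * C\<^sup>2 * (0 + 0) * t"
      by (intro tendsto_intros \<alpha>_seq_tendsto)
    then have "eventually (\<lambda>n. 4 * C\<^sup>2 * (\<alpha>_seq n + \<alpha>_seq n) * t < e\<^sup>2) sequentially"
      by (rule order_tendstoD) (use e in simp)
    then obtain N where N: "4 * C\<^sup>2 * (\<alpha>_seq N + \<alpha>_seq N) * t < e\<^sup>2"
      by (auto simp: eventually_sequentially)
    have "dist (Z (\<alpha>_seq m) t \<omega>) (Z (\<alpha>_seq n) t \<omega>) < e" if "m \<ge> N" "n \<ge> N" for m n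
    proof -
      have "\<alpha>_seq m \<le> \<alpha>_seq N" "\<alpha>_seq n \<le> \<alpha>_seq N" using that by (auto simp: \<alpha>_seq_def)
      then have "4 * C\<^sup>2 * (\<alpha>_seq m + \<alpha>_seq n) * t \<le> 4 * C\<^sup>2 * (\<alpha>_seq N + \<alpha>_seq N) * t"
        using t by (intro mult_right_mono mult_left_mono add_mono) auto
      with N Z_difference[OF \<omega> t C \<alpha>_seq_pos \<alpha>_seq_pos, of m n]
      have "(norm (Z (\<alpha>_seq m) t \<omega> - Z (\<alpha>_seq n) t \<omega>))\<^sup>2 < e\<^sup>2" by linarith
      then show ?thesis using e by (simp add: dist_norm power2_less_imp_less)
    qed
    then show "\<exists>N. \<forall>m\<ge>N. \<forall>n\<ge>N. dist (Z (\<alpha>_seq m) t \<omega>) (Z (\<alpha>_seq n) t \<omega>) < e" by blast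
  qed
  then show ?thesis unfolding Zlim_def by (simp add: Cauchy_convergent_iff convergent_LIMSEQ_iff)
qed

lemma Zlim_adapted:
  assumes t: "0 \<le> t"
  shows "Zlim t \<in> borel_measurable (Filt t)"
proof (rule borel_measurable_LIMSEQ_metric)
  show "Z (\<alpha>_seq n) t \<in> borel_measurable (Filt t)" for n by (rule Z_adapted[OF \<alpha>_seq_pos t])
  show "(\<lambda>n. Z (\<alpha>_seq n) t \<omega>) \<longlonglongrightarrow> Zlim t \<omega>" if "\<omega> \<in> space (Filt t)" for \<omega>
    using that Filt[OF t] by (intro Z_converges t) (simp add: subalgebra_def)
qed

lemma time_product_measurable:
  fixes Y :: "real \<Rightarrow> 'w \<Rightarrow> 'h"
  assumes meas: "\<And>t. 0 \<le> t \<Longrightarrow> Y t \<in> borel_measurable (Filt t)"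
    and cont: "\<And>\<omega>. \<omega> \<in> space M \<Longrightarrow> continuous_on UNIV (\<lambda>t. Y (max 0 t) \<omega>)"
  shows "(\<lambda>(t, \<omega>). Y t \<omega>) \<in> borel_measurable (time_product M)"
proof -
  have "(\<lambda>p. Y (max 0 (fst p)) (snd p)) \<in> borel_measurable (borel \<Otimes>\<^sub>M M)"
    by (rule measurable_of_continuous_paths) (auto intro!: cont measurable_from_subalg[OF Filt meas])
  moreover have "(\<lambda>p. (fst p, snd p)) \<in> measurable (restrict_space lborel {0::real..} \<Otimes>\<^sub>M M) (borel \<Otimes>\<^sub>M M)"
  proof -
    have "(\<lambda>r::real. r) \<in> measurable (restrict_space lborel {0::real..}) borel"
      by (rule measurable_restrict_space1) simp
    from measurable_Pair[OF measurable_compose[OF measurable_fst this] measurable_snd] show ?thesis .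
  qed
  then have "(\<lambda>p. p) \<in> measurable (restrict_space lborel {0::real..} \<Otimes>\<^sub>M M) (borel \<Otimes>\<^sub>M M)" by (simp only: prod.collapse)
  ultimately have "(\<lambda>p. Y (max 0 (fst p)) (snd p)) \<in> borel_measurable (time_product M)"
    unfolding time_product_def by (rule measurable_compose[rotated])
  then show ?thesis
    by (rule measurable_cong[THEN iffD1, rotated]) (auto simp: time_product_def space_pair_measure space_restrict_space)
qed

lemma Z_random_mild_solution:
  assumes "\<alpha> > 0"
  shows "random_mild_solution M Filt S (\<lambda>t. yosida UNIV (F t) \<alpha>) V x (Z \<alpha>)"
  unfolding random_mild_solution_def adapted_def
  using Z_adapted[OF assms] Z_mild_path[OF assms] by blast

lemma shifted_mild_solution:
  assumes \<alpha>: "\<alpha> > 0"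
  shows "mild_solution M Filt S (\<lambda>t. yosida UNIV (F t) \<alpha>) V x (\<lambda>t \<omega>. Z \<alpha> t \<omega> + V t \<omega>)"
  unfolding mild_solution_def adapted_def
proof (intro conjI allI impI AE_I2)
  show "(\<lambda>\<omega>. Z \<alpha> t \<omega> + V t \<omega>) \<in> borel_measurable (Filt t)" if "0 \<le> t" for t
    by (intro borel_measurable_add Z_adapted[OF \<alpha>] V_adapted that)
  fix \<omega> assume \<omega>: "\<omega> \<in> space M"
  show "mild_path S (\<lambda>t. yosida UNIV (F t) \<alpha>) x (\<lambda>t. V t \<omega>) (\<lambda>t. Z \<alpha> t \<omega> + V t \<omega>)"
    using Z_mild_path[OF \<alpha> \<omega>] V_cont[OF \<omega>] unfolding mild_path_def
    by (auto intro: continuous_on_add)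
qed

lemma continuous_max_0:
  "\<omega> \<in> space M \<Longrightarrow> \<alpha> > 0 \<Longrightarrow> continuous_on UNIV (\<lambda>t. Z \<alpha> (max 0 t) \<omega>)"
  using Z_cont by (simp add: Z_max)

lemma space_time_product: "space (time_product M) = {0..} \<times> space M"
  by (simp add: time_product_def space_pair_measure space_restrict_space)

lemma Z_time_measurable: "\<alpha> > 0 \<Longrightarrow> (\<lambda>(t, \<omega>). Z \<alpha> t \<omega>) \<in> borel_measurable (time_product M)"
  by (intro time_product_measurable Z_adapted continuous_max_0)

lemma V_time_measurable: "(\<lambda>(t, \<omega>). V t \<omega>) \<in> borel_measurable (time_product M)"
  by (rule time_product_measurable[OF V_adapted]) (use v_cont in \<open>simp_all add: v_def\<close>)

lemma Zlim_time_measurable: "(\<lambda>(t, \<omega>). Zlim t \<omega>) \<in> borel_measurable (time_product M)"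
proof (rule borel_measurable_LIMSEQ_metric)
  show "(\<lambda>(t, \<omega>). Z (\<alpha>_seq n) t \<omega>) \<in> borel_measurable (time_product M)" for n
    by (rule Z_time_measurable[OF \<alpha>_seq_pos])
  show "(\<lambda>n. case p of (t, \<omega>) \<Rightarrow> Z (\<alpha>_seq n) t \<omega>) \<longlonglongrightarrow> (case p of (t, \<omega>) \<Rightarrow> Zlim t \<omega>)"
    if "p \<in> space (time_product M)" for p
    using that Z_converges by (auto simp: space_time_product)
qed

lemma Z_limit_point: "pseudo_weak_limit_point M Z Zlim"
  unfolding pseudo_weak_limit_point_def
proof (intro exI[of _ \<alpha>_seq] conjI allI \<alpha>_seq_pos \<alpha>_seq_tendsto)
  show "pseudo_weakly_converges (time_product M) (\<lambda>n (t, \<omega>). Z (\<alpha>_seq n) t \<omega>) (\<lambda>(t, \<omega>). Zlim t \<omega>)"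
    by (rule pseudo_weak_of_pointwise[OF Z_time_measurable[OF \<alpha>_seq_pos] Zlim_time_measurable])
      (use Z_converges in \<open>auto simp: space_time_product\<close>)
qed

lemma shifted_limit_point:
  "pseudo_weak_limit_point M (\<lambda>\<alpha> t \<omega>. Z \<alpha> t \<omega> + V t \<omega>) (\<lambda>t \<omega>. Zlim t \<omega> + V t \<omega>)"
  unfolding pseudo_weak_limit_point_def
proof (intro exI[of _ \<alpha>_seq] conjI allI \<alpha>_seq_pos \<alpha>_seq_tendsto)
  have "(\<lambda>p. (case p of (t, \<omega>) \<Rightarrow> Z (\<alpha>_seq n) t \<omega>) + (case p of (t, \<omega>) \<Rightarrow> V t \<omega>)) \<in> borel_measurable (time_product M)" for n
    by (rule borel_measurable_add[OF Z_time_measurable[OF \<alpha>_seq_pos] V_time_measurable])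
  then have 1: "(\<lambda>(t, \<omega>). Z (\<alpha>_seq n) t \<omega> + V t \<omega>) \<in> borel_measurable (time_product M)" for n
    by (simp only: case_prod_beta')
  have "(\<lambda>p. (case p of (t, \<omega>) \<Rightarrow> Zlim t \<omega>) + (case p of (t, \<omega>) \<Rightarrow> V t \<omega>)) \<in> borel_measurable (time_product M)"
    by (rule borel_measurable_add[OF Zlim_time_measurable V_time_measurable])
  then have 2: "(\<lambda>(t, \<omega>). Zlim t \<omega> + V t \<omega>) \<in> borel_measurable (time_product M)"
    by (simp only: case_prod_beta')
  show "pseudo_weakly_converges (time_product M) (\<lambda>n (t, \<omega>). Z (\<alpha>_seq n) t \<omega> + V t \<omega>) (\<lambda>(t, \<omega>). Zlim t \<omega> + V t \<omega>)"
    by (rule pseudo_weak_of_pointwise[OF 1 2])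
      (auto simp: space_time_product intro!: tendsto_add Z_converges)
qed

lemma limit_pseudo_weak_solution:
  "pseudo_weak_solution M Filt S UNIV F V x (\<lambda>t \<omega>. Zlim t \<omega> + V t \<omega>)"
  unfolding pseudo_weak_solution_def
proof (intro conjI exI[of _ "\<lambda>\<alpha> t \<omega>. Z \<alpha> t \<omega> + V t \<omega>"] allI impI shifted_limit_point shifted_mild_solution)
  show "adapted Filt (\<lambda>t \<omega>. Zlim t \<omega> + V t \<omega>)"
    unfolding adapted_def by (intro allI impI borel_measurable_add Zlim_adapted V_adapted)
qed

context
  assumes V_nonzero: "\<And>h::'h. h \<noteq> 0 \<Longrightarrow> \<forall>s>0. AE \<omega> in M. V s \<omega> \<noteq> 0"
begin

text \<open>For almost every path the set of times at which the noise vanishes is a null set, by Fubini's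
  theorem; at all other times \<open>yosida_le_growth_norm\<close> applies. In the trivial Hilbert space the
  noise does vanish, but so does \<open>G\<close>.\<close>

lemma yosida_along_noise_le_growth:
  "AE \<omega> in M. AE s in lborel. \<forall>\<alpha>>0. 0 < s \<longrightarrow>
    ennreal (norm (G \<alpha> s (v \<omega> s))) \<le> growth_bound UNIV F (norm (V s \<omega>))"
proof (cases "\<exists>h::'h. h \<noteq> 0")
  case False
  then have "norm (G \<alpha> s (v \<omega> s)) = 0" for \<alpha> s \<omega> by (metis norm_zero)
  then show ?thesis by simp
next
  case True
  have v_meas: "(\<lambda>p. v (snd p) (fst p)) \<in> borel_measurable (borel \<Otimes>\<^sub>M M)"
  proof (rule measurable_of_continuous_paths[where Y = "\<lambda>s \<omega>. v \<omega> s"])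
    show "(\<lambda>\<omega>. v \<omega> s) \<in> borel_measurable M" for s
      unfolding v_def by (rule measurable_from_subalg[OF Filt V_adapted]) auto
  qed (rule v_cont)
  interpret pair_sigma_finite lborel M
    by (intro pair_sigma_finite.intro sigma_finite_lborel sigma_finite_measure_axioms)
  have [measurable]: "(\<lambda>p. v (snd p) (fst p)) \<in> borel_measurable (lborel \<Otimes>\<^sub>M M)"
    using v_meas measurable_cong_sets[OF sets_pair_measure_cong[OF sets_lborel refl] refl] by blast
  have "{p \<in> space (lborel \<Otimes>\<^sub>M M). 0 < fst p \<longrightarrow> v (snd p) (fst p) \<noteq> 0} \<in> sets (lborel \<Otimes>\<^sub>M M)"
    by measurable
  from AE_commute[OF this]
  have "(AE s in lborel. AE \<omega> in M. 0 < s \<longrightarrow> v \<omega> s \<noteq> 0) = (AE \<omega> in M. AE s in lborel. 0 < s \<longrightarrow> v \<omega> s \<noteq> 0)" .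
  moreover have "AE s in lborel. AE \<omega> in M. 0 < s \<longrightarrow> v \<omega> s \<noteq> 0"
  proof (rule AE_I2)
    fix s :: real
    show "AE \<omega> in M. 0 < s \<longrightarrow> v \<omega> s \<noteq> 0"
      using True V_nonzero by (cases "0 < s") (auto simp: v_def)
  qed
  ultimately have "AE \<omega> in M. AE s in lborel. 0 < s \<longrightarrow> v \<omega> s \<noteq> 0" by simp
  then show ?thesis
  proof eventually_elim
    case (elim \<omega>)
    then show ?case
    proof eventually_elim
      case (elim s)
      show ?case
      proof (intro allI impI)
        fix \<alpha> :: real assume \<alpha>: "\<alpha> > 0" and s: "0 < s"
        then have "v \<omega> s \<noteq> 0" using elim by simp
        then have "ennreal (norm (yosida UNIV (F (max 0 s)) \<alpha> (v \<omega> s))) \<le> growth_bound UNIV F (norm (v \<omega> s))"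
          by (intro yosida_le_growth_norm \<alpha>) auto
        then show "ennreal (norm (G \<alpha> s (v \<omega> s))) \<le> growth_bound UNIV F (norm (V s \<omega>))"
          using s by (simp add: G_def v_def)
      qed
    qed
  qed
qed

lemma limit_norm_le:
  "AE \<omega> in M. \<forall>t\<ge>0. ennreal (norm (Zlim t \<omega> + V t \<omega>)) \<le>
    ennreal (norm x * exp (- \<beta> * t)) +
    (\<integral>\<^sup>+ s\<in>{0..t}. ennreal (exp (- \<beta> * (t - s))) * growth_bound UNIV F (norm (V s \<omega>)) \<partial>lborel) +
    ennreal (norm (V t \<omega>))"
  using yosida_along_noise_le_growth AE_space
proof eventually_elim
  case (elim \<omega>)
  then have \<omega>: "\<omega> \<in> space M" by simp
  show ?case
  proof (intro allI impI)
    fix t :: real assume t: "0 \<le> t"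
    define I where "I = (\<integral>\<^sup>+ s\<in>{0..t}. ennreal (exp (- \<beta> * (t - s))) * growth_bound UNIV F (norm (V s \<omega>)) \<partial>lborel)"
    have le: "ennreal (norm (Z (\<alpha>_seq n) t \<omega>)) \<le> ennreal (norm x * exp (- \<beta> * t)) + I" for n
    proof -
      let ?g = "\<lambda>s. exp (- \<beta> * (t - s)) * norm (G (\<alpha>_seq n) s (v \<omega> s))"
      have \<alpha>: "0 < \<alpha>_seq n" by (rule \<alpha>_seq_pos)
      have [measurable]: "v \<omega> \<in> borel_measurable borel" by (rule borel_measurable_continuous_onI[OF v_cont[OF \<omega>]])
      have [measurable]: "(\<lambda>s. G (\<alpha>_seq n) s (v \<omega> s)) \<in> borel_measurable borel"
        by (rule borel_measurable_compose_pair[OF G_meas[OF \<alpha>]]) measurable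
      obtain Kv where Kv: "\<And>s. s \<in> {0..t} \<Longrightarrow> norm (v \<omega> s) \<le> Kv"
        using continuous_bounded_Icc[OF v_cont[OF \<omega>]] by blast
      have Kv0: "0 \<le> Kv" using order_trans[OF norm_ge_zero Kv[of 0]] t by simp
      have int: "set_integrable lborel {0..t} ?g"
      proof (rule set_integrable_bounded_Icc[where K = "a (Kv + 1)"])
        fix s assume s: "s \<in> {0..t}"
        have "exp (- \<beta> * (t - s)) * norm (G (\<alpha>_seq n) s (v \<omega> s)) \<le> 1 * a (Kv + 1)"
        proof (rule mult_mono)
          show "exp (- \<beta> * (t - s)) \<le> 1" using s \<beta> by simp
          show "norm (G (\<alpha>_seq n) s (v \<omega> s)) \<le> a (Kv + 1)"
            using Kv[OF s] Kv0 by (intro G_le_a \<alpha>) auto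
        qed auto
        then show "norm (?g s) \<le> a (Kv + 1)" by simp
      qed measurable
      have "ennreal (LINT s:{0..t}|lborel. ?g s) = (\<integral>\<^sup>+ s. ennreal (indicator {0..t} s *\<^sub>R ?g s) \<partial>lborel)"
        unfolding set_lebesgue_integral_def
        by (rule nn_integral_eq_integral[symmetric]) (use int in \<open>auto simp: set_integrable_def\<close>)
      also have "\<dots> \<le> I"
        unfolding I_def
      proof (rule nn_integral_mono_AE)
        show "AE s in lborel. ennreal (indicator {0..t} s *\<^sub>R ?g s)
            \<le> ennreal (exp (- \<beta> * (t - s))) * growth_bound UNIV F (norm (V s \<omega>)) * indicator {0..t} s"
          using elim(1) AE_lborel_singleton[of 0]
        proof eventually_elim
          case (elim s)
          show ?case
          proof (cases "s \<in> {0..t}")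
            case True
            then have "ennreal (norm (G (\<alpha>_seq n) s (v \<omega> s))) \<le> growth_bound UNIV F (norm (V s \<omega>))"
              using elim \<alpha> by auto
            then have "ennreal (exp (- \<beta> * (t - s))) * ennreal (norm (G (\<alpha>_seq n) s (v \<omega> s)))
                \<le> ennreal (exp (- \<beta> * (t - s))) * growth_bound UNIV F (norm (V s \<omega>))"
              by (intro mult_left_mono) auto
            then show ?thesis using True by (simp add: ennreal_mult)
          qed simp
        qed
      qed
      finally have gI: "ennreal (LINT s:{0..t}|lborel. ?g s) \<le> I" .
      have "ennreal (norm (Z (\<alpha>_seq n) t \<omega>)) \<le> ennreal (exp (- \<beta> * t) * norm x + (LINT s:{0..t}|lborel. ?g s))"
        by (rule ennreal_leI[OF Z_norm_le[OF \<alpha> \<omega> t]])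
      also have "\<dots> = ennreal (exp (- \<beta> * t) * norm x) + ennreal (LINT s:{0..t}|lborel. ?g s)"
      proof (rule ennreal_plus)
        show "0 \<le> (LINT s:{0..t}|lborel. ?g s)"
          unfolding set_lebesgue_integral_def by (intro Bochner_Integration.integral_nonneg) auto
      qed simp
      also have "\<dots> \<le> ennreal (norm x * exp (- \<beta> * t)) + I"
        using gI by (intro add_mono) (simp_all add: mult.commute)
      finally show ?thesis .
    qed
    have "ennreal (norm (Zlim t \<omega>)) \<le> ennreal (norm x * exp (- \<beta> * t)) + I"
    proof (rule LIMSEQ_le_const2)
      show "(\<lambda>n. ennreal (norm (Z (\<alpha>_seq n) t \<omega>))) \<longlonglongrightarrow> ennreal (norm (Zlim t \<omega>))"
        by (intro tendsto_ennrealI tendsto_norm Z_converges \<omega> t)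
    qed (use le in blast)
    moreover have "ennreal (norm (Zlim t \<omega> + V t \<omega>)) \<le> ennreal (norm (Zlim t \<omega>)) + ennreal (norm (V t \<omega>))"
      by (simp add: ennreal_plus[symmetric] norm_triangle_ineq ennreal_leI del: ennreal_plus)
    ultimately show "ennreal (norm (Zlim t \<omega> + V t \<omega>)) \<le> ennreal (norm x * exp (- \<beta> * t)) +
      (\<integral>\<^sup>+ s\<in>{0..t}. ennreal (exp (- \<beta> * (t - s))) * growth_bound UNIV F (norm (V s \<omega>)) \<partial>lborel) + ennreal (norm (V t \<omega>))"
      unfolding I_def by (meson add_right_mono order_trans)
  qed
qed

lemma limit_norm_le_time_product:
  "AE (t, \<omega>) in time_product M. ennreal (norm (Zlim t \<omega> + V t \<omega>)) \<le>
    ennreal (norm x * exp (- \<beta> * t)) +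
    (\<integral>\<^sup>+ s\<in>{0..t}. ennreal (exp (- \<beta> * (t - s))) * growth_bound UNIV F (norm (V s \<omega>)) \<partial>lborel) +
    ennreal (norm (V t \<omega>))"
proof -
  have "AE p in time_product M. \<forall>t\<ge>0. ennreal (norm (Zlim t (snd p) + V t (snd p))) \<le>
      ennreal (norm x * exp (- \<beta> * t)) +
      (\<integral>\<^sup>+ s\<in>{0..t}. ennreal (exp (- \<beta> * (t - s))) * growth_bound UNIV F (norm (V s (snd p))) \<partial>lborel) +
      ennreal (norm (V t (snd p)))"
    unfolding time_product_def by (rule AE_pair_snd[OF sigma_finite_measure_axioms limit_norm_le])
  then show ?thesis
    using AE_space by eventually_elim (auto simp: space_time_product)
qed

end

end

section \<open>The noise fills the domain\<close>

context prob_space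
begin

context
  fixes Filt :: "real \<Rightarrow> 'a measure"
    and W :: "real \<Rightarrow> 'h::{real_inner, banach, second_countable_topology} \<Rightarrow> 'a \<Rightarrow> real"
    and S :: "real \<Rightarrow> 'h \<Rightarrow>\<^sub>L 'h" and \<sigma> \<tau> :: "'h \<Rightarrow>\<^sub>L 'h" and V :: "real \<Rightarrow> 'a \<Rightarrow> 'h"
  assumes filtration: "usual_filtration M Filt"
    and wiener: "cylindrical_wiener M Filt W"
    and sg: "c0_semigroup S"
    and inverse: "\<sigma> o\<^sub>L \<tau> = id_blinfun"
    and OU: "stochastic_convolution M W S \<sigma> V"
begin

text \<open>The function \<open>\<phi> s = inner h (S (t - s) (\<sigma> y))\<close> is continuous, and at \<open>s = t\<close> it equals
  \<open>inner h (\<sigma> y)\<close>. This is positive when \<open>y\<close> is the normalised preimage of \<open>h\<close> under \<open>\<sigma>\<close>.\<close>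

lemma stochastic_convolution_nondegenerate:
  assumes t: "0 < t" and h: "h \<noteq> 0"
  shows "AE \<omega> in M. inner h (V t \<omega>) \<noteq> 0" "\<not> (AE \<omega> in M. inner h (V t \<omega>) \<le> c)"
proof -
  have \<sigma>\<tau>: "\<sigma> (\<tau> h) = h" using inverse by (metis blinfun_apply_blinfun_compose blinfun_apply_id_blinfun id_apply)
  then have \<tau>h: "\<tau> h \<noteq> 0" using h by (metis blinfun.zero_right)
  define y where "y = (1 / norm (\<tau> h)) *\<^sub>R \<tau> h"
  define \<phi> where "\<phi> s = inner h (S (max 0 (t - s)) (\<sigma> y))" for s
  have I: "is_wiener_integral M W t (\<lambda>s. S (t - s) o\<^sub>L \<sigma>) (V t)"
    using OU t by (simp add: stochastic_convolution_def)
  have y: "norm y \<le> 1" using \<tau>h by (simp add: y_def)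
  have "continuous_on UNIV (\<lambda>s. S (max 0 (t - s)) (\<sigma> y))"
    by (rule continuous_on_compose2[OF semigroup_continuous[OF sg, of "\<sigma> y"]]) (auto intro!: continuous_intros)
  then have cont: "continuous_on UNIV \<phi>" unfolding \<phi>_def by (intro continuous_on_inner continuous_on_const)
  have \<phi>: "\<phi> s = inner h ((S (t - s) o\<^sub>L \<sigma>) y)" if "s \<in> {0..t}" for s using that by (simp add: \<phi>_def)
  have "\<phi> t = (1 / norm (\<tau> h)) * inner h h"
    by (simp add: \<phi>_def semigroup_0[OF sg] y_def blinfun.scaleR_right \<sigma>\<tau>)
  then have pos: "0 < \<phi> t" using \<tau>h h by simp
  show "AE \<omega> in M. inner h (V t \<omega>) \<noteq> 0" "\<not> (AE \<omega> in M. inner h (V t \<omega>) \<le> c)"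
    by (rule wiener_integral_nondegenerate[OF filtration wiener I t y cont \<phi> pos]; assumption)+
qed

text \<open>A closed convex set different from the whole space lies in a half-space
  \<open>inner h u \<le> c\<close>. Since \<open>S t y + V t\<close> stays in it for almost every \<open>t\<close>, the variable \<open>inner h (V t)\<close>
  would be bounded above, contrary to nondegeneracy.\<close>

lemma invariant_domain_is_everything:
  assumes D: "D \<noteq> {}" and F_ne: "\<And>t y. t \<ge> 0 \<Longrightarrow> y \<in> D \<Longrightarrow> F t y \<noteq> {}"
    and inv: "\<And>y. y \<in> D \<Longrightarrow> AE (t, \<omega>) in time_product M. S t y + V t \<omega> \<in> D"
    and mdis: "\<And>t. t \<ge> 0 \<Longrightarrow> m_dissipative D (F t)"
    and growth: "\<And>r. r > 0 \<Longrightarrow> growth_bound D F r < \<infinity>"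
  shows "D = UNIV"
proof (rule ccontr)
  assume "D \<noteq> UNIV"
  then obtain p where p: "p \<notin> D" by blast
  have locbdd: "\<exists>a. \<forall>x\<in>D. norm x < r \<longrightarrow> norm (minimal_section (F 0) x) \<le> a" if r: "r > 0" for r
  proof (intro exI ballI impI)
    fix x assume x: "x \<in> D" "norm x < r"
    have "ennreal (norm (minimal_section (F 0) x)) \<le> growth_bound D F r"
      unfolding growth_bound_def
      by (rule SUP_upper2[of x], use x in simp, rule SUP_upper2[of 0]) auto
    also have "\<dots> = ennreal (enn2real (growth_bound D F r))" using growth[OF r] by (simp add: less_top)
    finally show "norm (minimal_section (F 0) x) \<le> enn2real (growth_bound D F r)" by simp
  qed
  have "closed D" by (rule closed_domain[OF mdis F_ne locbdd]) auto
  moreover have "convex D" by (rule convex_domain[OF mdis F_ne locbdd]) auto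
  ultimately obtain h where h: "h \<noteq> 0" "\<And>u. u \<in> D \<Longrightarrow> inner h u \<le> inner h p - (norm h)\<^sup>2"
    using separate_point_closed_convex[OF _ _ D p] by blast
  obtain y where y: "y \<in> D" using D by blast
  interpret T: sigma_finite_measure "restrict_space lborel {0::real..}"
    by (rule sigma_finite_measure_restrict_space[OF sigma_finite_lborel]) simp
  interpret TM: pair_sigma_finite "restrict_space lborel {0::real..}" M
    by (intro pair_sigma_finite.intro T.sigma_finite_measure_axioms sigma_finite_measure_axioms)
  have "AE t in restrict_space lborel {0..}. AE \<omega> in M. S t y + V t \<omega> \<in> D"
    using TM.AE_pair[OF inv[OF y, unfolded time_product_def]] by simp
  then have "AE t in lborel. t \<in> {0..} \<longrightarrow> (AE \<omega> in M. S t y + V t \<omega> \<in> D)"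
    by (subst (asm) AE_restrict_space_iff) auto
  \<comment> \<open>nondegeneracy rules out every \<open>t > 0\<close>, a set of positive measure\<close>
  then have "AE t in lborel. t \<notin> {0<..<1::real}"
  proof eventually_elim
    case (elim t)
    show ?case
    proof
      assume t: "t \<in> {0<..<1::real}"
      then have "AE \<omega> in M. S t y + V t \<omega> \<in> D" using elim by simp
      then have "AE \<omega> in M. inner h (V t \<omega>) \<le> inner h p - (norm h)\<^sup>2 - inner h (S t y)"
      proof eventually_elim
        case (elim \<omega>)
        from h(2)[OF this] show ?case by (simp add: inner_add_right)
      qed
      then show False using stochastic_convolution_nondegenerate(2)[OF _ h(1)] t by auto
    qed
  qed
  then have "emeasure lborel {0<..<1::real} = 0"
    by (subst (asm) AE_iff_measurable[of "{0<..<1::real}"]) auto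
  then show False by simp
qed

end

end

theorem theorem2p9:
  fixes M :: "'w measure"
    and Filt :: "real \<Rightarrow> 'w measure"
    and W :: "real \<Rightarrow> 'h::{real_inner, banach, second_countable_topology} \<Rightarrow> 'w \<Rightarrow> real"
    and A :: "'h \<Rightarrow> 'h" and D\<^sub>A :: "'h set"
    and S :: "real \<Rightarrow> ('h \<Rightarrow>\<^sub>L 'h)"
    and \<sigma> :: "'h \<Rightarrow>\<^sub>L 'h"
    and \<beta> \<epsilon> :: real
    and V :: "real \<Rightarrow> 'w \<Rightarrow> 'h"
    and D\<^sub>F :: "'h set" and F :: "real \<Rightarrow> 'h \<Rightarrow> 'h set"
    and x :: 'h
  assumes prob: "prob_space M"
    and filtration: "usual_filtration M Filt"
    and wiener: "cylindrical_wiener M Filt W"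
    and A1_generator: "generates_c0_semigroup A D\<^sub>A S"
    and A1_beta: "\<beta> > 0"
    and A1_dissipative: "\<And>y. y \<in> D\<^sub>A \<Longrightarrow> inner (A y) y \<le> - \<beta> * (norm y)\<^sup>2"
    and A2_inverse: "\<exists>\<tau> :: 'h \<Rightarrow>\<^sub>L 'h. \<tau> o\<^sub>L \<sigma> = id_blinfun \<and> \<sigma> o\<^sub>L \<tau> = id_blinfun"
    and A2_selfadjoint: "\<And>y z. inner (\<sigma> y) z = inner y (\<sigma> z)"
    and A2_positive: "\<And>y. inner (\<sigma> y) y \<ge> 0"
    and A2_epsilon: "\<epsilon> > 0"
    and A2_integral: "\<And>T. T > 0 \<Longrightarrow>
      (\<integral>\<^sup>+ t\<in>{0<..T}. ennreal (t powr (- \<epsilon>)) * hs_norm_sq (S t o\<^sub>L \<sigma>) \<partial>lborel) < \<infinity>"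
    and OU: "stochastic_convolution M W S \<sigma> V"
    and A3_domain: "D\<^sub>F \<noteq> {}" "D\<^sub>F \<in> sets borel"
    and A3_nonempty: "\<And>t y. t \<ge> 0 \<Longrightarrow> y \<in> D\<^sub>F \<Longrightarrow> F t y \<noteq> {}"
    and A3_OU: "\<And>y. y \<in> D\<^sub>F \<Longrightarrow> AE (t, \<omega>) in time_product M. S t y + V t \<omega> \<in> D\<^sub>F"
    and A3_m_dissipative: "\<And>t. t \<ge> 0 \<Longrightarrow> m_dissipative D\<^sub>F (F t)"
    and F0_measurable: "(\<lambda>(t, y). minimal_section (F t) y)
      \<in> borel_measurable (restrict_space borel ({0..} \<times> D\<^sub>F))"
    and F\<alpha>_measurable: "\<And>\<alpha>. \<alpha> > 0 \<Longrightarrow> (\<lambda>(t, y). yosida D\<^sub>F (F t) \<alpha> y)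
      \<in> borel_measurable (restrict_space borel ({0..} \<times> UNIV))"
    and A4: "\<And>r. r > 0 \<Longrightarrow> growth_bound D\<^sub>F F r < \<infinity>"
  shows "\<exists>X Z. pseudo_weak_solution M Filt S D\<^sub>F F V x X \<and>
    (\<exists>Z\<^sub>\<alpha>. (\<forall>\<alpha>>0. random_mild_solution M Filt S (\<lambda>t. yosida D\<^sub>F (F t) \<alpha>) V x (Z\<^sub>\<alpha> \<alpha>)) \<and>
       pseudo_weak_limit_point M Z\<^sub>\<alpha> Z) \<and>
    (\<forall>t\<ge>0. \<forall>\<omega>\<in>space M. X t \<omega> = Z t \<omega> + V t \<omega>) \<and>
    (AE (t, \<omega>) in time_product M.
       ennreal (norm (X t \<omega>)) \<le>
         ennreal (norm x * exp (- \<beta> * t)) +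
         (\<integral>\<^sup>+ s\<in>{0..t}. ennreal (exp (- \<beta> * (t - s))) * growth_bound D\<^sub>F F (norm (V s \<omega>)) \<partial>lborel) +
         ennreal (norm (V t \<omega>)))"
proof -
  interpret prob_space M by (rule prob)
  obtain \<tau> where \<tau>: "\<sigma> o\<^sub>L \<tau> = id_blinfun" using A2_inverse by blast
  have sg: "c0_semigroup S" using A1_generator by (simp add: generates_c0_semigroup_def)
  note noise = filtration wiener sg \<tau> OU
  have D: "D\<^sub>F = UNIV"
    by (rule invariant_domain_is_everything[OF noise A3_domain(1) A3_nonempty A3_OU A3_m_dissipative A4])
  have V_adapted: "V t \<in> borel_measurable (Filt t)" if "t \<ge> 0" for t
    using wiener_integral_measurable_filtration[OF filtration wiener _ that] OU that
    unfolding stochastic_convolution_def by blast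
  have V_cont: "continuous_on {0..} (\<lambda>t. V t \<omega>)" if "\<omega> \<in> space M" for \<omega>
    using OU that unfolding stochastic_convolution_def by blast
  have V_nonzero: "\<forall>s>0. AE \<omega> in M. V s \<omega> \<noteq> 0" if h: "h \<noteq> 0" for h :: 'h
  proof (intro allI impI)
    fix s :: real assume "s > 0"
    from stochastic_convolution_nondegenerate(1)[OF noise this h]
    show "AE \<omega> in M. V s \<omega> \<noteq> 0" by eventually_elim auto
  qed
  interpret E: whole_space_equation M Filt S \<beta> V F x
  proof
    show "subalgebra M (Filt t)" if "t \<ge> 0" for t by (rule filtration_subalgebra_M[OF filtration that])
    show "subalgebra (Filt t) (Filt s)" if "0 \<le> s" "s \<le> t" for s t
      by (rule filtration_subalgebra[OF filtration that])
    show "norm (S t y) \<le> exp (- \<beta> * t) * norm y" if "t \<ge> 0" for t y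
      by (rule semigroup_decay[OF A1_generator A1_dissipative A1_beta that])
    show "m_dissipative UNIV (F t)" if "t \<ge> 0" for t using A3_m_dissipative[OF that] by (simp only: D)
    show "F t y \<noteq> {}" if "t \<ge> 0" for t y using A3_nonempty[OF that] by (simp only: D UNIV_I simp_thms)
    show "(\<lambda>(t, y). yosida UNIV (F t) \<alpha> y) \<in> borel_measurable (restrict_space borel ({0..} \<times> UNIV))"
      if "\<alpha> > 0" for \<alpha> using F\<alpha>_measurable[OF that] by (simp only: D)
    show "growth_bound UNIV F r < \<infinity>" if "r > 0" for r using A4[OF that] by (simp only: D)
  qed (fact sg A1_beta | rule V_adapted V_cont; assumption)+
  show ?thesis
    unfolding D
  proof (intro exI conjI)
    show "pseudo_weak_solution M Filt S UNIV F V x (\<lambda>t \<omega>. E.Zlim t \<omega> + V t \<omega>)"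
      by (rule E.limit_pseudo_weak_solution)
    show "\<forall>\<alpha>>0. random_mild_solution M Filt S (\<lambda>t. yosida UNIV (F t) \<alpha>) V x (E.Z \<alpha>)"
      using E.Z_random_mild_solution by blast
    show "pseudo_weak_limit_point M E.Z E.Zlim" by (rule E.Z_limit_point)
    show "\<forall>t\<ge>0. \<forall>\<omega>\<in>space M. E.Zlim t \<omega> + V t \<omega> = E.Zlim t \<omega> + V t \<omega>" by simp
  qed (rule E.limit_norm_le_time_product[OF V_nonzero])
qed

end
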